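(* Let the relator's involution $m_{\langle p,s\rangle,\langle r,t\rangle}:(p\otimes s)\otimes(r\otimes t)\to(p\otimes r)\otimes(s\otimes t)$ be a natural isomorphism in $V$, and let $T$ be a small $V$-enriched category. Then in the category $\mathrm{Cat}_V^{=}$ of natural functors between $V$-enriched categories: 1. $X\mapsto X\otimes T$ defines a superfunctor, sending a natural functor $g:X\Rightarrow Y$ to the natural functor $g\otimes\mathrm{Id}_T:X\otimes T\Rightarrow Y\otimes T$. 2. The exponential space of natural transforms between natural functors $Y\mapsto Y_{=}^{(T)=}$ defines a coadjoint superfunctor; for a natural functor $f:X\Rightarrow Y$ the changing of target space $f^T:X^T\Rightarrow Y^T$ restricts to $f_{=}^{(T)=}:X_{=}^{(T)=}\Rightarrow Y_{=}^{(T)=}$. 3. The unit transform is given by natural sections functors $\lambda_X:X\Rightarrow(X\otimes T)_{=}^{(T)=}$; they are natural in $X$ even with respect to arbitrary original $V$-graphs transports $f:X\Rightarrow Y$. 4. The counit transform is given by natural evaluation functors $\mathrm{ev}_Y:Y_{=}^{(T)=}\otimes T\Rightarrow Y$; they are natural with respect to natural functors $g:Y\Rightarrow Y'$. 5. The name appointment $\mathrm{Cat}_V^{=}(X\otimes T;Y)\to\mathrm{Cat}_V^{=}(X;Y_{=}^{(T)=})$, sending $f$ to $\lambda_X$ followed by $f^T$, and the realization appointment $\mathrm{Cat}_V^{=}(X;Y_{=}^{(T)=})\to\mathrm{Cat}_V^{=}(X\otimes T;Y)$, sending $g$ to $g\otimes\mathrm{Id}_T$ followed by $\mathrm{ev}_Y$,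 are mutually inverse bijections, natural for natural functors $X\Rightarrow X'$ and $Y\Rightarrow Y'$. So the first triangular equality is obtained from the name of $\mathrm{Id}_{X\otimes T}$ and the second from the realization of $\mathrm{Id}_{Y_{=}^{(T)=}}$.
   Context: $V$ is a small-complete monoidal closed category with tensor product $\otimes$ (called a biproduct; not a categorical biproduct), natural associativity isomorphisms satisfying the pentagon, the final object $*$ as unit, and exponentials $t^s$ with natural bijection $V(r\otimes s;t)\cong V(r;t^s)$; it has relator's involution arrows $m$ (used as an interchange, in particular, with units, as $r\otimes s\cong s\otimes r$), and the tensor product is required to maintain products: $\prod_s(p_s\otimes r_s)=(\prod_s p_s)\otimes(\prod_s r_s)$. A $V$-graph $X$ is a set $X_0$ with objects $X(x;y)\in V$; an original $V$-graph also has units $1_x:*\to X(x;x)$; an (original) $V$-graphs transport $f:X\Rightarrow Y$ is a vertex map $f_0$ with mappings $f_{x,y}:X(x;y)\to Y(f_0(x);f_0(y))$ (maintaining units). A $V$-enriched category is an original $V$-graph with associative, unital composition mappings $X(x;y)\otimes X(y;z)\to X(x;y)\circ X(y;z)\subset X(x;z)$ (diagrammatic order). A natural functor is a $V$-functor in the usual sense (transport maintaining units and composition); "superfunctor" means a functor on a category of such functors. $X\otimes T$ has objects $X_0\times T_0$, arrows objects $X(x;x')\otimes T(s;s')$, units $1_x\otimes1_s$ and composition defined by $m$ followed by the composition mappings of $X$ and $T$. $Y^T$ has as vertexes transports $\phi:T\Rightarrow Y$ and $Y^T(\phi;\psi)=\prod_{s\in T_0}Y(\phi_0(s);\psi_0(s))$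 with componentwise units and composition. $Y_{=}^{(T)=}$ has as objects the natural functors $\phi:T\Rightarrow Y$, and $Y_{=}^{(T)=}(\phi;\psi)$ is the equalizer of the two mappings $\prod_{s}Y(\phi_0(s);\psi_0(s))\rightrightarrows\prod_{s,t\in T_0}Y(\phi_0(s);\psi_0(t))^{T(s;t)}$ that are the names of $Y(\phi_0(s);\psi_0(s))\circ\psi_{s,t}(T(s;t))$ and $\phi_{s,t}(T(s;t))\circ Y(\phi_0(t);\psi_0(t))$. $f^T$ sends $\phi$ to $\phi$ followed by $f$ and is $\prod_s f_{\phi_0(s),\psi_0(s)}$ on edges. $\lambda_X$ sends $x$ to the section $s\mapsto\langle x,s\rangle$ with edge mappings $T(s;t)\to1_x( * )\otimes T(s;t)$, and has edge mappings $X(x;y)\to\prod_s X(x;y)\otimes1_s( * )$. Naturality of sections for an original transport $f:X\Rightarrow Y$ means $f$ followed by $\lambda_Y$ equals $\lambda_X$ followed by $(f\otimes\mathrm{Id}_T)^T$. $\mathrm{ev}_Y$ sends $(\phi,s)$ to $\phi_0(s)$ with edge mappings $Y_{=}^{(T)=}(\phi;\psi)\otimes T(s;t)\to Y(\phi_0(s);\psi_0(s))\circ\psi_{s,t}(T(s;t))\subset Y(\phi_0(s);\psi_0(t))$.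
   Formalization: The relator's involution m is additionally assumed compatible with the unit isomorphisms of the tensor product (and involutive); with m merely a natural isomorphism X⊗T can fail the unit law, e.g. for sets with a Z/2-action and a twisted m. *)

theory Defs
  imports "HOL-Library.FuncSet"
begin

section \<open>Categories, limits, small completeness\<close>

text \<open>Composition is written in diagrammatic order: \<open>f \<cdot> g\<close> is \<open>f\<close> followed by \<open>g\<close>.\<close>

record ('o, 'm) cat =
  Ob :: "'o set"
  Hom :: "'o \<Rightarrow> 'o \<Rightarrow> 'm set"
  Idn :: "'o \<Rightarrow> 'm"
  Cmp :: "'m \<Rightarrow> 'm \<Rightarrow> 'm"  (infixl "\<cdot>\<index>" 65)

definition category :: "('o, 'm, 'c) cat_scheme \<Rightarrow> bool" where
  "category C \<longleftrightarrow>
    (\<forall>a\<in>Ob C. Idn C a \<in> Hom C a a) \<and>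
    (\<forall>a\<in>Ob C. \<forall>b\<in>Ob C. \<forall>c\<in>Ob C. \<forall>f\<in>Hom C a b. \<forall>g\<in>Hom C b c.
       f \<cdot>\<^bsub>C\<^esub> g \<in> Hom C a c) \<and>
    (\<forall>a\<in>Ob C. \<forall>b\<in>Ob C. \<forall>f\<in>Hom C a b. Idn C a \<cdot>\<^bsub>C\<^esub> f = f \<and> f \<cdot>\<^bsub>C\<^esub> Idn C b = f) \<and>
    (\<forall>a\<in>Ob C. \<forall>b\<in>Ob C. \<forall>c\<in>Ob C. \<forall>d\<in>Ob C.
       \<forall>f\<in>Hom C a b. \<forall>g\<in>Hom C b c. \<forall>h\<in>Hom C c d.
       (f \<cdot>\<^bsub>C\<^esub> g) \<cdot>\<^bsub>C\<^esub> h = f \<cdot>\<^bsub>C\<^esub> (g \<cdot>\<^bsub>C\<^esub> h))"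

definition inverse_arrows :: "('o, 'm, 'c) cat_scheme \<Rightarrow> 'o \<Rightarrow> 'o \<Rightarrow> 'm \<Rightarrow> 'm \<Rightarrow> bool" where
  "inverse_arrows C a b f g \<longleftrightarrow>
     f \<in> Hom C a b \<and> g \<in> Hom C b a \<and> f \<cdot>\<^bsub>C\<^esub> g = Idn C a \<and> g \<cdot>\<^bsub>C\<^esub> f = Idn C b"

definition is_iso :: "('o, 'm, 'c) cat_scheme \<Rightarrow> 'o \<Rightarrow> 'o \<Rightarrow> 'm \<Rightarrow> bool" where
  "is_iso C a b f \<longleftrightarrow> (\<exists>g. inverse_arrows C a b f g)"

definition arrow_inv :: "('o, 'm, 'c) cat_scheme \<Rightarrow> 'o \<Rightarrow> 'o \<Rightarrow> 'm \<Rightarrow> 'm" where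
  "arrow_inv C a b f = (THE g. inverse_arrows C a b f g)"

definition is_diagram ::
  "('i, 'j, 'd) cat_scheme \<Rightarrow> ('o, 'm, 'c) cat_scheme \<Rightarrow> ('i \<Rightarrow> 'o) \<Rightarrow> ('j \<Rightarrow> 'm) \<Rightarrow> bool" where
  "is_diagram J C D0 D1 \<longleftrightarrow>
    (\<forall>i\<in>Ob J. D0 i \<in> Ob C) \<and>
    (\<forall>i\<in>Ob J. \<forall>j\<in>Ob J. \<forall>u\<in>Hom J i j. D1 u \<in> Hom C (D0 i) (D0 j)) \<and>
    (\<forall>i\<in>Ob J. D1 (Idn J i) = Idn C (D0 i)) \<and>
    (\<forall>i\<in>Ob J. \<forall>j\<in>Ob J. \<forall>k\<in>Ob J. \<forall>u\<in>Hom J i j. \<forall>v\<in>Hom J j k.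
       D1 (u \<cdot>\<^bsub>J\<^esub> v) = D1 u \<cdot>\<^bsub>C\<^esub> D1 v)"

definition is_cone ::
  "('i, 'j, 'd) cat_scheme \<Rightarrow> ('o, 'm, 'c) cat_scheme \<Rightarrow> ('i \<Rightarrow> 'o) \<Rightarrow> ('j \<Rightarrow> 'm) \<Rightarrow>
   'o \<Rightarrow> ('i \<Rightarrow> 'm) \<Rightarrow> bool" where
  "is_cone J C D0 D1 a k \<longleftrightarrow>
    a \<in> Ob C \<and> (\<forall>i\<in>Ob J. k i \<in> Hom C a (D0 i)) \<and>
    (\<forall>i\<in>Ob J. \<forall>j\<in>Ob J. \<forall>u\<in>Hom J i j. k i \<cdot>\<^bsub>C\<^esub> D1 u = k j)"

definition is_limit ::
  "('i, 'j, 'd) cat_scheme \<Rightarrow> ('o, 'm, 'c) cat_scheme \<Rightarrow> ('i \<Rightarrow> 'o) \<Rightarrow> ('j \<Rightarrow> 'm) \<Rightarrow>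
   'o \<Rightarrow> ('i \<Rightarrow> 'm) \<Rightarrow> bool" where
  "is_limit J C D0 D1 l p \<longleftrightarrow>
    is_cone J C D0 D1 l p \<and>
    (\<forall>a k. is_cone J C D0 D1 a k \<longrightarrow>
       (\<exists>!u. u \<in> Hom C a l \<and> (\<forall>i\<in>Ob J. u \<cdot>\<^bsub>C\<^esub> p i = k i)))"

text \<open>
  The type \<open>'s\<close> plays the role of the universe of small sets: a small set is a subset
  of \<open>'s\<close>, a small category has its objects and its arrows in \<open>'s\<close>. The type \<open>'s\<close> is meant to
  be infinite, so that finite products of small sets are again small.
\<close>

definition small_complete :: "'s itself \<Rightarrow> ('o, 'm, 'c) cat_scheme \<Rightarrow> bool" where
  "small_complete U C \<longleftrightarrow>
    (\<forall>(J :: ('s, 's) cat) D0 D1. category J \<and> is_diagram J C D0 D1 \<longrightarrow>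
       (\<exists>l p. is_limit J C D0 D1 l p))"

definition is_terminal :: "('o, 'm, 'c) cat_scheme \<Rightarrow> 'o \<Rightarrow> bool" where
  "is_terminal C t \<longleftrightarrow> t \<in> Ob C \<and> (\<forall>a\<in>Ob C. \<exists>!f. f \<in> Hom C a t)"

definition is_product ::
  "('o, 'm, 'c) cat_scheme \<Rightarrow> 'i set \<Rightarrow> ('i \<Rightarrow> 'o) \<Rightarrow> 'o \<Rightarrow> ('i \<Rightarrow> 'm) \<Rightarrow> bool" where
  "is_product C I p P q \<longleftrightarrow>
    P \<in> Ob C \<and> (\<forall>i\<in>I. q i \<in> Hom C P (p i)) \<and>
    (\<forall>a\<in>Ob C. \<forall>k. (\<forall>i\<in>I. k i \<in> Hom C a (p i)) \<longrightarrow>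
       (\<exists>!u. u \<in> Hom C a P \<and> (\<forall>i\<in>I. u \<cdot>\<^bsub>C\<^esub> q i = k i)))"

definition is_equalizer ::
  "('o, 'm, 'c) cat_scheme \<Rightarrow> 'o \<Rightarrow> 'o \<Rightarrow> 'm \<Rightarrow> 'm \<Rightarrow> 'o \<Rightarrow> 'm \<Rightarrow> bool" where
  "is_equalizer C a b f g E e \<longleftrightarrow>
    E \<in> Ob C \<and> e \<in> Hom C E a \<and> e \<cdot>\<^bsub>C\<^esub> f = e \<cdot>\<^bsub>C\<^esub> g \<and>
    (\<forall>c\<in>Ob C. \<forall>h\<in>Hom C c a. h \<cdot>\<^bsub>C\<^esub> f = h \<cdot>\<^bsub>C\<^esub> g \<longrightarrow>
       (\<exists>!u. u \<in> Hom C c E \<and> u \<cdot>\<^bsub>C\<^esub> e = h))"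

text \<open>Chosen products and equalizers (meaningful whenever one exists).\<close>

definition prod_cone :: "('o, 'm, 'c) cat_scheme \<Rightarrow> 'i set \<Rightarrow> ('i \<Rightarrow> 'o) \<Rightarrow> 'o \<times> ('i \<Rightarrow> 'm)" where
  "prod_cone C I p = (SOME Pq. is_product C I p (fst Pq) (snd Pq))"

definition prod_ob :: "('o, 'm, 'c) cat_scheme \<Rightarrow> 'i set \<Rightarrow> ('i \<Rightarrow> 'o) \<Rightarrow> 'o" where
  "prod_ob C I p = fst (prod_cone C I p)"

definition proj :: "('o, 'm, 'c) cat_scheme \<Rightarrow> 'i set \<Rightarrow> ('i \<Rightarrow> 'o) \<Rightarrow> 'i \<Rightarrow> 'm" where
  "proj C I p = snd (prod_cone C I p)"

definition tuple ::
  "('o, 'm, 'c) cat_scheme \<Rightarrow> 'i set \<Rightarrow> ('i \<Rightarrow> 'o) \<Rightarrow> 'o \<Rightarrow> ('i \<Rightarrow> 'm) \<Rightarrow> 'm" where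
  "tuple C I p a k =
    (THE u. u \<in> Hom C a (prod_ob C I p) \<and> (\<forall>i\<in>I. u \<cdot>\<^bsub>C\<^esub> proj C I p i = k i))"

definition eq_cone :: "('o, 'm, 'c) cat_scheme \<Rightarrow> 'o \<Rightarrow> 'o \<Rightarrow> 'm \<Rightarrow> 'm \<Rightarrow> 'o \<times> 'm" where
  "eq_cone C a b f g = (SOME Ee. is_equalizer C a b f g (fst Ee) (snd Ee))"

section \<open>The base category\<close>

text \<open>
  \<open>p \<otimes> r\<close> is the tensor product of objects, \<open>f \<odot> g\<close> that of arrows, \<open>Asc p q r\<close> goes from
  \<open>(p \<otimes> q) \<otimes> r\<close> to \<open>p \<otimes> (q \<otimes> r)\<close>, \<open>Lun p\<close> from \<open>\<star> \<otimes> p\<close> to \<open>p\<close> and \<open>Run p\<close> from \<open>p \<otimes> \<star>\<close> to \<open>p\<close>.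
  \<open>Exp t s\<close> is the exponential \<open>t\<close> to the power \<open>s\<close>; \<open>Nam r s t\<close> maps the arrows
  \<open>r \<otimes> s \<rightarrow> t\<close> to their names \<open>r \<rightarrow> Exp t s\<close>.
  \<open>Mid p s r t\<close> is the interchange arrow with indices \<open>\<langle>p,s\<rangle>, \<langle>r,t\<rangle>\<close>, going from
  \<open>(p \<otimes> s) \<otimes> (r \<otimes> t)\<close> to \<open>(p \<otimes> r) \<otimes> (s \<otimes> t)\<close>.
\<close>

record ('o, 'm) relcat = "('o, 'm) cat" +
  TenO :: "'o \<Rightarrow> 'o \<Rightarrow> 'o"  (infixr "\<otimes>\<index>" 75)
  TenM :: "'m \<Rightarrow> 'm \<Rightarrow> 'm"  (infixr "\<odot>\<index>" 75)
  Unit :: 'o  ("\<star>\<index>")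
  Asc :: "'o \<Rightarrow> 'o \<Rightarrow> 'o \<Rightarrow> 'm"
  Lun :: "'o \<Rightarrow> 'm"
  Run :: "'o \<Rightarrow> 'm"
  Exp :: "'o \<Rightarrow> 'o \<Rightarrow> 'o"
  Nam :: "'o \<Rightarrow> 'o \<Rightarrow> 'o \<Rightarrow> 'm \<Rightarrow> 'm"
  Mid :: "'o \<Rightarrow> 'o \<Rightarrow> 'o \<Rightarrow> 'o \<Rightarrow> 'm"

definition tensor_bifunctor :: "('o, 'm, 'c) relcat_scheme \<Rightarrow> bool" where
  "tensor_bifunctor V \<longleftrightarrow>
    (\<forall>a\<in>Ob V. \<forall>b\<in>Ob V. a \<otimes>\<^bsub>V\<^esub> b \<in> Ob V \<and>
       Idn V a \<odot>\<^bsub>V\<^esub> Idn V b = Idn V (a \<otimes>\<^bsub>V\<^esub> b)) \<and>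
    (\<forall>a\<in>Ob V. \<forall>a'\<in>Ob V. \<forall>b\<in>Ob V. \<forall>b'\<in>Ob V. \<forall>f\<in>Hom V a a'. \<forall>g\<in>Hom V b b'.
       f \<odot>\<^bsub>V\<^esub> g \<in> Hom V (a \<otimes>\<^bsub>V\<^esub> b) (a' \<otimes>\<^bsub>V\<^esub> b')) \<and>
    (\<forall>a\<in>Ob V. \<forall>a'\<in>Ob V. \<forall>a''\<in>Ob V. \<forall>b\<in>Ob V. \<forall>b'\<in>Ob V. \<forall>b''\<in>Ob V.
       \<forall>f\<in>Hom V a a'. \<forall>f'\<in>Hom V a' a''. \<forall>g\<in>Hom V b b'. \<forall>g'\<in>Hom V b' b''.
       (f \<cdot>\<^bsub>V\<^esub> f') \<odot>\<^bsub>V\<^esub> (g \<cdot>\<^bsub>V\<^esub> g') = (f \<odot>\<^bsub>V\<^esub> g) \<cdot>\<^bsub>V\<^esub> (f' \<odot>\<^bsub>V\<^esub> g'))"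

definition associativity :: "('o, 'm, 'c) relcat_scheme \<Rightarrow> bool" where
  "associativity V \<longleftrightarrow>
    (\<forall>a\<in>Ob V. \<forall>b\<in>Ob V. \<forall>c\<in>Ob V.
       is_iso V ((a \<otimes>\<^bsub>V\<^esub> b) \<otimes>\<^bsub>V\<^esub> c) (a \<otimes>\<^bsub>V\<^esub> (b \<otimes>\<^bsub>V\<^esub> c)) (Asc V a b c)) \<and>
    (\<forall>a\<in>Ob V. \<forall>a'\<in>Ob V. \<forall>b\<in>Ob V. \<forall>b'\<in>Ob V. \<forall>c\<in>Ob V. \<forall>c'\<in>Ob V.
       \<forall>f\<in>Hom V a a'. \<forall>g\<in>Hom V b b'. \<forall>h\<in>Hom V c c'.
       ((f \<odot>\<^bsub>V\<^esub> g) \<odot>\<^bsub>V\<^esub> h) \<cdot>\<^bsub>V\<^esub> Asc V a' b' c' = Asc V a b c \<cdot>\<^bsub>V\<^esub> (f \<odot>\<^bsub>V\<^esub> (g \<odot>\<^bsub>V\<^esub> h))) \<and>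
    (\<forall>a\<in>Ob V. \<forall>b\<in>Ob V. \<forall>c\<in>Ob V. \<forall>d\<in>Ob V.
       (Asc V a b c \<odot>\<^bsub>V\<^esub> Idn V d) \<cdot>\<^bsub>V\<^esub> Asc V a (b \<otimes>\<^bsub>V\<^esub> c) d \<cdot>\<^bsub>V\<^esub> (Idn V a \<odot>\<^bsub>V\<^esub> Asc V b c d) =
       Asc V (a \<otimes>\<^bsub>V\<^esub> b) c d \<cdot>\<^bsub>V\<^esub> Asc V a b (c \<otimes>\<^bsub>V\<^esub> d))"

definition final_unit :: "('o, 'm, 'c) relcat_scheme \<Rightarrow> bool" where
  "final_unit V \<longleftrightarrow>
    is_terminal V \<star>\<^bsub>V\<^esub> \<and>
    (\<forall>a\<in>Ob V. is_iso V (\<star>\<^bsub>V\<^esub> \<otimes>\<^bsub>V\<^esub> a) a (Lun V a) \<and> is_iso V (a \<otimes>\<^bsub>V\<^esub> \<star>\<^bsub>V\<^esub>) a (Run V a)) \<and>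
    (\<forall>a\<in>Ob V. \<forall>b\<in>Ob V. \<forall>f\<in>Hom V a b.
       (Idn V \<star>\<^bsub>V\<^esub> \<odot>\<^bsub>V\<^esub> f) \<cdot>\<^bsub>V\<^esub> Lun V b = Lun V a \<cdot>\<^bsub>V\<^esub> f \<and>
       (f \<odot>\<^bsub>V\<^esub> Idn V \<star>\<^bsub>V\<^esub>) \<cdot>\<^bsub>V\<^esub> Run V b = Run V a \<cdot>\<^bsub>V\<^esub> f) \<and>
    (\<forall>a\<in>Ob V. \<forall>b\<in>Ob V.
       Asc V a \<star>\<^bsub>V\<^esub> b \<cdot>\<^bsub>V\<^esub> (Idn V a \<odot>\<^bsub>V\<^esub> Lun V b) = Run V a \<odot>\<^bsub>V\<^esub> Idn V b)"

text \<open>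
  Naturality in \<open>s\<close> and \<open>t\<close> is what defines the exponential on arrows, so only
  naturality in \<open>r\<close> is a condition.
\<close>

definition exponentials :: "('o, 'm, 'c) relcat_scheme \<Rightarrow> bool" where
  "exponentials V \<longleftrightarrow>
    (\<forall>s\<in>Ob V. \<forall>t\<in>Ob V. Exp V t s \<in> Ob V) \<and>
    (\<forall>r\<in>Ob V. \<forall>s\<in>Ob V. \<forall>t\<in>Ob V.
       bij_betw (Nam V r s t) (Hom V (r \<otimes>\<^bsub>V\<^esub> s) t) (Hom V r (Exp V t s))) \<and>
    (\<forall>r\<in>Ob V. \<forall>r'\<in>Ob V. \<forall>s\<in>Ob V. \<forall>t\<in>Ob V. \<forall>h\<in>Hom V r' r. \<forall>f\<in>Hom V (r \<otimes>\<^bsub>V\<^esub> s) t.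
       Nam V r' s t ((h \<odot>\<^bsub>V\<^esub> Idn V s) \<cdot>\<^bsub>V\<^esub> f) = h \<cdot>\<^bsub>V\<^esub> Nam V r s t f)"

definition monoidal_closed :: "('o, 'm, 'c) relcat_scheme \<Rightarrow> bool" where
  "monoidal_closed V \<longleftrightarrow>
    category V \<and> tensor_bifunctor V \<and> associativity V \<and> final_unit V \<and> exponentials V"

text \<open>
  The equality of \<open>\<Prod>\<^sub>s (p\<^sub>s \<otimes> r\<^sub>s)\<close> and \<open>(\<Prod>\<^sub>s p\<^sub>s) \<otimes> (\<Prod>\<^sub>s r\<^sub>s)\<close> is the canonical one: the tensor
  products of the projections form a product cone.
\<close>

definition tensor_maintains_products :: "'s itself \<Rightarrow> ('o, 'm, 'c) relcat_scheme \<Rightarrow> bool" where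
  "tensor_maintains_products U V \<longleftrightarrow>
    (\<forall>(S :: 's set) p r P R u v.
       (\<forall>s\<in>S. p s \<in> Ob V \<and> r s \<in> Ob V) \<and> is_product V S p P u \<and> is_product V S r R v \<longrightarrow>
       is_product V S (\<lambda>s. p s \<otimes>\<^bsub>V\<^esub> r s) (P \<otimes>\<^bsub>V\<^esub> R) (\<lambda>s. u s \<odot>\<^bsub>V\<^esub> v s))"

text \<open>
  The unit conditions are those of a monoidal functor \<open>V \<times> V \<rightarrow> V\<close>
  with underlying functor \<open>\<otimes>\<close>, structure arrows \<open>m\<close> and unit comparison \<open>\<star> \<cong> \<star> \<otimes> \<star>\<close>.
\<close>

definition relator_involution :: "('o, 'm, 'c) relcat_scheme \<Rightarrow> bool" where
  "relator_involution V \<longleftrightarrow>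
    (\<forall>p\<in>Ob V. \<forall>s\<in>Ob V. \<forall>r\<in>Ob V. \<forall>t\<in>Ob V.
       Mid V p s r t \<in> Hom V ((p \<otimes>\<^bsub>V\<^esub> s) \<otimes>\<^bsub>V\<^esub> (r \<otimes>\<^bsub>V\<^esub> t)) ((p \<otimes>\<^bsub>V\<^esub> r) \<otimes>\<^bsub>V\<^esub> (s \<otimes>\<^bsub>V\<^esub> t)) \<and>
       Mid V p s r t \<cdot>\<^bsub>V\<^esub> Mid V p r s t = Idn V ((p \<otimes>\<^bsub>V\<^esub> s) \<otimes>\<^bsub>V\<^esub> (r \<otimes>\<^bsub>V\<^esub> t))) \<and>
    (\<forall>r\<in>Ob V. \<forall>t\<in>Ob V.
       (Lun V \<star>\<^bsub>V\<^esub> \<odot>\<^bsub>V\<^esub> Idn V (r \<otimes>\<^bsub>V\<^esub> t)) \<cdot>\<^bsub>V\<^esub> Lun V (r \<otimes>\<^bsub>V\<^esub> t) =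
       Mid V \<star>\<^bsub>V\<^esub> \<star>\<^bsub>V\<^esub> r t \<cdot>\<^bsub>V\<^esub> (Lun V r \<odot>\<^bsub>V\<^esub> Lun V t)) \<and>
    (\<forall>p\<in>Ob V. \<forall>s\<in>Ob V.
       (Idn V (p \<otimes>\<^bsub>V\<^esub> s) \<odot>\<^bsub>V\<^esub> Lun V \<star>\<^bsub>V\<^esub>) \<cdot>\<^bsub>V\<^esub> Run V (p \<otimes>\<^bsub>V\<^esub> s) =
       Mid V p s \<star>\<^bsub>V\<^esub> \<star>\<^bsub>V\<^esub> \<cdot>\<^bsub>V\<^esub> (Run V p \<odot>\<^bsub>V\<^esub> Run V s))"

definition involution_natural_iso :: "('o, 'm, 'c) relcat_scheme \<Rightarrow> bool" where
  "involution_natural_iso V \<longleftrightarrow>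
    (\<forall>p\<in>Ob V. \<forall>s\<in>Ob V. \<forall>r\<in>Ob V. \<forall>t\<in>Ob V.
       is_iso V ((p \<otimes>\<^bsub>V\<^esub> s) \<otimes>\<^bsub>V\<^esub> (r \<otimes>\<^bsub>V\<^esub> t)) ((p \<otimes>\<^bsub>V\<^esub> r) \<otimes>\<^bsub>V\<^esub> (s \<otimes>\<^bsub>V\<^esub> t)) (Mid V p s r t)) \<and>
    (\<forall>p\<in>Ob V. \<forall>s\<in>Ob V. \<forall>r\<in>Ob V. \<forall>t\<in>Ob V. \<forall>p'\<in>Ob V. \<forall>s'\<in>Ob V. \<forall>r'\<in>Ob V. \<forall>t'\<in>Ob V.
       \<forall>f\<in>Hom V p p'. \<forall>g\<in>Hom V s s'. \<forall>h\<in>Hom V r r'. \<forall>k\<in>Hom V t t'.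
       ((f \<odot>\<^bsub>V\<^esub> g) \<odot>\<^bsub>V\<^esub> (h \<odot>\<^bsub>V\<^esub> k)) \<cdot>\<^bsub>V\<^esub> Mid V p' s' r' t' =
       Mid V p s r t \<cdot>\<^bsub>V\<^esub> ((f \<odot>\<^bsub>V\<^esub> h) \<odot>\<^bsub>V\<^esub> (g \<odot>\<^bsub>V\<^esub> k)))"

abbreviation lun_inv :: "('o, 'm, 'c) relcat_scheme \<Rightarrow> 'o \<Rightarrow> 'm" where
  "lun_inv V a \<equiv> arrow_inv V (\<star>\<^bsub>V\<^esub> \<otimes>\<^bsub>V\<^esub> a) a (Lun V a)"

abbreviation run_inv :: "('o, 'm, 'c) relcat_scheme \<Rightarrow> 'o \<Rightarrow> 'm" where
  "run_inv V a \<equiv> arrow_inv V (a \<otimes>\<^bsub>V\<^esub> \<star>\<^bsub>V\<^esub>) a (Run V a)"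

text \<open>
  The symmetry \<open>r \<otimes> s \<cong> (\<star> \<otimes> r) \<otimes> (s \<otimes> \<star>) \<rightarrow> (\<star> \<otimes> s) \<otimes> (r \<otimes> \<star>) \<cong> s \<otimes> r\<close> obtained from the
  interchange.
\<close>

definition swap :: "('o, 'm, 'c) relcat_scheme \<Rightarrow> 'o \<Rightarrow> 'o \<Rightarrow> 'm" where
  "swap V r s =
    (lun_inv V r \<odot>\<^bsub>V\<^esub> run_inv V s) \<cdot>\<^bsub>V\<^esub> Mid V \<star>\<^bsub>V\<^esub> r s \<star>\<^bsub>V\<^esub> \<cdot>\<^bsub>V\<^esub> (Lun V s \<odot>\<^bsub>V\<^esub> Run V r)"

section \<open>Graphs, enriched categories, transports, natural functors\<close>

record ('x, 'o) vgraph =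
  Vert :: "'x set"
  Edg :: "'x \<Rightarrow> 'x \<Rightarrow> 'o"

record ('x, 'o, 'm) ovgraph = "('x, 'o) vgraph" +
  Unt :: "'x \<Rightarrow> 'm"

record ('x, 'o, 'm) vcat = "('x, 'o, 'm) ovgraph" +
  Comps :: "'x \<Rightarrow> 'x \<Rightarrow> 'x \<Rightarrow> 'm"

definition original_graph ::
  "('o, 'm, 'c) relcat_scheme \<Rightarrow> ('x, 'o, 'm, 'e) ovgraph_scheme \<Rightarrow> bool" where
  "original_graph V X \<longleftrightarrow>
    (\<forall>x\<in>Vert X. \<forall>y\<in>Vert X. Edg X x y \<in> Ob V) \<and>
    (\<forall>x\<in>Vert X. Unt X x \<in> Hom V \<star>\<^bsub>V\<^esub> (Edg X x x))"

definition enriched :: "('o, 'm, 'c) relcat_scheme \<Rightarrow> ('x, 'o, 'm) vcat \<Rightarrow> bool" where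
  "enriched V X \<longleftrightarrow>
    original_graph V X \<and>
    (\<forall>x\<in>Vert X. \<forall>y\<in>Vert X. \<forall>z\<in>Vert X.
       Comps X x y z \<in> Hom V (Edg X x y \<otimes>\<^bsub>V\<^esub> Edg X y z) (Edg X x z)) \<and>
    (\<forall>w\<in>Vert X. \<forall>x\<in>Vert X. \<forall>y\<in>Vert X. \<forall>z\<in>Vert X.
       (Comps X w x y \<odot>\<^bsub>V\<^esub> Idn V (Edg X y z)) \<cdot>\<^bsub>V\<^esub> Comps X w y z =
       Asc V (Edg X w x) (Edg X x y) (Edg X y z) \<cdot>\<^bsub>V\<^esub>
         (Idn V (Edg X w x) \<odot>\<^bsub>V\<^esub> Comps X x y z) \<cdot>\<^bsub>V\<^esub> Comps X w x z) \<and>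
    (\<forall>x\<in>Vert X. \<forall>y\<in>Vert X.
       (Unt X x \<odot>\<^bsub>V\<^esub> Idn V (Edg X x y)) \<cdot>\<^bsub>V\<^esub> Comps X x x y = Lun V (Edg X x y) \<and>
       (Idn V (Edg X x y) \<odot>\<^bsub>V\<^esub> Unt X y) \<cdot>\<^bsub>V\<^esub> Comps X x y y = Run V (Edg X x y))"

record ('x, 'y, 'm) transport =
  on_vert :: "'x \<Rightarrow> 'y"
  on_edge :: "'x \<Rightarrow> 'x \<Rightarrow> 'm"

text \<open>
  Transports are extensional: outside the vertex set of the source their components
  have the value \<open>undefined\<close>, so that equality of transports is equality of components.
\<close>

definition mk_transport :: "'x set \<Rightarrow> ('x \<Rightarrow> 'y) \<Rightarrow> ('x \<Rightarrow> 'x \<Rightarrow> 'm) \<Rightarrow> ('x, 'y, 'm) transport" where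
  "mk_transport A f0 f1 =
    \<lparr>on_vert = restrict f0 A,
     on_edge = (\<lambda>x y. if x \<in> A \<and> y \<in> A then f1 x y else undefined)\<rparr>"

definition original_transports ::
  "('o, 'm, 'c) relcat_scheme \<Rightarrow> ('x, 'o, 'm, 'd) ovgraph_scheme \<Rightarrow> ('y, 'o, 'm, 'e) ovgraph_scheme \<Rightarrow>
   ('x, 'y, 'm) transport set" where
  "original_transports V X Y = {f.
    mk_transport (Vert X) (on_vert f) (on_edge f) = f \<and>
    (\<forall>x\<in>Vert X. on_vert f x \<in> Vert Y) \<and>
    (\<forall>x\<in>Vert X. \<forall>y\<in>Vert X. on_edge f x y \<in> Hom V (Edg X x y) (Edg Y (on_vert f x) (on_vert f y))) \<and>
    (\<forall>x\<in>Vert X. Unt X x \<cdot>\<^bsub>V\<^esub> on_edge f x x = Unt Y (on_vert f x))}"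

definition natural_functors ::
  "('o, 'm, 'c) relcat_scheme \<Rightarrow> ('x, 'o, 'm) vcat \<Rightarrow> ('y, 'o, 'm) vcat \<Rightarrow>
   ('x, 'y, 'm) transport set" where
  "natural_functors V X Y = {f \<in> original_transports V X Y.
    \<forall>x\<in>Vert X. \<forall>y\<in>Vert X. \<forall>z\<in>Vert X.
      Comps X x y z \<cdot>\<^bsub>V\<^esub> on_edge f x z =
      (on_edge f x y \<odot>\<^bsub>V\<^esub> on_edge f y z) \<cdot>\<^bsub>V\<^esub> Comps Y (on_vert f x) (on_vert f y) (on_vert f z)}"

definition id_transport ::
  "('o, 'm, 'c) relcat_scheme \<Rightarrow> ('x, 'o, 'd) vgraph_scheme \<Rightarrow> ('x, 'x, 'm) transport" where
  "id_transport V X = mk_transport (Vert X) (\<lambda>x. x) (\<lambda>x y. Idn V (Edg X x y))"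

definition followed_by ::
  "('o, 'm, 'c) relcat_scheme \<Rightarrow> ('x, 'o, 'd) vgraph_scheme \<Rightarrow>
   ('x, 'y, 'm) transport \<Rightarrow> ('y, 'z, 'm) transport \<Rightarrow> ('x, 'z, 'm) transport" where
  "followed_by V X f g = mk_transport (Vert X)
    (\<lambda>x. on_vert g (on_vert f x))
    (\<lambda>x y. on_edge f x y \<cdot>\<^bsub>V\<^esub> on_edge g (on_vert f x) (on_vert f y))"

section \<open>Tensor products\<close>

definition ten_graph ::
  "('o, 'm, 'c) relcat_scheme \<Rightarrow> ('x, 'o, 'm, 'd) ovgraph_scheme \<Rightarrow> ('s, 'o, 'm, 'e) ovgraph_scheme \<Rightarrow>
   ('x \<times> 's, 'o, 'm) ovgraph" where
  "ten_graph V X T =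
    \<lparr>Vert = Vert X \<times> Vert T,
     Edg = (\<lambda>(x, s) (y, t). Edg X x y \<otimes>\<^bsub>V\<^esub> Edg T s t),
     Unt = (\<lambda>(x, s). lun_inv V \<star>\<^bsub>V\<^esub> \<cdot>\<^bsub>V\<^esub> (Unt X x \<odot>\<^bsub>V\<^esub> Unt T s))\<rparr>"

definition ten_cat ::
  "('o, 'm, 'c) relcat_scheme \<Rightarrow> ('x, 'o, 'm) vcat \<Rightarrow> ('s, 'o, 'm) vcat \<Rightarrow>
   ('x \<times> 's, 'o, 'm) vcat" where
  "ten_cat V X T =
    \<lparr>Vert = Vert (ten_graph V X T), Edg = Edg (ten_graph V X T), Unt = Unt (ten_graph V X T),
     Comps = (\<lambda>(x, s) (y, t) (z, u).
       Mid V (Edg X x y) (Edg T s t) (Edg X y z) (Edg T t u) \<cdot>\<^bsub>V\<^esub> (Comps X x y z \<odot>\<^bsub>V\<^esub> Comps T s t u))\<rparr>"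

definition ten_transport ::
  "('o, 'm, 'c) relcat_scheme \<Rightarrow> ('x, 'o, 'm, 'd) ovgraph_scheme \<Rightarrow> ('s, 'o, 'm, 'e) ovgraph_scheme \<Rightarrow>
   ('x, 'y, 'm) transport \<Rightarrow> ('s, 't, 'm) transport \<Rightarrow> ('x \<times> 's, 'y \<times> 't, 'm) transport" where
  "ten_transport V X T f h = mk_transport (Vert X \<times> Vert T)
    (\<lambda>(x, s). (on_vert f x, on_vert h s))
    (\<lambda>(x, s) (y, t). on_edge f x y \<odot>\<^bsub>V\<^esub> on_edge h s t)"

abbreviation ten_id ::
  "('o, 'm, 'c) relcat_scheme \<Rightarrow> ('x, 'o, 'm, 'd) ovgraph_scheme \<Rightarrow> ('s, 'o, 'm, 'e) ovgraph_scheme \<Rightarrow>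
   ('x, 'y, 'm) transport \<Rightarrow> ('x \<times> 's, 'y \<times> 's, 'm) transport" where
  "ten_id V X T f \<equiv> ten_transport V X T f (id_transport V T)"

section \<open>The space of all transports, with componentwise edges\<close>

abbreviation comp_family ::
  "('y, 'o, 'e) vgraph_scheme \<Rightarrow> ('s, 'y, 'm) transport \<Rightarrow> ('s, 'y, 'm) transport \<Rightarrow> 's \<Rightarrow> 'o" where
  "comp_family Y \<phi> \<psi> \<equiv> (\<lambda>s. Edg Y (on_vert \<phi> s) (on_vert \<psi> s))"

definition pow_graph ::
  "('o, 'm, 'c) relcat_scheme \<Rightarrow> ('s, 'o, 'm, 'd) ovgraph_scheme \<Rightarrow> ('y, 'o, 'm, 'e) ovgraph_scheme \<Rightarrow>
   (('s, 'y, 'm) transport, 'o, 'm) ovgraph" where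
  "pow_graph V T Y =
    \<lparr>Vert = original_transports V T Y,
     Edg = (\<lambda>\<phi> \<psi>. prod_ob V (Vert T) (comp_family Y \<phi> \<psi>)),
     Unt = (\<lambda>\<phi>. tuple V (Vert T) (comp_family Y \<phi> \<phi>) \<star>\<^bsub>V\<^esub> (\<lambda>s. Unt Y (on_vert \<phi> s)))\<rparr>"

definition pow_cat ::
  "('o, 'm, 'c) relcat_scheme \<Rightarrow> ('s, 'o, 'm) vcat \<Rightarrow> ('y, 'o, 'm) vcat \<Rightarrow>
   (('s, 'y, 'm) transport, 'o, 'm) vcat" where
  "pow_cat V T Y =
    \<lparr>Vert = Vert (pow_graph V T Y), Edg = Edg (pow_graph V T Y), Unt = Unt (pow_graph V T Y),
     Comps = (\<lambda>\<phi> \<psi> \<chi>.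
       tuple V (Vert T) (comp_family Y \<phi> \<chi>)
         (Edg (pow_graph V T Y) \<phi> \<psi> \<otimes>\<^bsub>V\<^esub> Edg (pow_graph V T Y) \<psi> \<chi>)
         (\<lambda>s. (proj V (Vert T) (comp_family Y \<phi> \<psi>) s \<odot>\<^bsub>V\<^esub> proj V (Vert T) (comp_family Y \<psi> \<chi>) s) \<cdot>\<^bsub>V\<^esub>
              Comps Y (on_vert \<phi> s) (on_vert \<psi> s) (on_vert \<chi> s)))\<rparr>"

definition pow_transport ::
  "('o, 'm, 'c) relcat_scheme \<Rightarrow> ('s, 'o, 'm, 'd) ovgraph_scheme \<Rightarrow>
   ('x, 'o, 'm, 'e) ovgraph_scheme \<Rightarrow> ('y, 'o, 'm, 'f) ovgraph_scheme \<Rightarrow>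
   ('x, 'y, 'm) transport \<Rightarrow> (('s, 'x, 'm) transport, ('s, 'y, 'm) transport, 'm) transport" where
  "pow_transport V T X Y f = mk_transport (Vert (pow_graph V T X))
    (\<lambda>\<phi>. followed_by V T \<phi> f)
    (\<lambda>\<phi> \<psi>. tuple V (Vert T) (comp_family Y (followed_by V T \<phi> f) (followed_by V T \<psi> f))
       (Edg (pow_graph V T X) \<phi> \<psi>)
       (\<lambda>s. proj V (Vert T) (comp_family X \<phi> \<psi>) s \<cdot>\<^bsub>V\<^esub> on_edge f (on_vert \<phi> s) (on_vert \<psi> s)))"

section \<open>The exponential space of natural transforms between natural functors\<close>

abbreviation square_family ::
  "('o, 'm, 'c) relcat_scheme \<Rightarrow> ('s, 'o, 'd) vgraph_scheme \<Rightarrow> ('y, 'o, 'e) vgraph_scheme \<Rightarrow>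
   ('s, 'y, 'm) transport \<Rightarrow> ('s, 'y, 'm) transport \<Rightarrow> 's \<times> 's \<Rightarrow> 'o" where
  "square_family V T Y \<phi> \<psi> \<equiv>
    (\<lambda>(s, t). Exp V (Edg Y (on_vert \<phi> s) (on_vert \<psi> t)) (Edg T s t))"

definition square_first ::
  "('o, 'm, 'c) relcat_scheme \<Rightarrow> ('s, 'o, 'm) vcat \<Rightarrow> ('y, 'o, 'm) vcat \<Rightarrow>
   ('s, 'y, 'm) transport \<Rightarrow> ('s, 'y, 'm) transport \<Rightarrow> 'm" where
  "square_first V T Y \<phi> \<psi> =
    (let P = prod_ob V (Vert T) (comp_family Y \<phi> \<psi>) in
     tuple V (Vert T \<times> Vert T) (square_family V T Y \<phi> \<psi>) P
       (\<lambda>(s, t). Nam V P (Edg T s t) (Edg Y (on_vert \<phi> s) (on_vert \<psi> t))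
         ((proj V (Vert T) (comp_family Y \<phi> \<psi>) s \<odot>\<^bsub>V\<^esub> on_edge \<psi> s t) \<cdot>\<^bsub>V\<^esub>
          Comps Y (on_vert \<phi> s) (on_vert \<psi> s) (on_vert \<psi> t))))"

definition square_second ::
  "('o, 'm, 'c) relcat_scheme \<Rightarrow> ('s, 'o, 'm) vcat \<Rightarrow> ('y, 'o, 'm) vcat \<Rightarrow>
   ('s, 'y, 'm) transport \<Rightarrow> ('s, 'y, 'm) transport \<Rightarrow> 'm" where
  "square_second V T Y \<phi> \<psi> =
    (let P = prod_ob V (Vert T) (comp_family Y \<phi> \<psi>) in
     tuple V (Vert T \<times> Vert T) (square_family V T Y \<phi> \<psi>) P
       (\<lambda>(s, t). Nam V P (Edg T s t) (Edg Y (on_vert \<phi> s) (on_vert \<psi> t))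
         (swap V P (Edg T s t) \<cdot>\<^bsub>V\<^esub>
          (on_edge \<phi> s t \<odot>\<^bsub>V\<^esub> proj V (Vert T) (comp_family Y \<phi> \<psi>) t) \<cdot>\<^bsub>V\<^esub>
          Comps Y (on_vert \<phi> s) (on_vert \<phi> t) (on_vert \<psi> t))))"

definition nat_cone ::
  "('o, 'm, 'c) relcat_scheme \<Rightarrow> ('s, 'o, 'm) vcat \<Rightarrow> ('y, 'o, 'm) vcat \<Rightarrow>
   ('s, 'y, 'm) transport \<Rightarrow> ('s, 'y, 'm) transport \<Rightarrow> 'o \<times> 'm" where
  "nat_cone V T Y \<phi> \<psi> =
    eq_cone V (prod_ob V (Vert T) (comp_family Y \<phi> \<psi>))
      (prod_ob V (Vert T \<times> Vert T) (square_family V T Y \<phi> \<psi>))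
      (square_first V T Y \<phi> \<psi>) (square_second V T Y \<phi> \<psi>)"

abbreviation nat_ob where "nat_ob V T Y \<phi> \<psi> \<equiv> fst (nat_cone V T Y \<phi> \<psi>)"
abbreviation nat_incl where "nat_incl V T Y \<phi> \<psi> \<equiv> snd (nat_cone V T Y \<phi> \<psi>)"

text \<open>The arrow from \<open>a\<close> through which \<open>h\<close>, with values in the full product, factors.\<close>

definition nat_lift ::
  "('o, 'm, 'c) relcat_scheme \<Rightarrow> ('s, 'o, 'm) vcat \<Rightarrow> ('y, 'o, 'm) vcat \<Rightarrow>
   ('s, 'y, 'm) transport \<Rightarrow> ('s, 'y, 'm) transport \<Rightarrow> 'o \<Rightarrow> 'm \<Rightarrow> 'm" where
  "nat_lift V T Y \<phi> \<psi> a h =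
    (THE u. u \<in> Hom V a (nat_ob V T Y \<phi> \<psi>) \<and> u \<cdot>\<^bsub>V\<^esub> nat_incl V T Y \<phi> \<psi> = h)"

definition exp_cat ::
  "('o, 'm, 'c) relcat_scheme \<Rightarrow> ('s, 'o, 'm) vcat \<Rightarrow> ('y, 'o, 'm) vcat \<Rightarrow>
   (('s, 'y, 'm) transport, 'o, 'm) vcat" where
  "exp_cat V T Y =
    \<lparr>Vert = natural_functors V T Y,
     Edg = nat_ob V T Y,
     Unt = (\<lambda>\<phi>. nat_lift V T Y \<phi> \<phi> \<star>\<^bsub>V\<^esub> (Unt (pow_cat V T Y) \<phi>)),
     Comps = (\<lambda>\<phi> \<psi> \<chi>.
       nat_lift V T Y \<phi> \<chi> (nat_ob V T Y \<phi> \<psi> \<otimes>\<^bsub>V\<^esub> nat_ob V T Y \<psi> \<chi>)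
         ((nat_incl V T Y \<phi> \<psi> \<odot>\<^bsub>V\<^esub> nat_incl V T Y \<psi> \<chi>) \<cdot>\<^bsub>V\<^esub> Comps (pow_cat V T Y) \<phi> \<psi> \<chi>))\<rparr>"

definition exp_incl ::
  "('o, 'm, 'c) relcat_scheme \<Rightarrow> ('s, 'o, 'm) vcat \<Rightarrow> ('y, 'o, 'm) vcat \<Rightarrow>
   (('s, 'y, 'm) transport, ('s, 'y, 'm) transport, 'm) transport" where
  "exp_incl V T Y = mk_transport (natural_functors V T Y) (\<lambda>\<phi>. \<phi>) (nat_incl V T Y)"

definition exp_transport ::
  "('o, 'm, 'c) relcat_scheme \<Rightarrow> ('s, 'o, 'm) vcat \<Rightarrow> ('x, 'o, 'm) vcat \<Rightarrow> ('y, 'o, 'm) vcat \<Rightarrow>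
   ('x, 'y, 'm) transport \<Rightarrow> (('s, 'x, 'm) transport, ('s, 'y, 'm) transport, 'm) transport" where
  "exp_transport V T X Y f = mk_transport (natural_functors V T X)
    (\<lambda>\<phi>. followed_by V T \<phi> f)
    (\<lambda>\<phi> \<psi>. nat_lift V T Y (followed_by V T \<phi> f) (followed_by V T \<psi> f) (nat_ob V T X \<phi> \<psi>)
       (nat_incl V T X \<phi> \<psi> \<cdot>\<^bsub>V\<^esub> on_edge (pow_transport V T X Y f) \<phi> \<psi>))"

section \<open>Sections, evaluation, name and realization\<close>

definition section_at ::
  "('o, 'm, 'c) relcat_scheme \<Rightarrow> ('x, 'o, 'm, 'd) ovgraph_scheme \<Rightarrow> ('s, 'o, 'm, 'e) ovgraph_scheme \<Rightarrow>
   'x \<Rightarrow> ('s, 'x \<times> 's, 'm) transport" where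
  "section_at V X T x = mk_transport (Vert T) (\<lambda>s. (x, s))
    (\<lambda>s t. lun_inv V (Edg T s t) \<cdot>\<^bsub>V\<^esub> (Unt X x \<odot>\<^bsub>V\<^esub> Idn V (Edg T s t)))"

definition sections_pow ::
  "('o, 'm, 'c) relcat_scheme \<Rightarrow> ('s, 'o, 'm, 'e) ovgraph_scheme \<Rightarrow> ('x, 'o, 'm, 'd) ovgraph_scheme \<Rightarrow>
   ('x, ('s, 'x \<times> 's, 'm) transport, 'm) transport" where
  "sections_pow V T X = mk_transport (Vert X) (section_at V X T)
    (\<lambda>x y. tuple V (Vert T)
       (comp_family (ten_graph V X T) (section_at V X T x) (section_at V X T y)) (Edg X x y)
       (\<lambda>s. run_inv V (Edg X x y) \<cdot>\<^bsub>V\<^esub> (Idn V (Edg X x y) \<odot>\<^bsub>V\<^esub> Unt T s)))"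

definition sections_exp ::
  "('o, 'm, 'c) relcat_scheme \<Rightarrow> ('s, 'o, 'm) vcat \<Rightarrow> ('x, 'o, 'm) vcat \<Rightarrow>
   ('x, ('s, 'x \<times> 's, 'm) transport, 'm) transport" where
  "sections_exp V T X = mk_transport (Vert X) (section_at V X T)
    (\<lambda>x y. nat_lift V T (ten_cat V X T) (section_at V X T x) (section_at V X T y) (Edg X x y)
       (on_edge (sections_pow V T X) x y))"

definition evaluation ::
  "('o, 'm, 'c) relcat_scheme \<Rightarrow> ('s, 'o, 'm) vcat \<Rightarrow> ('y, 'o, 'm) vcat \<Rightarrow>
   (('s, 'y, 'm) transport \<times> 's, 'y, 'm) transport" where
  "evaluation V T Y = mk_transport (natural_functors V T Y \<times> Vert T)
    (\<lambda>(\<phi>, s). on_vert \<phi> s)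
    (\<lambda>(\<phi>, s) (\<psi>, t).
       ((nat_incl V T Y \<phi> \<psi> \<cdot>\<^bsub>V\<^esub> proj V (Vert T) (comp_family Y \<phi> \<psi>) s) \<odot>\<^bsub>V\<^esub> on_edge \<psi> s t) \<cdot>\<^bsub>V\<^esub>
       Comps Y (on_vert \<phi> s) (on_vert \<psi> s) (on_vert \<psi> t))"

definition name_of ::
  "('o, 'm, 'c) relcat_scheme \<Rightarrow> ('s, 'o, 'm) vcat \<Rightarrow> ('x, 'o, 'm) vcat \<Rightarrow> ('y, 'o, 'm) vcat \<Rightarrow>
   ('x \<times> 's, 'y, 'm) transport \<Rightarrow> ('x, ('s, 'y, 'm) transport, 'm) transport" where
  "name_of V T X Y f =
    followed_by V X (sections_exp V T X) (exp_transport V T (ten_cat V X T) Y f)"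

definition realization_of ::
  "('o, 'm, 'c) relcat_scheme \<Rightarrow> ('s, 'o, 'm) vcat \<Rightarrow> ('x, 'o, 'm) vcat \<Rightarrow> ('y, 'o, 'm) vcat \<Rightarrow>
   ('x, ('s, 'y, 'm) transport, 'm) transport \<Rightarrow> ('x \<times> 's, 'y, 'm) transport" where
  "realization_of V T X Y g =
    followed_by V (ten_cat V X T) (ten_id V X T g) (evaluation V T Y)"

end

theory Submission
  imports Defs
begin

text \<open>
  The hypotheses force the tensor product of \<open>V\<close> to be the cartesian product. Indeed \<open>a\<close> is the
  product of \<open>a\<close> and the final object, \<open>b\<close> is the product of the final object and \<open>b\<close>, and \<open>\<otimes>\<close>
  maintains products of two objects, so that \<open>a \<otimes> b\<close> is the product of \<open>a \<otimes> \<star> \<cong> a\<close> and \<open>\<star> \<otimes> b \<cong> b\<close>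
  (\<open>tensor_product_universal\<close>). An arrow into \<open>a \<otimes> b\<close> is therefore a pair of arrows, and arrows can
  be compared by their effect on generalized elements \<open>z \<rightarrow> a\<close>.

  The structure isomorphisms are the evident ones. Naturality lets every component of the
  interchange and of the associativity be computed with the other objects replaced by \<open>\<star>\<close>. The unit
  conditions then say that the interchange sends \<open>\<langle>\<langle>p, s\<rangle>, \<langle>r, t\<rangle>\<rangle>\<close> to \<open>\<langle>\<langle>p, r\<rangle>, \<langle>s, t\<rangle>\<rangle>\<close>
  (\<open>pair_Mid\<close>) and that the associativity keeps the outer two of three entries. The middle entry
  could still be moved by a natural automorphism of the identity; the pentagon makes it idempotent,
  hence trivial (\<open>mid_Asc_id\<close>).

  Consequently a \<open>V\<close>-enriched category is, at each stage \<open>z\<close>, an ordinary category whose arrows are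
  the elements \<open>z \<rightarrow> X(x;y)\<close> (\<open>enriched_iff\<close>), and natural functors are functors stage by stage
  (\<open>nf_comp_el\<close>, \<open>nfI\<close>). An element of \<open>(X \<otimes> T)(\<langle>x,s\<rangle>;\<langle>y,t\<rangle>)\<close> is a pair \<open>\<langle>a, \<tau>\<rangle>\<close>. The equalizer
  that defines the exponential, read through the bijection between arrows and their names, says
  that an element \<open>e\<close> of it is a family of components \<open>e\<^sub>s\<close> with \<open>e\<^sub>s \<circ> \<psi>(\<tau>) = \<phi>(\<tau>) \<circ> e\<^sub>t\<close> at every
  later stage (\<open>squares\<close>, \<open>exp_lift\<close>, \<open>nat_component_natural\<close>); composition stays in diagrammatic
  order.

  In these terms the unit is \<open>a \<mapsto> (\<langle>a, 1\<^sub>s\<rangle>)\<^sub>s\<close> and the counit is \<open>\<langle>e, \<tau>\<rangle> \<mapsto> e\<^sub>s \<circ> \<psi>(\<tau>)\<close>. The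
  realization of the name of \<open>f\<close> sends \<open>\<langle>a, \<tau>\<rangle>\<close> to \<open>f\<langle>a, 1\<rangle> \<circ> f\<langle>1, \<tau>\<rangle> = f\<langle>a \<circ> 1, 1 \<circ> \<tau>\<rangle> = f\<langle>a, \<tau>\<rangle>\<close>,
  and the name of the realization of \<open>g\<close> sends \<open>a\<close> to the family \<open>(g a)\<^sub>s \<circ> 1 = (g a)\<^sub>s\<close>.
  Naturality of both appointments follows from the naturality of the unit and counit and from
  functoriality; the triangular equalities are the two round trips at the identities.
\<close>

section \<open>Arrows of the base category\<close>

text \<open>The parameter \<open>U\<close> carries the type of small elements, which does not occur in the type of \<open>V\<close>.\<close>

locale relator_category =
  fixes V :: "('o, 'm) relcat" (structure) and U :: "'s itself"
  assumes infinite_small: "infinite (UNIV :: 's set)"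
    and monoidal: "monoidal_closed V"
    and complete: "small_complete U V"
    and maintains: "tensor_maintains_products U V"
    and involution: "relator_involution V"
    and involution_nat: "involution_natural_iso V"
begin

text \<open>
  Membership in \<open>a \<leadsto> b\<close> also records that \<open>a\<close> and \<open>b\<close> are objects, since the sets \<open>Hom V a b\<close> are
  unconstrained for other \<open>a\<close>, \<open>b\<close>.
\<close>

definition arrows :: "'o \<Rightarrow> 'o \<Rightarrow> 'm set"  (infix "\<leadsto>" 60) where
  "a \<leadsto> b = {f. a \<in> Ob V \<and> b \<in> Ob V \<and> f \<in> Hom V a b}"

lemma category_V: "category V" and bifunctor_V: "tensor_bifunctor V"
  and associativity_V: "associativity V" and final_V: "final_unit V" and exponentials_V: "exponentials V"
  using monoidal by (auto simp: monoidal_closed_def)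

lemma arrows_ob: "f \<in> a \<leadsto> b \<Longrightarrow> a \<in> Ob V" "f \<in> a \<leadsto> b \<Longrightarrow> b \<in> Ob V"
  by (auto simp: arrows_def)

lemma arrows_iff: "a \<in> Ob V \<Longrightarrow> b \<in> Ob V \<Longrightarrow> f \<in> a \<leadsto> b \<longleftrightarrow> f \<in> Hom V a b"
  by (auto simp: arrows_def)

lemma id_in: "a \<in> Ob V \<Longrightarrow> Idn V a \<in> a \<leadsto> a"
  using category_V by (auto simp: arrows_def category_def)

lemma comp_in: "f \<in> a \<leadsto> b \<Longrightarrow> g \<in> b \<leadsto> c \<Longrightarrow> f \<cdot> g \<in> a \<leadsto> c"
  using category_V by (auto simp: arrows_def category_def)

lemma id_left: "f \<in> a \<leadsto> b \<Longrightarrow> Idn V a \<cdot> f = f"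
  using category_V by (auto simp: arrows_def category_def)

lemma id_right: "f \<in> a \<leadsto> b \<Longrightarrow> f \<cdot> Idn V b = f"
  using category_V by (auto simp: arrows_def category_def)

lemma assoc: "f \<in> a \<leadsto> b \<Longrightarrow> g \<in> b \<leadsto> c \<Longrightarrow> h \<in> c \<leadsto> d \<Longrightarrow> f \<cdot> g \<cdot> h = f \<cdot> (g \<cdot> h)"
  using category_V by (auto simp: arrows_def category_def)

lemma tensor_ob: "a \<in> Ob V \<Longrightarrow> b \<in> Ob V \<Longrightarrow> a \<otimes> b \<in> Ob V"
  using bifunctor_V by (auto simp: tensor_bifunctor_def)

lemma tensor_id: "a \<in> Ob V \<Longrightarrow> b \<in> Ob V \<Longrightarrow> Idn V a \<odot> Idn V b = Idn V (a \<otimes> b)"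
  using bifunctor_V by (auto simp: tensor_bifunctor_def)

lemma tensor_in: "f \<in> a \<leadsto> a' \<Longrightarrow> g \<in> b \<leadsto> b' \<Longrightarrow> f \<odot> g \<in> a \<otimes> b \<leadsto> a' \<otimes> b'"
  using bifunctor_V by (auto simp: tensor_bifunctor_def arrows_def)

lemma tensor_comp:
  "f \<in> a \<leadsto> a' \<Longrightarrow> f' \<in> a' \<leadsto> a'' \<Longrightarrow> g \<in> b \<leadsto> b' \<Longrightarrow> g' \<in> b' \<leadsto> b'' \<Longrightarrow>
   (f \<odot> g) \<cdot> (f' \<odot> g') = (f \<cdot> f') \<odot> (g \<cdot> g')"
  using bifunctor_V unfolding tensor_bifunctor_def arrows_def by auto

lemma unit_ob: "\<star> \<in> Ob V"
  using final_V by (auto simp: final_unit_def is_terminal_def)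

lemma to_unit_unique: "f \<in> a \<leadsto> \<star> \<Longrightarrow> g \<in> a \<leadsto> \<star> \<Longrightarrow> f = g"
  using final_V by (auto simp: final_unit_def is_terminal_def arrows_def)

definition bang :: "'o \<Rightarrow> 'm" where
  "bang a = (THE f. f \<in> a \<leadsto> \<star>)"

lemma bang_in: "a \<in> Ob V \<Longrightarrow> bang a \<in> a \<leadsto> \<star>"
proof -
  assume "a \<in> Ob V"
  then have "\<exists>!f. f \<in> a \<leadsto> \<star>"
    using final_V unit_ob unfolding final_unit_def is_terminal_def arrows_def by auto
  then show ?thesis unfolding bang_def by (rule theI')
qed

lemma comp_bang: "f \<in> a \<leadsto> b \<Longrightarrow> f \<cdot> bang b = bang a"
  by (meson arrows_ob bang_in comp_in to_unit_unique)

lemma bang_unit: "bang \<star> = Idn V \<star>"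
  by (meson bang_in id_in to_unit_unique unit_ob)

lemma iso_in: "is_iso V a b f \<Longrightarrow> a \<in> Ob V \<Longrightarrow> b \<in> Ob V \<Longrightarrow> f \<in> a \<leadsto> b"
  by (auto simp: is_iso_def inverse_arrows_def arrows_def)

lemma arrow_inv_inverse:
  assumes "is_iso V a b f" "a \<in> Ob V" "b \<in> Ob V"
  shows "arrow_inv V a b f \<in> b \<leadsto> a" "f \<cdot> arrow_inv V a b f = Idn V a"
    "arrow_inv V a b f \<cdot> f = Idn V b"
proof -
  obtain g where g: "inverse_arrows V a b f g" using assms(1) by (auto simp: is_iso_def)
  have "g' = g" if "inverse_arrows V a b f g'" for g'
  proof -
    have m: "g \<in> b \<leadsto> a" "g' \<in> b \<leadsto> a" "f \<in> a \<leadsto> b"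
      using g that assms by (auto simp: inverse_arrows_def arrows_def)
    have "g' = g' \<cdot> (f \<cdot> g)" using g m id_right by (auto simp: inverse_arrows_def)
    also have "\<dots> = g' \<cdot> f \<cdot> g" using assoc m by metis
    also have "\<dots> = g" using that m id_left by (auto simp: inverse_arrows_def)
    finally show ?thesis .
  qed
  then have "inverse_arrows V a b f (arrow_inv V a b f)"
    unfolding arrow_inv_def using g by (metis theI)
  then show "arrow_inv V a b f \<in> b \<leadsto> a" "f \<cdot> arrow_inv V a b f = Idn V a"
    "arrow_inv V a b f \<cdot> f = Idn V b"
    using assms by (auto simp: inverse_arrows_def arrows_def)
qed

lemma Lun_iso: "a \<in> Ob V \<Longrightarrow> is_iso V (\<star> \<otimes> a) a (Lun V a)"
  and Run_iso: "a \<in> Ob V \<Longrightarrow> is_iso V (a \<otimes> \<star>) a (Run V a)"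
  using final_V by (auto simp: final_unit_def)

lemma Lun_in: "a \<in> Ob V \<Longrightarrow> Lun V a \<in> \<star> \<otimes> a \<leadsto> a"
  and Run_in: "a \<in> Ob V \<Longrightarrow> Run V a \<in> a \<otimes> \<star> \<leadsto> a"
  by (simp_all add: iso_in Lun_iso Run_iso tensor_ob unit_ob)

lemma Lun_nat: "f \<in> a \<leadsto> b \<Longrightarrow> (Idn V \<star> \<odot> f) \<cdot> Lun V b = Lun V a \<cdot> f"
  and Run_nat: "f \<in> a \<leadsto> b \<Longrightarrow> (f \<odot> Idn V \<star>) \<cdot> Run V b = Run V a \<cdot> f"
  using final_V by (auto simp: final_unit_def arrows_def)

section \<open>The tensor product is the cartesian product\<close>

text \<open>
  The candidate projections of \<open>a \<otimes> b\<close>: forget one factor by sending it to the final object.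
\<close>

definition pr1 :: "'o \<Rightarrow> 'o \<Rightarrow> 'm" where
  "pr1 a b = (Idn V a \<odot> bang b) \<cdot> Run V a"

definition pr2 :: "'o \<Rightarrow> 'o \<Rightarrow> 'm" where
  "pr2 a b = (bang a \<odot> Idn V b) \<cdot> Lun V b"

lemma pr1_in: "a \<in> Ob V \<Longrightarrow> b \<in> Ob V \<Longrightarrow> pr1 a b \<in> a \<otimes> b \<leadsto> a"
  and pr2_in: "a \<in> Ob V \<Longrightarrow> b \<in> Ob V \<Longrightarrow> pr2 a b \<in> a \<otimes> b \<leadsto> b"
  unfolding pr1_def pr2_def
  by (meson Lun_in Run_in bang_in comp_in id_in tensor_in)+

lemma pr1_unit: "a \<in> Ob V \<Longrightarrow> pr1 a \<star> = Run V a"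
  and pr2_unit: "a \<in> Ob V \<Longrightarrow> pr2 \<star> a = Lun V a"
  unfolding pr1_def pr2_def bang_unit
  by (simp_all add: tensor_id unit_ob id_left[OF Run_in] id_left[OF Lun_in])

lemma tensor_pr1: assumes "f \<in> a \<leadsto> a'" "g \<in> b \<leadsto> b'" shows "(f \<odot> g) \<cdot> pr1 a' b' = pr1 a b \<cdot> f"
proof -
  note m = assms arrows_ob[OF assms(1)] arrows_ob[OF assms(2)]
  have "(f \<odot> g) \<cdot> pr1 a' b' = (f \<odot> g) \<cdot> (Idn V a' \<odot> bang b') \<cdot> Run V a'"
    unfolding pr1_def by (rule assoc[symmetric]) (use m in \<open>auto intro: tensor_in id_in bang_in Run_in\<close>)
  also have "(f \<odot> g) \<cdot> (Idn V a' \<odot> bang b') = f \<odot> bang b"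
    using tensor_comp[OF m(1) id_in[OF m(4)] m(2) bang_in[OF m(6)]] id_right[OF m(1)] comp_bang[OF m(2)]
    by simp
  also have "\<dots> = (Idn V a \<odot> bang b) \<cdot> (f \<odot> Idn V \<star>)"
    using tensor_comp[OF id_in[OF m(3)] m(1) bang_in[OF m(5)] id_in[OF unit_ob]]
      id_left[OF m(1)] id_right[OF bang_in[OF m(5)]] by simp
  also have "\<dots> \<cdot> Run V a' = (Idn V a \<odot> bang b) \<cdot> ((f \<odot> Idn V \<star>) \<cdot> Run V a')"
    by (rule assoc) (use m unit_ob in \<open>auto intro: tensor_in id_in bang_in Run_in\<close>)
  also have "\<dots> = (Idn V a \<odot> bang b) \<cdot> (Run V a \<cdot> f)"
    by (simp add: Run_nat[OF m(1)])
  also have "\<dots> = pr1 a b \<cdot> f"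
    unfolding pr1_def by (rule assoc[symmetric]) (use m in \<open>auto intro: tensor_in id_in bang_in Run_in\<close>)
  finally show ?thesis .
qed

lemma tensor_pr2: assumes "f \<in> a \<leadsto> a'" "g \<in> b \<leadsto> b'" shows "(f \<odot> g) \<cdot> pr2 a' b' = pr2 a b \<cdot> g"
proof -
  note m = assms arrows_ob[OF assms(1)] arrows_ob[OF assms(2)]
  have "(f \<odot> g) \<cdot> pr2 a' b' = (f \<odot> g) \<cdot> (bang a' \<odot> Idn V b') \<cdot> Lun V b'"
    unfolding pr2_def by (rule assoc[symmetric]) (use m in \<open>auto intro: tensor_in id_in bang_in Lun_in\<close>)
  also have "(f \<odot> g) \<cdot> (bang a' \<odot> Idn V b') = bang a \<odot> g"
    using tensor_comp[OF m(1) bang_in[OF m(4)] m(2) id_in[OF m(6)]] id_right[OF m(2)] comp_bang[OF m(1)]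
    by simp
  also have "\<dots> = (bang a \<odot> Idn V b) \<cdot> (Idn V \<star> \<odot> g)"
    using tensor_comp[OF bang_in[OF m(3)] id_in[OF unit_ob] id_in[OF m(5)] m(2)]
      id_left[OF m(2)] id_right[OF bang_in[OF m(3)]] by simp
  also have "\<dots> \<cdot> Lun V b' = (bang a \<odot> Idn V b) \<cdot> ((Idn V \<star> \<odot> g) \<cdot> Lun V b')"
    by (rule assoc) (use m unit_ob in \<open>auto intro: tensor_in id_in bang_in Lun_in\<close>)
  also have "\<dots> = (bang a \<odot> Idn V b) \<cdot> (Lun V b \<cdot> g)"
    by (simp add: Lun_nat[OF m(2)])
  also have "\<dots> = pr2 a b \<cdot> g"
    unfolding pr2_def by (rule assoc[symmetric]) (use m in \<open>auto intro: tensor_in id_in bang_in Lun_in\<close>)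
  finally show ?thesis .
qed

lemma iso_transpose:
  assumes "is_iso V b c i" "b \<in> Ob V" "c \<in> Ob V" "u \<in> a \<leadsto> b" "f \<in> a \<leadsto> c"
  shows "u \<cdot> i = f \<longleftrightarrow> u = f \<cdot> arrow_inv V b c i"
proof -
  note m = arrow_inv_inverse[OF assms(1-3)] iso_in[OF assms(1-3)]
  have "u \<cdot> i \<cdot> arrow_inv V b c i = u" "f \<cdot> arrow_inv V b c i \<cdot> i = f"
    using m assms by (simp_all add: assoc[of _ _ _ _ _ _ b] assoc[of _ _ _ _ _ _ c] id_right)
  then show ?thesis by auto
qed

text \<open>
  All factors but one are final, so an arrow into the product is determined by the remaining entry.
\<close>

lemma is_product_with_units:
  assumes "a \<in> Ob V" "i \<in> S"
  shows "is_product V S (\<lambda>s. if s = i then a else \<star>) a (\<lambda>s. if s = i then Idn V a else bang a)"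
  unfolding is_product_def
proof (intro conjI ballI allI impI)
  show "(if s = i then Idn V a else bang a) \<in> Hom V a (if s = i then a else \<star>)" for s
    using id_in[of a] bang_in[of a] assms by (auto simp: arrows_def)
  fix z k assume z: "z \<in> Ob V" and k: "\<forall>s\<in>S. k s \<in> Hom V z (if s = i then a else \<star>)"
  have ki: "k i \<in> z \<leadsto> a" using k assms z by (auto simp: arrows_def)
  have ks: "k s = bang z" if "s \<in> S" "s \<noteq> i" for s
    using k that z unit_ob by (intro to_unit_unique[OF _ bang_in]) (auto simp: arrows_def)
  show "\<exists>!u. u \<in> Hom V z a \<and> (\<forall>s\<in>S. u \<cdot> (if s = i then Idn V a else bang a) = k s)"
  proof (rule ex1I[of _ "k i"])
    show "k i \<in> Hom V z a \<and> (\<forall>s\<in>S. k i \<cdot> (if s = i then Idn V a else bang a) = k s)"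
      using ki ks id_right[OF ki] comp_bang[OF ki] by (auto simp: arrows_def)
    fix u assume "u \<in> Hom V z a \<and> (\<forall>s\<in>S. u \<cdot> (if s = i then Idn V a else bang a) = k s)"
    then show "u = k i"
      using id_right[of u z a] assms z by (auto simp: arrows_def)
  qed
qed (use assms in auto)

text \<open>
  The product of the families \<open>(a, \<star>)\<close> and \<open>(\<star>, b)\<close> over a two-element small set is \<open>a\<close>,
  respectively \<open>b\<close>; as \<open>\<otimes>\<close> maintains products, \<open>a \<otimes> b\<close> is the product of \<open>a \<otimes> \<star>\<close> and \<open>\<star> \<otimes> b\<close>, and
  the unit isomorphisms turn the legs of that product into \<open>pr1\<close> and \<open>pr2\<close>.
\<close>

lemma tensor_product_universal:
  assumes "f \<in> z \<leadsto> a" "g \<in> z \<leadsto> b"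
  shows "\<exists>!u. u \<in> z \<leadsto> a \<otimes> b \<and> u \<cdot> pr1 a b = f \<and> u \<cdot> pr2 a b = g"
proof -
  have ob: "z \<in> Ob V" "a \<in> Ob V" "b \<in> Ob V" using assms by (auto simp: arrows_ob)
  obtain i :: 's where True by simp
  \<comment> \<open>a second index exists because the type of small elements is infinite\<close>
  obtain j where j: "j \<noteq> i"
    using infinite_small by (metis finite.emptyI finite_insert insertI1 rev_finite_subset subsetI ex_new_if_finite)
  note 1 = is_product_with_units[of a i "{i, j}"] and 2 = is_product_with_units[of b j "{i, j}"]
  have "is_product V {i, j} (\<lambda>s. (if s = i then a else \<star>) \<otimes> (if s = j then b else \<star>)) (a \<otimes> b)
      (\<lambda>s. (if s = i then Idn V a else bang a) \<odot> (if s = j then Idn V b else bang b))"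
    using maintains 1 2 ob unit_ob unfolding tensor_maintains_products_def by auto
  then have ex: "\<exists>!u. u \<in> Hom V z (a \<otimes> b) \<and> u \<cdot> (Idn V a \<odot> bang b) = k i \<and> u \<cdot> (bang a \<odot> Idn V b) = k j"
    if "k i \<in> z \<leadsto> a \<otimes> \<star>" "k j \<in> z \<leadsto> \<star> \<otimes> b" for k
    using that ob j unfolding is_product_def by (auto simp: arrows_def)
  have eq: "u \<cdot> pr1 a b = f \<longleftrightarrow> u \<cdot> (Idn V a \<odot> bang b) = f \<cdot> run_inv V a"
           "u \<cdot> pr2 a b = g \<longleftrightarrow> u \<cdot> (bang a \<odot> Idn V b) = g \<cdot> lun_inv V b"
    if "u \<in> z \<leadsto> a \<otimes> b" for u
  proof -
    have m: "Idn V a \<odot> bang b \<in> a \<otimes> b \<leadsto> a \<otimes> \<star>" "bang a \<odot> Idn V b \<in> a \<otimes> b \<leadsto> \<star> \<otimes> b"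
      using ob by (auto intro: tensor_in id_in bang_in)
    show "u \<cdot> pr1 a b = f \<longleftrightarrow> u \<cdot> (Idn V a \<odot> bang b) = f \<cdot> run_inv V a"
      unfolding pr1_def
      using iso_transpose[OF Run_iso] assoc[OF that m(1) Run_in] comp_in[OF that m(1)] assms ob unit_ob tensor_ob
      by metis
    show "u \<cdot> pr2 a b = g \<longleftrightarrow> u \<cdot> (bang a \<odot> Idn V b) = g \<cdot> lun_inv V b"
      unfolding pr2_def
      using iso_transpose[OF Lun_iso] assoc[OF that m(2) Lun_in] comp_in[OF that m(2)] assms ob unit_ob tensor_ob
      by metis
  qed
  have "f \<cdot> run_inv V a \<in> z \<leadsto> a \<otimes> \<star>" "g \<cdot> lun_inv V b \<in> z \<leadsto> \<star> \<otimes> b"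
    using arrow_inv_inverse(1)[OF Run_iso] arrow_inv_inverse(1)[OF Lun_iso] assms ob unit_ob tensor_ob comp_in by metis+
  then have "\<exists>!u. u \<in> Hom V z (a \<otimes> b) \<and> u \<cdot> (Idn V a \<odot> bang b) = f \<cdot> run_inv V a \<and> 
      u \<cdot> (bang a \<odot> Idn V b) = g \<cdot> lun_inv V b"
    using ex[of "\<lambda>s. if s = i then f \<cdot> run_inv V a else g \<cdot> lun_inv V b"] j by auto
  then show ?thesis using eq ob tensor_ob by (metis arrows_iff)
qed

text \<open>
  The stage \<open>z\<close> and the factors \<open>a\<close>, \<open>b\<close> are arguments because an arrow does not determine its
  source and target: different sets \<open>Hom V a b\<close> may overlap.
\<close>

definition pair :: "'o \<Rightarrow> 'o \<Rightarrow> 'o \<Rightarrow> 'm \<Rightarrow> 'm \<Rightarrow> 'm" where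
  "pair z a b f g = (THE u. u \<in> z \<leadsto> a \<otimes> b \<and> u \<cdot> pr1 a b = f \<and> u \<cdot> pr2 a b = g)"

lemma pair_char:
  assumes "f \<in> z \<leadsto> a" "g \<in> z \<leadsto> b"
  shows "pair z a b f g \<in> z \<leadsto> a \<otimes> b \<and> pair z a b f g \<cdot> pr1 a b = f \<and> pair z a b f g \<cdot> pr2 a b = g"
  unfolding pair_def by (rule theI'[OF tensor_product_universal[OF assms]])

lemma pair_in: "f \<in> z \<leadsto> a \<Longrightarrow> g \<in> z \<leadsto> b \<Longrightarrow> pair z a b f g \<in> z \<leadsto> a \<otimes> b"
  and pair_pr1: "f \<in> z \<leadsto> a \<Longrightarrow> g \<in> z \<leadsto> b \<Longrightarrow> pair z a b f g \<cdot> pr1 a b = f"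
  and pair_pr2: "f \<in> z \<leadsto> a \<Longrightarrow> g \<in> z \<leadsto> b \<Longrightarrow> pair z a b f g \<cdot> pr2 a b = g"
  by (auto simp: pair_char)

lemma pair_eqI:
  assumes "u \<in> z \<leadsto> a \<otimes> b" "v \<in> z \<leadsto> a \<otimes> b"
    "u \<cdot> pr1 a b = v \<cdot> pr1 a b" "u \<cdot> pr2 a b = v \<cdot> pr2 a b" "a \<in> Ob V" "b \<in> Ob V"
  shows "u = v"
  using tensor_product_universal[OF comp_in[OF assms(2) pr1_in[OF assms(5,6)]] comp_in[OF assms(2) pr2_in[OF assms(5,6)]]]
    assms(1-4) by blast

lemma pair_unique:
  assumes "u \<in> z \<leadsto> a \<otimes> b" "u \<cdot> pr1 a b = f" "u \<cdot> pr2 a b = g" "a \<in> Ob V" "b \<in> Ob V"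
  shows "u = pair z a b f g"
proof -
  have "f \<in> z \<leadsto> a" "g \<in> z \<leadsto> b" using assms comp_in pr1_in pr2_in by metis+
  then have "pair z a b f g \<in> z \<leadsto> a \<otimes> b" "pair z a b f g \<cdot> pr1 a b = f" "pair z a b f g \<cdot> pr2 a b = g"
    by (simp_all only: pair_char)
  with assms show ?thesis by (intro pair_eqI[of u z a b]) simp_all
qed

lemma pair_cases:
  assumes "u \<in> z \<leadsto> a \<otimes> b" "a \<in> Ob V" "b \<in> Ob V"
  obtains f g where "f \<in> z \<leadsto> a" "g \<in> z \<leadsto> b" "u = pair z a b f g"
  using pair_unique[OF assms(1) refl refl assms(2,3)] assms comp_in pr1_in pr2_in by metis

lemma pair_inject:
  assumes "pair z a b f g = pair z a b f' g'"
    "f \<in> z \<leadsto> a" "g \<in> z \<leadsto> b" "f' \<in> z \<leadsto> a" "g' \<in> z \<leadsto> b"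
  shows "f = f' \<and> g = g'"
  using assms pair_char by metis

lemma pair_tensor:
  assumes "f \<in> z \<leadsto> a" "g \<in> z \<leadsto> b" "u \<in> a \<leadsto> a'" "v \<in> b \<leadsto> b'"
  shows "pair z a b f g \<cdot> (u \<odot> v) = pair z a' b' (f \<cdot> u) (g \<cdot> v)"
proof (rule pair_unique)
  note m = pair_in[OF assms(1,2)] tensor_in[OF assms(3,4)] 
    arrows_ob[OF assms(3)] arrows_ob[OF assms(4)]
  show "pair z a b f g \<cdot> (u \<odot> v) \<in> z \<leadsto> a' \<otimes> b'" using comp_in m by blast
  show "pair z a b f g \<cdot> (u \<odot> v) \<cdot> pr1 a' b' = f \<cdot> u"
    by (simp only: assoc[OF m(1,2) pr1_in[OF m(4,6)]] tensor_pr1[OF assms(3,4)]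
        assoc[OF m(1) pr1_in[OF m(3,5)] assms(3), symmetric] pair_pr1[OF assms(1,2)])
  show "pair z a b f g \<cdot> (u \<odot> v) \<cdot> pr2 a' b' = g \<cdot> v"
    by (simp only: assoc[OF m(1,2) pr2_in[OF m(4,6)]] tensor_pr2[OF assms(3,4)]
        assoc[OF m(1) pr2_in[OF m(3,5)] assms(4), symmetric] pair_pr2[OF assms(1,2)])
qed (use assms arrows_ob in auto)

lemma pair_Run: "f \<in> z \<leadsto> a \<Longrightarrow> t \<in> z \<leadsto> \<star> \<Longrightarrow> pair z a \<star> f t \<cdot> Run V a = f"
  using pair_pr1 pr1_unit arrows_ob by metis

lemma pair_Lun: "f \<in> z \<leadsto> a \<Longrightarrow> t \<in> z \<leadsto> \<star> \<Longrightarrow> pair z \<star> a t f \<cdot> Lun V a = f"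
  using pair_pr2 pr2_unit arrows_ob by metis

lemma run_inv_in: "a \<in> Ob V \<Longrightarrow> run_inv V a \<in> a \<leadsto> a \<otimes> \<star>"
  and lun_inv_in: "a \<in> Ob V \<Longrightarrow> lun_inv V a \<in> a \<leadsto> \<star> \<otimes> a"
  using arrow_inv_inverse(1)[OF Run_iso] arrow_inv_inverse(1)[OF Lun_iso] tensor_ob unit_ob by auto

lemma comp_run_inv:
  assumes "f \<in> z \<leadsto> a"
  shows "f \<cdot> run_inv V a = pair z a \<star> f (bang z)"
  using iso_transpose[OF Run_iso[of a], of "pair z a \<star> f (bang z)" z f] assms
  by (simp add: arrows_ob tensor_ob unit_ob pair_in bang_in pair_Run)

lemma comp_lun_inv:
  assumes "f \<in> z \<leadsto> a"
  shows "f \<cdot> lun_inv V a = pair z \<star> a (bang z) f"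
  using iso_transpose[OF Lun_iso[of a], of "pair z \<star> a (bang z) f" z f] assms
  by (simp add: arrows_ob tensor_ob unit_ob pair_in bang_in pair_Lun)

text \<open>
  The Yoneda principle: the identity of \<open>a\<close> is one of the elements \<open>x\<close>. It is what reduces
  equations between arrows to equations between generalized elements.
\<close>

lemma arrow_eqI:
  assumes "f \<in> a \<leadsto> b" "g \<in> a \<leadsto> b" "\<And>z x. x \<in> z \<leadsto> a \<Longrightarrow> x \<cdot> f = x \<cdot> g"
  shows "f = g"
  using assms(3)[OF id_in[OF arrows_ob(1)[OF assms(1)]]] id_left[OF assms(1)] id_left[OF assms(2)] by simp

section \<open>Interchange\<close>

lemma Mid_in: "\<lbrakk>p \<in> Ob V; s \<in> Ob V; r \<in> Ob V; t \<in> Ob V\<rbrakk> \<Longrightarrow>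
    Mid V p s r t \<in> (p \<otimes> s) \<otimes> (r \<otimes> t) \<leadsto> (p \<otimes> r) \<otimes> (s \<otimes> t)"
  using involution by (auto simp: relator_involution_def arrows_def tensor_ob)

lemma Mid_nat:
  "\<lbrakk>f \<in> p \<leadsto> p'; g \<in> s \<leadsto> s'; h \<in> r \<leadsto> r'; k \<in> t \<leadsto> t'\<rbrakk> \<Longrightarrow>
   ((f \<odot> g) \<odot> (h \<odot> k)) \<cdot> Mid V p' s' r' t' = Mid V p s r t \<cdot> ((f \<odot> h) \<odot> (g \<odot> k))"
  using involution_nat unfolding involution_natural_iso_def arrows_def by auto

lemma Mid_Lun: "\<lbrakk>r \<in> Ob V; t \<in> Ob V\<rbrakk> \<Longrightarrow>
    (Lun V \<star> \<odot> Idn V (r \<otimes> t)) \<cdot> Lun V (r \<otimes> t) = Mid V \<star> \<star> r t \<cdot> (Lun V r \<odot> Lun V t)"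
  and Mid_Run: "\<lbrakk>p \<in> Ob V; s \<in> Ob V\<rbrakk> \<Longrightarrow>
    (Idn V (p \<otimes> s) \<odot> Lun V \<star>) \<cdot> Run V (p \<otimes> s) = Mid V p s \<star> \<star> \<cdot> (Run V p \<odot> Run V s)"
  using involution by (auto simp: relator_involution_def)

text \<open>
  Naturality along \<open>R \<rightarrow> \<star>\<close> and \<open>T \<rightarrow> \<star>\<close> reduces the first entries to the right unit condition on the
  interchange.
\<close>

lemma Mid_pr1:
  assumes "P \<in> Ob V" "S \<in> Ob V" "R \<in> Ob V" "T \<in> Ob V"
  shows "Mid V P S R T \<cdot> (pr1 P R \<odot> pr1 S T) = pr1 (P \<otimes> S) (R \<otimes> T)"
proof -
  note iP = id_in[OF assms(1)] and iS = id_in[OF assms(2)] and bR = bang_in[OF assms(3)] and bT = bang_in[OF assms(4)]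
  note RP = Run_in[OF assms(1)] and RS = Run_in[OF assms(2)]
  note M = Mid_in[OF assms]
  note l = tensor_in[OF tensor_in[OF iP bR] tensor_in[OF iS bT]]
  note n = tensor_in[OF tensor_in[OF iP iS] tensor_in[OF bR bT]]
  note M' = Mid_in[OF assms(1,2) unit_ob unit_ob]
  note PS = tensor_ob[OF assms(1,2)] and RT = tensor_ob[OF assms(3,4)]
  note L = Lun_in[OF unit_ob]
  have "Mid V P S R T \<cdot> (pr1 P R \<odot> pr1 S T) =
     Mid V P S R T \<cdot> (((Idn V P \<odot> bang R) \<odot> (Idn V S \<odot> bang T)) \<cdot> (Run V P \<odot> Run V S))"
    unfolding pr1_def by (simp only: tensor_comp[OF tensor_in[OF iP bR] RP tensor_in[OF iS bT] RS])
  also have "\<dots> = (Mid V P S R T \<cdot> ((Idn V P \<odot> bang R) \<odot> (Idn V S \<odot> bang T))) \<cdot> (Run V P \<odot> Run V S)"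
    by (rule assoc[OF M l tensor_in[OF RP RS], symmetric])
  also have "\<dots> = ((Idn V P \<odot> Idn V S) \<odot> (bang R \<odot> bang T)) \<cdot> Mid V P S \<star> \<star> \<cdot> (Run V P \<odot> Run V S)"
    by (simp only: Mid_nat[OF iP iS bR bT])
  also have "\<dots> = ((Idn V P \<odot> Idn V S) \<odot> (bang R \<odot> bang T)) \<cdot> (Mid V P S \<star> \<star> \<cdot> (Run V P \<odot> Run V S))"
    by (rule assoc[OF n M' tensor_in[OF RP RS]])
  also have "\<dots> = ((Idn V P \<odot> Idn V S) \<odot> (bang R \<odot> bang T)) \<cdot> ((Idn V (P \<otimes> S) \<odot> Lun V \<star>) \<cdot> Run V (P \<otimes> S))"
    by (simp only: Mid_Run[OF assms(1,2)])
  also have "\<dots> = ((Idn V P \<odot> Idn V S) \<odot> (bang R \<odot> bang T)) \<cdot> (Idn V (P \<otimes> S) \<odot> Lun V \<star>) \<cdot> Run V (P \<otimes> S)"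
    by (rule assoc[OF n tensor_in[OF id_in[OF PS] L] Run_in[OF PS], symmetric])
  also have "\<dots> = pr1 (P \<otimes> S) (R \<otimes> T)"
    using to_unit_unique[OF comp_in[OF tensor_in[OF bR bT] L] bang_in[OF RT]]
    by (simp only: tensor_comp[OF id_in[OF PS] id_in[OF PS] tensor_in[OF bR bT] L]
       tensor_id[OF assms(1,2)] id_left[OF id_in[OF PS]] pr1_def)
  finally show ?thesis .
qed

text \<open>
  Symmetrically, \<open>P \<rightarrow> \<star>\<close> and \<open>S \<rightarrow> \<star>\<close> reduce the last entries to the left unit condition.
\<close>

lemma Mid_pr2:
  assumes "P \<in> Ob V" "S \<in> Ob V" "R \<in> Ob V" "T \<in> Ob V"
  shows "Mid V P S R T \<cdot> (pr2 P R \<odot> pr2 S T) = pr2 (P \<otimes> S) (R \<otimes> T)"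
proof -
  note bP = bang_in[OF assms(1)] and bS = bang_in[OF assms(2)] and iR = id_in[OF assms(3)] and iT = id_in[OF assms(4)]
  note LR = Lun_in[OF assms(3)] and LT = Lun_in[OF assms(4)]
  note M = Mid_in[OF assms]
  note l = tensor_in[OF tensor_in[OF bP iR] tensor_in[OF bS iT]]
  note n = tensor_in[OF tensor_in[OF bP bS] tensor_in[OF iR iT]]
  note M' = Mid_in[OF unit_ob unit_ob assms(3,4)]
  note PS = tensor_ob[OF assms(1,2)] and RT = tensor_ob[OF assms(3,4)]
  note L = Lun_in[OF unit_ob]
  have "Mid V P S R T \<cdot> (pr2 P R \<odot> pr2 S T) =
     Mid V P S R T \<cdot> (((bang P \<odot> Idn V R) \<odot> (bang S \<odot> Idn V T)) \<cdot> (Lun V R \<odot> Lun V T))"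
    unfolding pr2_def by (simp only: tensor_comp[OF tensor_in[OF bP iR] LR tensor_in[OF bS iT] LT])
  also have "\<dots> = (Mid V P S R T \<cdot> ((bang P \<odot> Idn V R) \<odot> (bang S \<odot> Idn V T))) \<cdot> (Lun V R \<odot> Lun V T)"
    by (rule assoc[OF M l tensor_in[OF LR LT], symmetric])
  also have "\<dots> = ((bang P \<odot> bang S) \<odot> (Idn V R \<odot> Idn V T)) \<cdot> Mid V \<star> \<star> R T \<cdot> (Lun V R \<odot> Lun V T)"
    by (simp only: Mid_nat[OF bP bS iR iT])
  also have "\<dots> = ((bang P \<odot> bang S) \<odot> (Idn V R \<odot> Idn V T)) \<cdot> (Mid V \<star> \<star> R T \<cdot> (Lun V R \<odot> Lun V T))"
    by (rule assoc[OF n M' tensor_in[OF LR LT]])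
  also have "\<dots> = ((bang P \<odot> bang S) \<odot> (Idn V R \<odot> Idn V T)) \<cdot> ((Lun V \<star> \<odot> Idn V (R \<otimes> T)) \<cdot> Lun V (R \<otimes> T))"
    by (simp only: Mid_Lun[OF assms(3,4)])
  also have "\<dots> = ((bang P \<odot> bang S) \<odot> (Idn V R \<odot> Idn V T)) \<cdot> (Lun V \<star> \<odot> Idn V (R \<otimes> T)) \<cdot> Lun V (R \<otimes> T)"
    by (rule assoc[OF n tensor_in[OF L id_in[OF RT]] Lun_in[OF RT], symmetric])
  also have "\<dots> = pr2 (P \<otimes> S) (R \<otimes> T)"
    using to_unit_unique[OF comp_in[OF tensor_in[OF bP bS] L] bang_in[OF PS]]
    by (simp only: tensor_comp[OF tensor_in[OF bP bS] L id_in[OF RT] id_in[OF RT]]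
       tensor_id[OF assms(3,4)] id_left[OF id_in[OF RT]] pr2_def)
  finally show ?thesis .
qed

lemma pair_Mid:
  assumes p: "p \<in> z \<leadsto> P" and s: "s \<in> z \<leadsto> S" and r: "r \<in> z \<leadsto> R" and t: "t \<in> z \<leadsto> T"
  shows "pair z (P \<otimes> S) (R \<otimes> T) (pair z P S p s) (pair z R T r t) \<cdot> Mid V P S R T =
         pair z (P \<otimes> R) (S \<otimes> T) (pair z P R p r) (pair z S T s t)" (is "?x \<cdot> _ = _")
proof -
  have ob: "P \<in> Ob V" "S \<in> Ob V" "R \<in> Ob V" "T \<in> Ob V" "z \<in> Ob V"
    using assms by (auto simp: arrows_ob)
  note x = pair_in[OF pair_in[OF p s] pair_in[OF r t]]
  note M = Mid_in[OF ob(1-4)]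
  obtain p' r' s' t' where e: "p' \<in> z \<leadsto> P" "r' \<in> z \<leadsto> R" "s' \<in> z \<leadsto> S" "t' \<in> z \<leadsto> T"
     and eq: "?x \<cdot> Mid V P S R T = pair z (P \<otimes> R) (S \<otimes> T) (pair z P R p' r') (pair z S T s' t')"
    using comp_in[OF x M] ob by (metis pair_cases tensor_ob)
  note e' = pair_in[OF e(1,2)] pair_in[OF e(3,4)]
  have "pair z P S p s = ?x \<cdot> Mid V P S R T \<cdot> (pr1 P R \<odot> pr1 S T)"
    by (simp only: assoc[OF x M tensor_in[OF pr1_in[OF ob(1,3)] pr1_in[OF ob(2,4)]]] Mid_pr1[OF ob(1-4)]
         pair_pr1[OF pair_in[OF p s] pair_in[OF r t]])
  also have "\<dots> = pair z P S p' s'"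
    by (simp only: eq pair_tensor[OF e' pr1_in[OF ob(1,3)] pr1_in[OF ob(2,4)]] pair_pr1[OF e(1,2)] pair_pr1[OF e(3,4)])
  finally have 1: "p = p' \<and> s = s'" using pair_inject[OF _ p s e(1,3)] by blast
  have "pair z R T r t = ?x \<cdot> Mid V P S R T \<cdot> (pr2 P R \<odot> pr2 S T)"
    by (simp only: assoc[OF x M tensor_in[OF pr2_in[OF ob(1,3)] pr2_in[OF ob(2,4)]]] Mid_pr2[OF ob(1-4)]
         pair_pr2[OF pair_in[OF p s] pair_in[OF r t]])
  also have "\<dots> = pair z R T r' t'"
    by (simp only: eq pair_tensor[OF e' pr2_in[OF ob(1,3)] pr2_in[OF ob(2,4)]] pair_pr2[OF e(1,2)] pair_pr2[OF e(3,4)])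
  finally have 2: "r = r' \<and> t = t'" using pair_inject[OF _ r t e(2,4)] by blast
  show ?thesis using eq 1 2 by simp
qed

lemma pair_swap:
  assumes r: "r \<in> z \<leadsto> R" and s: "s \<in> z \<leadsto> S"
  shows "pair z R S r s \<cdot> swap V R S = pair z S R s r"
proof -
  have ob: "R \<in> Ob V" "S \<in> Ob V" "z \<in> Ob V" using assms by (auto simp: arrows_ob)
  note b = bang_in[OF ob(3)]
  note x = pair_in[OF r s]
  note l = tensor_in[OF lun_inv_in[OF ob(1)] run_inv_in[OF ob(2)]]
  note M = Mid_in[OF unit_ob ob(1,2) unit_ob]
  note n = tensor_in[OF Lun_in[OF ob(2)] Run_in[OF ob(1)]]
  have "pair z R S r s \<cdot> swap V R S = 
      pair z R S r s \<cdot> (lun_inv V R \<odot> run_inv V S) \<cdot> Mid V \<star> R S \<star> \<cdot> (Lun V S \<odot> Run V R)"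
    unfolding swap_def
    by (simp only: assoc[OF x comp_in[OF l M] n] assoc[OF x l M])
  also have "\<dots> = pair z S R s r"
    by (simp only: pair_tensor[OF r s lun_inv_in[OF ob(1)] run_inv_in[OF ob(2)]]
       comp_lun_inv[OF r] comp_run_inv[OF s] pair_Mid[OF b r s b]
       pair_tensor[OF pair_in[OF b s] pair_in[OF r b] Lun_in[OF ob(2)] Run_in[OF ob(1)]]
       pair_Run[OF r b] pair_Lun[OF s b])
  finally show ?thesis .
qed

lemma swap_in: "R \<in> Ob V \<Longrightarrow> S \<in> Ob V \<Longrightarrow> swap V R S \<in> R \<otimes> S \<leadsto> S \<otimes> R"
  unfolding swap_def
  by (rule comp_in[OF comp_in[OF tensor_in[OF lun_inv_in run_inv_in] Mid_in[OF unit_ob _ _ unit_ob]]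
      tensor_in[OF Lun_in Run_in]])

section \<open>Associativity\<close>

lemma Asc_iso: "\<lbrakk>a \<in> Ob V; b \<in> Ob V; c \<in> Ob V\<rbrakk> \<Longrightarrow>
    is_iso V ((a \<otimes> b) \<otimes> c) (a \<otimes> (b \<otimes> c)) (Asc V a b c)"
  and Asc_pentagon: "\<lbrakk>a \<in> Ob V; b \<in> Ob V; c \<in> Ob V; d \<in> Ob V\<rbrakk> \<Longrightarrow>
     (Asc V a b c \<odot> Idn V d) \<cdot> Asc V a (b \<otimes> c) d \<cdot> (Idn V a \<odot> Asc V b c d) =
     Asc V (a \<otimes> b) c d \<cdot> Asc V a b (c \<otimes> d)"
  using associativity_V by (simp_all add: associativity_def)

lemma Asc_in: "\<lbrakk>a \<in> Ob V; b \<in> Ob V; c \<in> Ob V\<rbrakk> \<Longrightarrow>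
    Asc V a b c \<in> (a \<otimes> b) \<otimes> c \<leadsto> a \<otimes> (b \<otimes> c)"
  by (simp add: Asc_iso iso_in tensor_ob)

lemma Asc_nat: "\<lbrakk>f \<in> a \<leadsto> a'; g \<in> b \<leadsto> b'; h \<in> c \<leadsto> c'\<rbrakk> \<Longrightarrow>
    ((f \<odot> g) \<odot> h) \<cdot> Asc V a' b' c' = Asc V a b c \<cdot> (f \<odot> (g \<odot> h))"
  using associativity_V unfolding associativity_def arrows_def by auto

lemma Asc_triangle: "\<lbrakk>a \<in> Ob V; b \<in> Ob V\<rbrakk> \<Longrightarrow>
    Asc V a \<star> b \<cdot> (Idn V a \<odot> Lun V b) = Run V a \<odot> Idn V b"
  using final_V by (auto simp: final_unit_def)

text \<open>middle nat_component\<close>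

text \<open>
  What the associativity does to the middle one of three entries, computed with the outer objects
  equal to \<open>\<star>\<close>.
\<close>

definition mid_Asc :: "'o \<Rightarrow> 'o \<Rightarrow> 'm \<Rightarrow> 'm" where
  "mid_Asc z b x = pair z (\<star> \<otimes> b) \<star> (pair z \<star> b (bang z) x) (bang z)
     \<cdot> Asc V \<star> b \<star> \<cdot> pr2 \<star> (b \<otimes> \<star>) \<cdot> pr1 b \<star>"

lemma Asc_natural_elements:
  assumes "x \<in> z \<leadsto> a" "y \<in> z \<leadsto> b" "w \<in> z \<leadsto> c" "f \<in> a \<leadsto> a'" "g \<in> b \<leadsto> b'" "h \<in> c \<leadsto> c'"
  shows "pair z (a' \<otimes> b') c' (pair z a' b' (x \<cdot> f) (y \<cdot> g)) (w \<cdot> h) \<cdot> Asc V a' b' c' =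
     pair z (a \<otimes> b) c (pair z a b x y) w \<cdot> Asc V a b c \<cdot> (f \<odot> (g \<odot> h))"
proof -
  note ob = arrows_ob[OF assms(4)] arrows_ob[OF assms(5)] arrows_ob[OF assms(6)]
  note x = pair_in[OF pair_in[OF assms(1,2)] assms(3)]
  show ?thesis
    by (simp only: assoc[OF x Asc_in[OF ob(1,3,5)] tensor_in[OF assms(4) tensor_in[OF assms(5,6)]]]
     Asc_nat[OF assms(4-6), symmetric]
     assoc[OF x tensor_in[OF tensor_in[OF assms(4,5)] assms(6)] Asc_in[OF ob(2,4,6)], symmetric]
     pair_tensor[OF pair_in[OF assms(1,2)] assms(3) tensor_in[OF assms(4,5)] assms(6)]
     pair_tensor[OF assms(1,2,4,5)])
qed

text \<open>
  Naturality along \<open>b \<rightarrow> \<star>\<close> and the triangle give the outer entries, naturality along \<open>a \<rightarrow> \<star>\<close> and \<open>c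
  \<rightarrow> \<star>\<close> the middle one.
\<close>

lemma pair_Asc_outer:
  assumes x: "x \<in> z \<leadsto> a" and y: "y \<in> z \<leadsto> b" and w: "w \<in> z \<leadsto> c"
  shows "pair z (a \<otimes> b) c (pair z a b x y) w \<cdot> Asc V a b c =
      pair z a (b \<otimes> c) x (pair z b c (mid_Asc z b y) w)" and "mid_Asc z b y \<in> z \<leadsto> b"
proof -
  have ob: "a \<in> Ob V" "b \<in> Ob V" "c \<in> Ob V" "z \<in> Ob V" using assms by (auto simp: arrows_ob)
  note e = pair_in[OF pair_in[OF x y] w] and A = Asc_in[OF ob(1-3)]
  obtain x' y' w' where e': "x' \<in> z \<leadsto> a" "y' \<in> z \<leadsto> b" "w' \<in> z \<leadsto> c"
    and eq: "pair z (a \<otimes> b) c (pair z a b x y) w \<cdot> Asc V a b c = pair z a (b \<otimes> c) x' (pair z b c y' w')"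
    using comp_in[OF e A] ob by (metis pair_cases tensor_ob)
  note ia = id_in[OF ob(1)] and ib = id_in[OF ob(2)] and ic = id_in[OF ob(3)]
  note b = bang_in[OF ob(4)] bang_in[OF ob(1)] bang_in[OF ob(2)] bang_in[OF ob(3)]
  note e1 = pair_in[OF e'(2,3)]
  have "pair z (a \<otimes> \<star>) c (pair z a \<star> x (bang z)) w \<cdot> Asc V a \<star> c = pair z a (\<star> \<otimes> c) x' (pair z \<star> c (bang z) w')"
    using Asc_natural_elements[OF x y w ia b(3) ic]
    by (simp only: eq id_right[OF x] comp_bang[OF y] id_right[OF w] pair_tensor[OF e'(1) e1 ia tensor_in[OF b(3) ic]]
       pair_tensor[OF e'(2,3) b(3) ic] id_right[OF e'(1)] comp_bang[OF e'(2)] id_right[OF e'(3)])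
  then have "pair z (a \<otimes> \<star>) c (pair z a \<star> x (bang z)) w \<cdot> Asc V a \<star> c \<cdot> (Idn V a \<odot> Lun V c) = 
      pair z a (\<star> \<otimes> c) x' (pair z \<star> c (bang z) w') \<cdot> (Idn V a \<odot> Lun V c)" by simp
  then have "pair z a c x w = pair z a c x' w'"
    by (simp only: assoc[OF pair_in[OF pair_in[OF x b(1)] w] Asc_in[OF ob(1) unit_ob ob(3)] tensor_in[OF ia Lun_in[OF
        ob(3)]]]
      Asc_triangle[OF ob(1,3)] pair_tensor[OF pair_in[OF x b(1)] w Run_in[OF ob(1)] ic]
      pair_tensor[OF e'(1) pair_in[OF b(1) e'(3)] ia Lun_in[OF ob(3)]] pair_Run[OF x b(1)] id_right[OF w]
      pair_Lun[OF e'(3) b(1)] id_right[OF e'(1)])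
  then have 1: "x' = x" "w' = w" using pair_inject[OF _ x w e'(1,3)] by blast+
  have "pair z (\<star> \<otimes> b) \<star> (pair z \<star> b (bang z) y) (bang z) \<cdot> Asc V \<star> b \<star> = 
     pair z \<star> (b \<otimes> \<star>) (bang z) (pair z b \<star> y' (bang z))"
    using Asc_natural_elements[OF x y w b(2) ib b(4)]
    by (simp only: eq id_right[OF y] comp_bang[OF x] comp_bang[OF w] pair_tensor[OF e'(1) e1 b(2) tensor_in[OF ib b(4)]]
       pair_tensor[OF e'(2,3) ib b(4)] id_right[OF e'(2)] comp_bang[OF e'(1)] comp_bang[OF e'(3)])
  then have 2: "mid_Asc z b y = y'"
    unfolding mid_Asc_def by (simp only: pair_pr2[OF b(1) pair_in[OF e'(2) b(1)]] pair_pr1[OF e'(2) b(1)])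
  show "pair z (a \<otimes> b) c (pair z a b x y) w \<cdot> Asc V a b c =
      pair z a (b \<otimes> c) x (pair z b c (mid_Asc z b y) w)" and "mid_Asc z b y \<in> z \<leadsto> b"
    using eq 1 2 e' by simp_all
qed

lemma mid_Asc_nat:
  assumes y: "y \<in> z \<leadsto> b" and g: "g \<in> b \<leadsto> b'"
  shows "mid_Asc z b' (y \<cdot> g) = mid_Asc z b y \<cdot> g"
proof -
  have ob: "z \<in> Ob V" using arrows_ob y by auto
  note b = bang_in[OF ob] and i = id_in[OF unit_ob] and m = pair_Asc_outer(2)[OF b _ b]
  note yg = comp_in[OF y g] 
  have "pair z \<star> (b' \<otimes> \<star>) (bang z) (pair z b' \<star> (mid_Asc z b' (y \<cdot> g)) (bang z)) =
        pair z \<star> (b' \<otimes> \<star>) (bang z) (pair z b' \<star> (mid_Asc z b y \<cdot> g) (bang z))"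
    using Asc_natural_elements[OF b y b i g i]
    by (simp only: pair_Asc_outer(1)[OF b y b] id_right[OF b] pair_Asc_outer(1)[OF b yg b]
        pair_tensor[OF b pair_in[OF m[OF y] b] i tensor_in[OF g i]] pair_tensor[OF m[OF y] b g i])
  then have "pair z b' \<star> (mid_Asc z b' (y \<cdot> g)) (bang z) = pair z b' \<star> (mid_Asc z b y \<cdot> g) (bang z)"
    using pair_inject[OF _ b pair_in[OF m[OF yg] b] b pair_in[OF comp_in[OF m[OF y] g] b]] by blast
  then show ?thesis
    using pair_inject[OF _ m[OF yg] b comp_in[OF m[OF y] g] b] by blast
qed

lemma mid_Asc_inject:
  assumes y: "y \<in> z \<leadsto> b" and y': "y' \<in> z \<leadsto> b" and eq: "mid_Asc z b y = mid_Asc z b y'"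
  shows "y = y'"
proof -
  have ob: "z \<in> Ob V" "b \<in> Ob V" using arrows_ob y by auto
  note b = bang_in[OF ob(1)]
  note e = pair_in[OF pair_in[OF b y] b] and e' = pair_in[OF pair_in[OF b y'] b]
  note A = Asc_in[OF unit_ob ob(2) unit_ob]
  note inv = arrow_inv_inverse[OF Asc_iso[OF unit_ob ob(2) unit_ob]
     tensor_ob[OF tensor_ob[OF unit_ob ob(2)] unit_ob] tensor_ob[OF unit_ob tensor_ob[OF ob(2) unit_ob]]]
  have "pair z (\<star> \<otimes> b) \<star> (pair z \<star> b (bang z) y) (bang z) \<cdot> Asc V \<star> b \<star> = 
        pair z (\<star> \<otimes> b) \<star> (pair z \<star> b (bang z) y') (bang z) \<cdot> Asc V \<star> b \<star>"
    by (simp only: pair_Asc_outer(1)[OF b y b] pair_Asc_outer(1)[OF b y' b] eq)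
  then have "pair z (\<star> \<otimes> b) \<star> (pair z \<star> b (bang z) y) (bang z) = 
        pair z (\<star> \<otimes> b) \<star> (pair z \<star> b (bang z) y') (bang z)"
    using assoc[OF e A inv(1)] assoc[OF e' A inv(1)] id_right[OF e] id_right[OF e'] inv(2) by metis
  then show ?thesis
    using pair_inject[OF _ pair_in[OF b y] b pair_in[OF b y'] b] pair_inject[OF _ b y b y'] by blast
qed

text \<open>
  Follow \<open>y\<close> through the pentagon for \<open>\<star>, b, \<star>, \<star>\<close>. On one side it is in the middle position twice,
  first as \<open>b\<close> and then inside \<open>b \<otimes> \<star>\<close>; on the other side only once. So \<open>mid_Asc\<close> is idempotent,
  and it is injective because the associativity is invertible.
\<close>

lemma mid_Asc_id:
  assumes y: "y \<in> z \<leadsto> b"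
  shows "mid_Asc z b y = y"
proof -
  have ob: "z \<in> Ob V" "b \<in> Ob V" using arrows_ob y by auto
  note b = bang_in[OF ob(1)] and m = pair_Asc_outer(2)[OF b _ b]
  note u = unit_ob and i = id_in[OF unit_ob]
  let ?x = "pair z ((\<star> \<otimes> b) \<otimes> \<star>) \<star> (pair z (\<star> \<otimes> b) \<star> (pair z \<star> b (bang z) y) (bang z)) (bang z)"
  note p1 = pair_in[OF b y] note p2 = pair_in[OF p1 b] note x = pair_in[OF p2 b]
  note A = tensor_in[OF Asc_in[OF u ob(2) u] i] Asc_in[OF u tensor_ob[OF ob(2) u] u] tensor_in[OF i Asc_in[OF ob(2) u u]]
    Asc_in[OF tensor_ob[OF u ob(2)] u u] Asc_in[OF u ob(2) tensor_ob[OF u u]]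
  note q1 = pair_in[OF m[OF y] b] 
  note q2 = pair_Asc_outer(2)[OF b q1 b]
  note bb = pair_in[OF b b]
  note mb = to_unit_unique[OF m[OF b] b]
  obtain y2 t where y2: "y2 \<in> z \<leadsto> b" "t \<in> z \<leadsto> \<star>" "mid_Asc z (b \<otimes> \<star>) (pair z b \<star> (mid_Asc z b y) (bang z)) = pair z b \<star> y2 t"
    using q2 ob u by (metis pair_cases)
  have t: "t = bang z" using y2(2) b to_unit_unique by blast
  note q3 = pair_in[OF y2(1) b]
  \<comment> \<open>with all outer entries equal to \<open>bang z\<close>, only the entry in \<open>b\<close> is informative\<close>
  have "?x \<cdot> ((Asc V \<star> b \<star> \<odot> Idn V \<star>) \<cdot> Asc V \<star> (b \<otimes> \<star>) \<star> \<cdot> (Idn V \<star> \<odot> Asc V b \<star> \<star>)) =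
    ?x \<cdot> (Asc V (\<star> \<otimes> b) \<star> \<star> \<cdot> Asc V \<star> b (\<star> \<otimes> \<star>))"
    by (simp only: Asc_pentagon[OF u ob(2) u u])
  then have "pair z \<star> (b \<otimes> (\<star> \<otimes> \<star>)) (bang z) (pair z b (\<star> \<otimes> \<star>) y2 (pair z \<star> \<star> (bang z) (bang z))) =
     pair z \<star> (b \<otimes> (\<star> \<otimes> \<star>)) (bang z) (pair z b (\<star> \<otimes> \<star>) (mid_Asc z b y) (pair z \<star> \<star> (bang z) (bang z)))"
    by (simp only: assoc[OF x comp_in[OF A(1,2)] A(3), symmetric] assoc[OF x A(1,2), symmetric]
       assoc[OF x A(4,5), symmetric] pair_tensor[OF p2 b Asc_in[OF u ob(2) u] i] id_right[OF b]
       pair_Asc_outer(1)[OF b y b] pair_Asc_outer(1)[OF b q1 b] y2(3) t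
       pair_tensor[OF b pair_in[OF q3 b] i Asc_in[OF ob(2) u u]]
       pair_Asc_outer(1)[OF y2(1) b b] pair_Asc_outer(1)[OF p1 b b] mb
       pair_Asc_outer(1)[OF b y bb])
  then have "y2 = mid_Asc z b y"
    using pair_inject[OF _ b pair_in[OF y2(1) bb] b pair_in[OF m[OF y] bb]] 
       pair_inject[OF _ y2(1) bb m[OF y] bb] by blast
  \<comment> \<open>the entry in \<open>b \<otimes> \<star>\<close> moved as a whole is moved in its projection to \<open>b\<close>, by naturality\<close>
  moreover have "y2 = mid_Asc z b (mid_Asc z b y)"
    using mid_Asc_nat[OF q1 pr1_in[OF ob(2) u]] 
    by (simp only: y2(3) pair_pr1[OF m[OF y] b] pair_pr1[OF y2(1,2)])
  ultimately show ?thesis using mid_Asc_inject[OF m[OF y] y] by simp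
qed

lemma pair_Asc:
  assumes "x \<in> z \<leadsto> a" "y \<in> z \<leadsto> b" "w \<in> z \<leadsto> c"
  shows "pair z (a \<otimes> b) c (pair z a b x y) w \<cdot> Asc V a b c = pair z a (b \<otimes> c) x (pair z b c y w)"
  using pair_Asc_outer(1)[OF assms] mid_Asc_id[OF assms(2)] by simp

section \<open>Small products and equalizers\<close>

text \<open>
  Products are needed over small sets and over sets of pairs of small elements.
\<close>

definition small_index :: "'i set \<Rightarrow> bool" where
  "small_index I \<longleftrightarrow> (\<exists>c :: 'i \<Rightarrow> 's. inj_on c I)"

lemma small_index_small: "small_index (S :: 's set)"
  unfolding small_index_def by (rule exI[of _ id]) simp

lemma small_index_pairs: "small_index (S :: ('s \<times> 's) set)"
proof -
  obtain c where "bij_betw c (UNIV \<times> UNIV :: ('s \<times> 's) set) (UNIV :: 's set)"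
    using card_of_Times_same_infinite[OF infinite_small] unfolding card_of_ordIso[symmetric] by blast
  then have "inj_on c S" by (auto simp: bij_betw_def intro: inj_on_subset)
  then show ?thesis unfolding small_index_def by blast
qed

text \<open>
  A product is the limit over a discrete small category, with each object standing for its
  identity.
\<close>

lemma product_exists:
  fixes I :: "'i set"
  assumes "small_index I" "\<And>i. i \<in> I \<Longrightarrow> p i \<in> Ob V"
  shows "\<exists>P q. is_product V I p P q"
proof -
  obtain c :: "'i \<Rightarrow> 's" where c: "inj_on c I" using assms(1) unfolding small_index_def by blast
  define d where "d = the_inv_into I c"
  have dc: "d (c i) = i" if "i \<in> I" for i using that c unfolding d_def by (simp add: the_inv_into_f_f)
  define J :: "('s, 's) cat" where
    "J = \<lparr>Ob = c ` I, Hom = (\<lambda>i j. if i = j then {i} else {}), Idn = (\<lambda>i. i), Cmp = (\<lambda>u v. u)\<rparr>"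
  define D1 where "D1 = (\<lambda>u. Idn V (p (d u)))"
  have J: "category J" unfolding category_def J_def by auto
  have D: "is_diagram J V (\<lambda>u. p (d u)) D1"
    unfolding is_diagram_def J_def D1_def
    using id_in assms(2) id_left[OF id_in[OF assms(2)]]
    by (auto simp: dc arrows_def inj_on_eq_iff[OF c])
  obtain l q where l: "is_limit J V (\<lambda>u. p (d u)) D1 l q"
    using complete J D unfolding small_complete_def by blast
  have cone: "is_cone J V (\<lambda>u. p (d u)) D1 a k \<longleftrightarrow> a \<in> Ob V \<and> (\<forall>i\<in>I. k (c i) \<in> Hom V a (p i))" for a k
  proof -
    have "k (c i) \<cdot> D1 (c i) = k (c i)" if "k (c i) \<in> Hom V a (p i)" "i \<in> I" "a \<in> Ob V" for i
      unfolding D1_def using that assms(2)[of i] id_right[of "k (c i)" a "p i"] by (auto simp: dc arrows_def)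
    then show ?thesis unfolding is_cone_def J_def by (auto simp: dc)
  qed
  have "is_product V I p l (\<lambda>i. q (c i))"
    unfolding is_product_def
  proof (intro conjI ballI allI impI)
    show "q (c i) \<in> Hom V l (p i)" if "i \<in> I" for i
      using l that unfolding is_limit_def cone by auto
    show "l \<in> Ob V" using l unfolding is_limit_def cone by auto
    fix a k assume "a \<in> Ob V" and "\<forall>i\<in>I. k i \<in> Hom V a (p i)"
    then have "is_cone J V (\<lambda>u. p (d u)) D1 a (\<lambda>u. k (d u))" unfolding cone by (auto simp: dc)
    then have "\<exists>!u. u \<in> Hom V a l \<and> (\<forall>i\<in>Ob J. u \<cdot> q i = k (d i))"
      using l unfolding is_limit_def by blast
    then show "\<exists>!u. u \<in> Hom V a l \<and> (\<forall>i\<in>I. u \<cdot> q (c i) = k i)" by (simp add: J_def dc)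
  qed
  then show ?thesis by blast
qed

context
  fixes I :: "'i set" and p :: "'i \<Rightarrow> 'o"
  assumes I: "small_index I" and p: "\<And>i. i \<in> I \<Longrightarrow> p i \<in> Ob V"
begin

lemma chosen_product: "is_product V I p (prod_ob V I p) (proj V I p)"
proof -
  obtain P q where "is_product V I p P q" using product_exists[of I p, OF I p] by blast
  then have "is_product V I p (fst (P, q)) (snd (P, q))" by simp
  then show ?thesis unfolding prod_ob_def proj_def prod_cone_def by (rule someI)
qed

lemma prod_ob: "prod_ob V I p \<in> Ob V"
  using chosen_product by (simp add: is_product_def)

lemma proj_in: "i \<in> I \<Longrightarrow> proj V I p i \<in> prod_ob V I p \<leadsto> p i"
  using chosen_product p by (auto simp: is_product_def arrows_def)

lemma tuple_char:
  assumes "a \<in> Ob V" "\<And>i. i \<in> I \<Longrightarrow> k i \<in> a \<leadsto> p i"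
  shows "tuple V I p a k \<in> a \<leadsto> prod_ob V I p \<and> (\<forall>i\<in>I. tuple V I p a k \<cdot> proj V I p i = k i)"
proof -
  have "\<exists>!u. u \<in> Hom V a (prod_ob V I p) \<and> (\<forall>i\<in>I. u \<cdot> proj V I p i = k i)"
    using chosen_product assms unfolding is_product_def by (auto simp: arrows_def)
  from theI'[OF this] show ?thesis using prod_ob assms(1) unfolding tuple_def by (auto simp: arrows_def)
qed

lemma prod_eqI:
  assumes "u \<in> a \<leadsto> prod_ob V I p" "v \<in> a \<leadsto> prod_ob V I p"
    "\<And>i. i \<in> I \<Longrightarrow> u \<cdot> proj V I p i = v \<cdot> proj V I p i"
  shows "u = v"
proof -
  have "\<exists>!w. w \<in> Hom V a (prod_ob V I p) \<and> (\<forall>i\<in>I. w \<cdot> proj V I p i = v \<cdot> proj V I p i)"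
    using chosen_product comp_in[OF assms(2) proj_in] assms(2) unfolding is_product_def by (auto simp: arrows_def)
  moreover have "u \<in> Hom V a (prod_ob V I p) \<and> (\<forall>i\<in>I. u \<cdot> proj V I p i = v \<cdot> proj V I p i)"
    using assms(1,3) by (simp add: arrows_def)
  moreover have "v \<in> Hom V a (prod_ob V I p) \<and> (\<forall>i\<in>I. v \<cdot> proj V I p i = v \<cdot> proj V I p i)"
    using assms(2) by (simp add: arrows_def)
  ultimately show ?thesis by blast
qed

end

text \<open>
  An equalizer is the limit of a parallel pair, realized as a small category with objects \<open>n0\<close>,
  \<open>n1\<close> and arrows \<open>n2\<close>, \<open>n3\<close> from \<open>n0\<close> to \<open>n1\<close>; each object is again its own identity arrow.
\<close>

lemma equalizer_exists:
  assumes f: "f \<in> a \<leadsto> b" and g: "g \<in> a \<leadsto> b"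
  shows "\<exists>E e. is_equalizer V a b f g E e"
proof -
  obtain A :: "'s set" where "finite A" "card A = 4"
    using infinite_arbitrarily_large[OF infinite_small] by blast
  then obtain n0 n1 n2 n3 :: 's where n: "distinct [n0, n1, n2, n3]"
    by (auto simp: card_Suc_eq numeral_eq_Suc)
  define J :: "('s, 's) cat" where
    "J = \<lparr>Ob = {n0, n1},
      Hom = (\<lambda>i j. if i = n0 \<and> j = n0 then {n0} else if i = n1 \<and> j = n1 then {n1}
               else if i = n0 \<and> j = n1 then {n2, n3} else {}),
      Idn = (\<lambda>i. i), Cmp = (\<lambda>u v. if u = n0 \<or> u = n1 then v else u)\<rparr>"
  define D0 where "D0 = (\<lambda>i. if i = n0 then a else b)"
  define D1 where "D1 = (\<lambda>u. if u = n0 then Idn V a else if u = n1 then Idn V b else if u = n2 then f else g)"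
  have n': "n0 \<noteq> n1" "n1 \<noteq> n0" "n0 \<noteq> n2" "n2 \<noteq> n0" "n0 \<noteq> n3" "n3 \<noteq> n0"
     "n1 \<noteq> n2" "n2 \<noteq> n1" "n1 \<noteq> n3" "n3 \<noteq> n1" "n2 \<noteq> n3" "n3 \<noteq> n2" using n by auto
  note ob = arrows_ob[OF f]
  have m: "Idn V a \<in> Hom V a a" "Idn V b \<in> Hom V b b" "f \<in> Hom V a b" "g \<in> Hom V a b"
    using id_in f g ob by (auto simp: arrows_def)
  have J: "category J" unfolding category_def J_def by (simp add: n')
  have D: "is_diagram J V D0 D1"
    unfolding is_diagram_def J_def D0_def D1_def
    by (simp add: n' m ob id_left[OF f] id_left[OF g] id_right[OF f] id_right[OF g]
        id_left[OF id_in[OF ob(1)]] id_left[OF id_in[OF ob(2)]])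
  obtain E q where E: "is_limit J V D0 D1 E q"
    using complete J D unfolding small_complete_def by blast
  have cone: "is_cone J V D0 D1 c k \<longleftrightarrow> k n0 \<in> c \<leadsto> a \<and> k n0 \<cdot> f = k n1 \<and> k n0 \<cdot> g = k n1" for c k
  proof
    assume "is_cone J V D0 D1 c k"
    then show "k n0 \<in> c \<leadsto> a \<and> k n0 \<cdot> f = k n1 \<and> k n0 \<cdot> g = k n1"
      using ob unfolding is_cone_def J_def D1_def D0_def by (simp add: n' arrows_def)
  next
    assume k: "k n0 \<in> c \<leadsto> a \<and> k n0 \<cdot> f = k n1 \<and> k n0 \<cdot> g = k n1"
    then have "k n1 \<in> c \<leadsto> b" using comp_in[OF _ f, of "k n0" c] by simp
    with k show "is_cone J V D0 D1 c k"
      using id_right[of "k n0" c a] id_right[of "k n1" c b]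
      unfolding is_cone_def J_def D1_def D0_def by (simp add: n' arrows_def)
  qed
  have "is_equalizer V a b f g E (q n0)"
    unfolding is_equalizer_def
  proof (intro conjI ballI impI)
    have q: "is_cone J V D0 D1 E q" using E unfolding is_limit_def by blast
    show "E \<in> Ob V" "q n0 \<in> Hom V E a" "q n0 \<cdot> f = q n0 \<cdot> g" using q unfolding cone by (auto simp: arrows_def)
    fix c h assume h: "c \<in> Ob V" "h \<in> Hom V c a" "h \<cdot> f = h \<cdot> g"
    have "is_cone J V D0 D1 c (\<lambda>i. if i = n0 then h else h \<cdot> f)"
      unfolding cone using h n ob by (auto simp: arrows_def)
    then have ex: "\<exists>!u. u \<in> Hom V c E \<and> (\<forall>i\<in>Ob J. u \<cdot> q i = (if i = n0 then h else h \<cdot> f))"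
      using E unfolding is_limit_def by blast
    have "(\<forall>i\<in>Ob J. u \<cdot> q i = (if i = n0 then h else h \<cdot> f)) \<longleftrightarrow> u \<cdot> q n0 = h" if "u \<in> Hom V c E" for u
    proof -
      have "u \<cdot> q n1 = u \<cdot> q n0 \<cdot> f"
        using q assoc[of u c E "q n0" a f b] that f h(1) unfolding cone by (auto simp: arrows_def)
      then show ?thesis using n by (auto simp: J_def)
    qed
    with ex show "\<exists>!u. u \<in> Hom V c E \<and> u \<cdot> q n0 = h" by metis
  qed
  then show ?thesis by blast
qed

lemma chosen_equalizer:
  assumes f: "f \<in> a \<leadsto> b" and g: "g \<in> a \<leadsto> b"
  shows "is_equalizer V a b f g (fst (eq_cone V a b f g)) (snd (eq_cone V a b f g))"
proof -
  obtain P q where "is_equalizer V a b f g P q" using equalizer_exists[OF f g] by blast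
  then have "is_equalizer V a b f g (fst (P, q)) (snd (P, q))" by simp
  then show ?thesis unfolding eq_cone_def by (rule someI)
qed

lemma Exp_ob: "s \<in> Ob V \<Longrightarrow> t \<in> Ob V \<Longrightarrow> Exp V t s \<in> Ob V"
  using exponentials_V by (auto simp: exponentials_def)

lemma Nam_bij: "r \<in> Ob V \<Longrightarrow> s \<in> Ob V \<Longrightarrow> t \<in> Ob V \<Longrightarrow>
    bij_betw (Nam V r s t) (Hom V (r \<otimes> s) t) (Hom V r (Exp V t s))"
  using exponentials_V by (auto simp: exponentials_def)

lemma Nam_in: "s \<in> Ob V \<Longrightarrow> r \<in> Ob V \<Longrightarrow> f \<in> r \<otimes> s \<leadsto> t \<Longrightarrow> Nam V r s t f \<in> r \<leadsto> Exp V t s"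
  using bij_betwE[OF Nam_bij[of r s t]] Exp_ob[of s t] unfolding arrows_def by blast

lemma Nam_nat:
  assumes "s \<in> Ob V" "h \<in> r' \<leadsto> r" "f \<in> r \<otimes> s \<leadsto> t"
  shows "h \<cdot> Nam V r s t f = Nam V r' s t ((h \<odot> Idn V s) \<cdot> f)"
  using exponentials_V assms unfolding exponentials_def arrows_def by auto

lemma Nam_inject:
  assumes "s \<in> Ob V" "r \<in> Ob V" "f \<in> r \<otimes> s \<leadsto> t" "g \<in> r \<otimes> s \<leadsto> t"
  shows "Nam V r s t f = Nam V r s t g \<longleftrightarrow> f = g"
  using assms Nam_bij[of r s t, THEN bij_betw_imp_inj_on] by (auto simp: arrows_def dest: inj_onD)

text \<open>
  Names can be compared without exponentials: two names agree after \<open>h\<close> exactly if the named arrows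
  agree on all pairs whose first entry factors through \<open>h\<close>.
\<close>

lemma names_agree_iff:
  assumes s: "s \<in> Ob V" and h: "h \<in> z \<leadsto> r" and F: "F \<in> r \<otimes> s \<leadsto> t" and G: "G \<in> r \<otimes> s \<leadsto> t"
  shows "h \<cdot> Nam V r s t F = h \<cdot> Nam V r s t G \<longleftrightarrow>
    (\<forall>w k \<tau>. k \<in> w \<leadsto> z \<longrightarrow> \<tau> \<in> w \<leadsto> s \<longrightarrow> pair w r s (k \<cdot> h) \<tau> \<cdot> F = pair w r s (k \<cdot> h) \<tau> \<cdot> G)"
proof -
  note ob = arrows_ob[OF h]
  note hs = tensor_in[OF h id_in[OF s]]
  have ev: "pair w z s k \<tau> \<cdot> ((h \<odot> Idn V s) \<cdot> K) = pair w r s (k \<cdot> h) \<tau> \<cdot> K"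
    if "k \<in> w \<leadsto> z" "\<tau> \<in> w \<leadsto> s" "K \<in> r \<otimes> s \<leadsto> t" for w k \<tau> K
    by (simp only: assoc[OF pair_in[OF that(1,2)] hs that(3), symmetric] pair_tensor[OF that(1,2) h id_in[OF s]]
      id_right[OF that(2)])
  have "(h \<odot> Idn V s) \<cdot> F = (h \<odot> Idn V s) \<cdot> G \<longleftrightarrow>
    (\<forall>w k \<tau>. k \<in> w \<leadsto> z \<longrightarrow> \<tau> \<in> w \<leadsto> s \<longrightarrow> pair w r s (k \<cdot> h) \<tau> \<cdot> F = pair w r s (k \<cdot> h) \<tau> \<cdot> G)" (is "?l \<longleftrightarrow> ?r")
  proof
    assume ?l then show ?r using ev F G by metis
  next
    assume r: ?r
    show ?l
    proof (rule arrow_eqI[OF comp_in[OF hs F] comp_in[OF hs G]])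
      fix w x assume "x \<in> w \<leadsto> z \<otimes> s"
      then show "x \<cdot> ((h \<odot> Idn V s) \<cdot> F) = x \<cdot> ((h \<odot> Idn V s) \<cdot> G)"
        using r ev F G by (metis pair_cases ob(1) s)
    qed
  qed
  then show ?thesis
    by (simp only: Nam_nat[OF s h F] Nam_nat[OF s h G] Nam_inject[OF s ob(1) comp_in[OF hs F] comp_in[OF hs G]])
qed

section \<open>Enriched categories in terms of generalized elements\<close>

text \<open>
  The arrows from \<open>x\<close> to \<open>y\<close> at stage \<open>z\<close>. Together with \<open>comp_el\<close> and \<open>unit_el\<close>, the composition
  and the units at stage \<open>z\<close>, they form an ordinary category when \<open>X\<close> is enriched.
\<close>

definition hom :: "('x, 'o, 'd) vgraph_scheme \<Rightarrow> 'o \<Rightarrow> 'x \<Rightarrow> 'x \<Rightarrow> 'm set" where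
  "hom X z x y = {f. x \<in> Vert X \<and> y \<in> Vert X \<and> f \<in> z \<leadsto> Edg X x y}"

definition comp_el :: "('x, 'o, 'm) vcat \<Rightarrow> 'o \<Rightarrow> 'x \<Rightarrow> 'x \<Rightarrow> 'x \<Rightarrow> 'm \<Rightarrow> 'm \<Rightarrow> 'm" where
  "comp_el X z x y w f g = pair z (Edg X x y) (Edg X y w) f g \<cdot> Comps X x y w"

definition unit_el :: "('x, 'o, 'm, 'd) ovgraph_scheme \<Rightarrow> 'o \<Rightarrow> 'x \<Rightarrow> 'm" where
  "unit_el X z x = bang z \<cdot> Unt X x"

text \<open>
  The typing part of an enriched category: enough to speak of natural functors from and to the
  space \<open>pow_cat\<close> of all transports.
\<close>

definition composable :: "('x, 'o, 'm) vcat \<Rightarrow> bool" where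
  "composable X \<longleftrightarrow> original_graph V X \<and>
    (\<forall>x\<in>Vert X. \<forall>y\<in>Vert X. \<forall>z\<in>Vert X. Comps X x y z \<in> Edg X x y \<otimes> Edg X y z \<leadsto> Edg X x z)"

lemma homI: "x \<in> Vert X \<Longrightarrow> y \<in> Vert X \<Longrightarrow> f \<in> z \<leadsto> Edg X x y \<Longrightarrow> f \<in> hom X z x y"
  and homD: "f \<in> hom X z x y \<Longrightarrow> f \<in> z \<leadsto> Edg X x y"
  and hom_vert: "f \<in> hom X z x y \<Longrightarrow> x \<in> Vert X" "f \<in> hom X z x y \<Longrightarrow> y \<in> Vert X"
  and hom_ob: "f \<in> hom X z x y \<Longrightarrow> z \<in> Ob V"
  by (auto simp: hom_def arrows_def)

lemma hom_comp: "h \<in> w \<leadsto> z \<Longrightarrow> f \<in> hom X z x y \<Longrightarrow> h \<cdot> f \<in> hom X w x y"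
  by (auto simp: hom_def intro: comp_in)

lemma Edg_ob: "original_graph V X \<Longrightarrow> x \<in> Vert X \<Longrightarrow> y \<in> Vert X \<Longrightarrow> Edg X x y \<in> Ob V"
  by (auto simp: original_graph_def)

lemma Unt_in: "original_graph V X \<Longrightarrow> x \<in> Vert X \<Longrightarrow> Unt X x \<in> \<star> \<leadsto> Edg X x x"
  using unit_ob by (auto simp: original_graph_def arrows_def)

lemma composable_graph: "composable X \<Longrightarrow> original_graph V X"
  by (simp add: composable_def)

lemma Comps_in: "composable X \<Longrightarrow> x \<in> Vert X \<Longrightarrow> y \<in> Vert X \<Longrightarrow> z \<in> Vert X \<Longrightarrow>
    Comps X x y z \<in> Edg X x y \<otimes> Edg X y z \<leadsto> Edg X x z"
  by (auto simp: composable_def)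

lemma unit_el_in: "original_graph V X \<Longrightarrow> x \<in> Vert X \<Longrightarrow> z \<in> Ob V \<Longrightarrow> unit_el X z x \<in> hom X z x x"
  unfolding unit_el_def by (blast intro: homI comp_in[OF bang_in Unt_in])

lemma unit_el_unit: "original_graph V X \<Longrightarrow> x \<in> Vert X \<Longrightarrow> unit_el X \<star> x = Unt X x"
  unfolding unit_el_def bang_unit by (rule id_left[OF Unt_in])

lemma comp_el_in: 
  assumes "composable X" "f \<in> hom X z x y" "g \<in> hom X z y w"
  shows "comp_el X z x y w f g \<in> hom X z x w"
  unfolding comp_el_def
  using hom_vert[OF assms(2)] hom_vert[OF assms(3)]
  by (intro homI comp_in[OF pair_in[OF homD[OF assms(2)] homD[OF assms(3)]] Comps_in[OF assms(1)]])

text \<open>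
  Both sides of each axiom are arrows out of an iterated tensor product, so they agree as soon as
  they agree on tuples of elements; on tuples, the associativity and the unit isomorphisms act in
  the evident way.
\<close>

lemma enriched_iff:
  "enriched V X \<longleftrightarrow> composable X \<and>
     (\<forall>t w x y z f g h. f \<in> hom X t w x \<longrightarrow> g \<in> hom X t x y \<longrightarrow> h \<in> hom X t y z \<longrightarrow>
        comp_el X t w y z (comp_el X t w x y f g) h = comp_el X t w x z f (comp_el X t x y z g h)) \<and>
     (\<forall>t x y f. f \<in> hom X t x y \<longrightarrow>
        comp_el X t x x y (unit_el X t x) f = f \<and> comp_el X t x y y f (unit_el X t y) = f)"
  (is "_ \<longleftrightarrow> _ \<and> ?assoc \<and> ?unit")
proof (cases "composable X")
  case C: True
  note G = composable_graph[OF C]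
  note E = Edg_ob[OF G] and K = Comps_in[OF C]
  let ?A = "\<forall>w\<in>Vert X. \<forall>x\<in>Vert X. \<forall>y\<in>Vert X. \<forall>z\<in>Vert X.
       (Comps X w x y \<odot> Idn V (Edg X y z)) \<cdot> Comps X w y z =
       Asc V (Edg X w x) (Edg X x y) (Edg X y z) \<cdot> (Idn V (Edg X w x) \<odot> Comps X x y z) \<cdot> Comps X w x z"
  let ?U = "\<forall>x\<in>Vert X. \<forall>y\<in>Vert X.
       (Unt X x \<odot> Idn V (Edg X x y)) \<cdot> Comps X x x y = Lun V (Edg X x y) \<and>
       (Idn V (Edg X x y) \<odot> Unt X y) \<cdot> Comps X x y y = Run V (Edg X x y)"
  have "enriched V X \<longleftrightarrow> ?A \<and> ?U"
    using C unfolding enriched_def composable_def by (auto simp: arrows_def)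
  moreover have "?A \<longleftrightarrow> ?assoc"
  proof -
    have ev: "pair t (Edg X w x \<otimes> Edg X x y) (Edg X y z) (pair t (Edg X w x) (Edg X x y) f g) h \<cdot>
         ((Comps X w x y \<odot> Idn V (Edg X y z)) \<cdot> Comps X w y z) = comp_el X t w y z (comp_el X t w x y f g) h"
       "pair t (Edg X w x \<otimes> Edg X x y) (Edg X y z) (pair t (Edg X w x) (Edg X x y) f g) h \<cdot>
         (Asc V (Edg X w x) (Edg X x y) (Edg X y z) \<cdot> (Idn V (Edg X w x) \<odot> Comps X x y z) \<cdot> Comps X w x z) =
         comp_el X t w x z f (comp_el X t x y z g h)"
      if f: "f \<in> hom X t w x" and g: "g \<in> hom X t x y" and h: "h \<in> hom X t y z" for t w x y z f g h
    proof -
      note v = hom_vert(1)[OF f] hom_vert(1)[OF g] hom_vert[OF h]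
      note f' = homD[OF f] and g' = homD[OF g] and h' = homD[OF h]
      note p = pair_in[OF pair_in[OF f' g'] h']
      show "pair t (Edg X w x \<otimes> Edg X x y) (Edg X y z) (pair t (Edg X w x) (Edg X x y) f g) h \<cdot>
         ((Comps X w x y \<odot> Idn V (Edg X y z)) \<cdot> Comps X w y z) = comp_el X t w y z (comp_el X t w x y f g) h"
        unfolding comp_el_def
        by (simp only: assoc[OF p tensor_in[OF K[OF v(1-3)] id_in[OF E[OF v(3,4)]]] K[OF v(1,3,4)], symmetric]
          pair_tensor[OF pair_in[OF f' g'] h' K[OF v(1-3)] id_in[OF E[OF v(3,4)]]] id_right[OF h'])
      note A = Asc_in[OF E[OF v(1,2)] E[OF v(2,3)] E[OF v(3,4)]]
      note B = tensor_in[OF id_in[OF E[OF v(1,2)]] K[OF v(2-4)]]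
      show "pair t (Edg X w x \<otimes> Edg X x y) (Edg X y z) (pair t (Edg X w x) (Edg X x y) f g) h \<cdot>
         (Asc V (Edg X w x) (Edg X x y) (Edg X y z) \<cdot> (Idn V (Edg X w x) \<odot> Comps X x y z) \<cdot> Comps X w x z) =
         comp_el X t w x z f (comp_el X t x y z g h)"
        unfolding comp_el_def
        by (simp only: assoc[OF p comp_in[OF A B] K[OF v(1,2,4)], symmetric] assoc[OF p A B, symmetric]
          pair_Asc[OF f' g' h'] pair_tensor[OF f' pair_in[OF g' h'] id_in[OF E[OF v(1,2)]] K[OF v(2-4)]]
          id_right[OF f'])
    qed
    show ?thesis
    proof
      assume a: ?A
      show ?assoc
      proof (intro allI impI)
        fix t w x y z f g h assume f: "f \<in> hom X t w x" and g: "g \<in> hom X t x y" and h: "h \<in> hom X t y z"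
        show "comp_el X t w y z (comp_el X t w x y f g) h = comp_el X t w x z f (comp_el X t x y z g h)"
          using a hom_vert[OF f] hom_vert[OF g] hom_vert[OF h] ev(1)[OF f g h] ev(2)[OF f g h] by simp
      qed
    next
      assume a: ?assoc
      show ?A
      proof (intro ballI)
        fix w x y z assume v: "w \<in> Vert X" "x \<in> Vert X" "y \<in> Vert X" "z \<in> Vert X"
        note A = Asc_in[OF E[OF v(1,2)] E[OF v(2,3)] E[OF v(3,4)]]
        note B = tensor_in[OF id_in[OF E[OF v(1,2)]] K[OF v(2-4)]]
        show "(Comps X w x y \<odot> Idn V (Edg X y z)) \<cdot> Comps X w y z =
          Asc V (Edg X w x) (Edg X x y) (Edg X y z) \<cdot> (Idn V (Edg X w x) \<odot> Comps X x y z) \<cdot> Comps X w x z"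
        proof (rule arrow_eqI)
          show "(Comps X w x y \<odot> Idn V (Edg X y z)) \<cdot> Comps X w y z \<in>
            (Edg X w x \<otimes> Edg X x y) \<otimes> Edg X y z \<leadsto> Edg X w z"
            by (rule comp_in[OF tensor_in[OF K[OF v(1-3)] id_in[OF E[OF v(3,4)]]] K[OF v(1,3,4)]])
          show "Asc V (Edg X w x) (Edg X x y) (Edg X y z) \<cdot> (Idn V (Edg X w x) \<odot> Comps X x y z) \<cdot> Comps X w x z
             \<in> (Edg X w x \<otimes> Edg X x y) \<otimes> Edg X y z \<leadsto> Edg X w z"
            by (rule comp_in[OF comp_in[OF A B] K[OF v(1,2,4)]])
          fix t u assume "u \<in> t \<leadsto> (Edg X w x \<otimes> Edg X x y) \<otimes> Edg X y z"
          then obtain q h where q: "q \<in> t \<leadsto> Edg X w x \<otimes> Edg X x y" and h: "h \<in> t \<leadsto> Edg X y z"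
            and u: "u = pair t (Edg X w x \<otimes> Edg X x y) (Edg X y z) q h"
            using pair_cases[OF _ tensor_ob[OF E[OF v(1,2)] E[OF v(2,3)]] E[OF v(3,4)]] by metis
          from q obtain f g where f: "f \<in> t \<leadsto> Edg X w x" and g: "g \<in> t \<leadsto> Edg X x y"
            and q: "q = pair t (Edg X w x) (Edg X x y) f g"
            using pair_cases[OF _ E[OF v(1,2)] E[OF v(2,3)]] by metis
          note m = homI[OF v(1,2) f] homI[OF v(2,3) g] homI[OF v(3,4) h]
          show "u \<cdot> ((Comps X w x y \<odot> Idn V (Edg X y z)) \<cdot> Comps X w y z) =
             u \<cdot> (Asc V (Edg X w x) (Edg X x y) (Edg X y z) \<cdot> (Idn V (Edg X w x) \<odot> Comps X x y z) \<cdot> Comps X w x z)"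
            unfolding u q ev(1)[OF m] ev(2)[OF m] using a m by blast
        qed
      qed
    qed
  qed
  moreover have "?U \<longleftrightarrow> ?unit"
  proof -
    have ev: "pair t \<star> (Edg X x y) b f \<cdot> ((Unt X x \<odot> Idn V (Edg X x y)) \<cdot> Comps X x x y) = comp_el X t x x y (unit_el X t x)
        f"
      "pair t (Edg X x y) \<star> f b \<cdot> ((Idn V (Edg X x y) \<odot> Unt X y) \<cdot> Comps X x y y) = comp_el X t x y y f (unit_el X t y)"
      "pair t \<star> (Edg X x y) b f \<cdot> Lun V (Edg X x y) = f"
      "pair t (Edg X x y) \<star> f b \<cdot> Run V (Edg X x y) = f"
      if f: "f \<in> hom X t x y" and b: "b \<in> t \<leadsto> \<star>" for t x y f b
    proof -
      note v = hom_vert[OF f] and f' = homD[OF f] and i = id_in[OF E[OF hom_vert[OF f]]]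
      have bb: "b = bang t" using to_unit_unique[OF b bang_in[OF hom_ob[OF f]]] .
      show "pair t \<star> (Edg X x y) b f \<cdot> ((Unt X x \<odot> Idn V (Edg X x y)) \<cdot> Comps X x x y) = comp_el X t x x y (unit_el X t x)
          f"
        unfolding comp_el_def unit_el_def bb[symmetric]
        by (simp only: assoc[OF pair_in[OF b f'] tensor_in[OF Unt_in[OF G v(1)] i] K[OF v(1,1,2)], symmetric]
           pair_tensor[OF b f' Unt_in[OF G v(1)] i] id_right[OF f'])
      show "pair t (Edg X x y) \<star> f b \<cdot> ((Idn V (Edg X x y) \<odot> Unt X y) \<cdot> Comps X x y y) = comp_el X t x y y f (unit_el X t
          y)"
        unfolding comp_el_def unit_el_def bb[symmetric]
        by (simp only: assoc[OF pair_in[OF f' b] tensor_in[OF i Unt_in[OF G v(2)]] K[OF v(1,2,2)], symmetric]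
           pair_tensor[OF f' b i Unt_in[OF G v(2)]] id_right[OF f'])
      show "pair t \<star> (Edg X x y) b f \<cdot> Lun V (Edg X x y) = f" "pair t (Edg X x y) \<star> f b \<cdot> Run V (Edg X x y) = f"
        by (rule pair_Lun[OF f' b], rule pair_Run[OF f' b])
    qed
    show ?thesis
    proof
      assume a: ?U
      show ?unit
      proof (intro allI impI)
        fix t x y f assume f: "f \<in> hom X t x y"
        show "comp_el X t x x y (unit_el X t x) f = f \<and> comp_el X t x y y f (unit_el X t y) = f"
          using a hom_vert[OF f] ev[OF f bang_in[OF hom_ob[OF f]]] by simp
      qed
    next
      assume a: ?unit
      show ?U
      proof (intro ballI conjI)
        fix x y assume v: "x \<in> Vert X" "y \<in> Vert X"
        note i = id_in[OF E[OF v]]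
        show "(Unt X x \<odot> Idn V (Edg X x y)) \<cdot> Comps X x x y = Lun V (Edg X x y)"
        proof (rule arrow_eqI[OF comp_in[OF tensor_in[OF Unt_in[OF G v(1)] i] K[OF v(1,1,2)]] Lun_in[OF E[OF v]]])
          fix t u assume "u \<in> t \<leadsto> \<star> \<otimes> Edg X x y"
          then obtain b f where b: "b \<in> t \<leadsto> \<star>" and f: "f \<in> t \<leadsto> Edg X x y" and u: "u = pair t \<star> (Edg X x y) b f"
            using pair_cases[OF _ unit_ob E[OF v]] by metis
          show "u \<cdot> ((Unt X x \<odot> Idn V (Edg X x y)) \<cdot> Comps X x x y) = u \<cdot> Lun V (Edg X x y)"
            unfolding u ev[OF homI[OF v f] b] using a homI[OF v f] by blast
        qed
        show "(Idn V (Edg X x y) \<odot> Unt X y) \<cdot> Comps X x y y = Run V (Edg X x y)"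
        proof (rule arrow_eqI[OF comp_in[OF tensor_in[OF i Unt_in[OF G v(2)]] K[OF v(1,2,2)]] Run_in[OF E[OF v]]])
          fix t u assume "u \<in> t \<leadsto> Edg X x y \<otimes> \<star>"
          then obtain b f where b: "b \<in> t \<leadsto> \<star>" and f: "f \<in> t \<leadsto> Edg X x y" and u: "u = pair t (Edg X x y) \<star> f b"
            using pair_cases[OF _ E[OF v] unit_ob] by metis
          show "u \<cdot> ((Idn V (Edg X x y) \<odot> Unt X y) \<cdot> Comps X x y y) = u \<cdot> Run V (Edg X x y)"
            unfolding u ev[OF homI[OF v f] b] using a homI[OF v f] by blast
        qed
      qed
    qed
  qed
  ultimately show ?thesis using C by blast
next
  case False
  moreover have "composable X" if "enriched V X"
    unfolding composable_def
  proof (intro conjI ballI)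
    show G: "original_graph V X" using that unfolding enriched_def by blast
    fix x y z assume v: "x \<in> Vert X" "y \<in> Vert X" "z \<in> Vert X"
    show "Comps X x y z \<in> Edg X x y \<otimes> Edg X y z \<leadsto> Edg X x z"
      using that v unfolding enriched_def
      by (simp add: arrows_iff tensor_ob Edg_ob[OF G])
  qed
  ultimately show ?thesis by blast
qed

lemma enriched_composable: "enriched V X \<Longrightarrow> composable X"
  and enriched_graph: "enriched V X \<Longrightarrow> original_graph V X"
  and comp_el_assoc: "enriched V X \<Longrightarrow> f \<in> hom X t w x \<Longrightarrow> g \<in> hom X t x y \<Longrightarrow> h \<in> hom X t y z \<Longrightarrow>
        comp_el X t w y z (comp_el X t w x y f g) h = comp_el X t w x z f (comp_el X t x y z g h)"
  and comp_el_unit_el_left: "enriched V X \<Longrightarrow> f \<in> hom X t x y \<Longrightarrow> comp_el X t x x y (unit_el X t x) f = f"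
  and comp_el_unit_el_right: "enriched V X \<Longrightarrow> f \<in> hom X t x y \<Longrightarrow> comp_el X t x y y f (unit_el X t y) = f"
proof -
  show "enriched V X \<Longrightarrow> composable X" using enriched_iff by blast
  then show "enriched V X \<Longrightarrow> original_graph V X" by (simp add: composable_def)
next
  assume "enriched V X"
  note a = this[unfolded enriched_iff, THEN conjunct2]
  show "f \<in> hom X t w x \<Longrightarrow> g \<in> hom X t x y \<Longrightarrow> h \<in> hom X t y z \<Longrightarrow>
        comp_el X t w y z (comp_el X t w x y f g) h = comp_el X t w x z f (comp_el X t x y z g h)"
    using a[THEN conjunct1] by blast
  show "f \<in> hom X t x y \<Longrightarrow> comp_el X t x x y (unit_el X t x) f = f"
    "f \<in> hom X t x y \<Longrightarrow> comp_el X t x y y f (unit_el X t y) = f"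
    using a[THEN conjunct2] by blast+
qed

end

section \<open>Transports and natural functors on generalized elements\<close>

lemma on_vert_mk: "x \<in> A \<Longrightarrow> on_vert (mk_transport A f0 f1) x = f0 x"
  and on_edge_mk: "x \<in> A \<Longrightarrow> y \<in> A \<Longrightarrow> on_edge (mk_transport A f0 f1) x y = f1 x y"
  by (simp_all add: mk_transport_def)

lemma mk_transport_idem:
  "mk_transport A (on_vert (mk_transport A f0 f1)) (on_edge (mk_transport A f0 f1)) = mk_transport A f0 f1"
  by (auto simp: mk_transport_def fun_eq_iff)

lemma mk_transport_cong:
  assumes "\<And>x. x \<in> A \<Longrightarrow> f0 x = g0 x" "\<And>x y. x \<in> A \<Longrightarrow> y \<in> A \<Longrightarrow> f1 x y = g1 x y"
  shows "mk_transport A f0 f1 = mk_transport A g0 g1"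
  using assms by (auto simp: mk_transport_def fun_eq_iff)

lemma followed_by_vert: "x \<in> Vert X \<Longrightarrow> on_vert (followed_by V X f g) x = on_vert g (on_vert f x)"
  by (simp add: followed_by_def on_vert_mk)

lemma id_transport_vert: "x \<in> Vert X \<Longrightarrow> on_vert (id_transport V X) x = x"
  by (simp add: id_transport_def on_vert_mk)

context relator_category begin

lemma ot_mk: "f \<in> original_transports V X Y \<Longrightarrow> mk_transport (Vert X) (on_vert f) (on_edge f) = f"
  by (simp add: original_transports_def)

lemma ot_vert: "f \<in> original_transports V X Y \<Longrightarrow> x \<in> Vert X \<Longrightarrow> on_vert f x \<in> Vert Y"
  by (simp add: original_transports_def)

lemma ot_edge:
  assumes "original_graph V X" "original_graph V Y" "f \<in> original_transports V X Y" "x \<in> Vert X" "y \<in> Vert X"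
  shows "on_edge f x y \<in> Edg X x y \<leadsto> Edg Y (on_vert f x) (on_vert f y)"
  using assms(3-5) Edg_ob[OF assms(1,4,5)]
    Edg_ob[OF assms(2) ot_vert[OF assms(3,4)] ot_vert[OF assms(3,5)]]
  unfolding original_transports_def by (simp add: arrows_def)

lemma hom_edge:
  assumes "original_graph V Y" "f \<in> original_transports V X Y" "a \<in> hom X z x y"
  shows "on_edge f x y \<in> Edg X x y \<leadsto> Edg Y (on_vert f x) (on_vert f y)"
proof -
  note v = hom_vert[OF assms(3)]
  show ?thesis
  using assms(2) v arrows_ob[OF homD[OF assms(3)]]
    Edg_ob[OF assms(1) ot_vert[OF assms(2) v(1)] ot_vert[OF assms(2) v(2)]]
  unfolding original_transports_def by (simp add: arrows_def)
qed

lemma ot_act: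
  assumes "original_graph V Y" "f \<in> original_transports V X Y" "a \<in> hom X z x y"
  shows "a \<cdot> on_edge f x y \<in> hom Y z (on_vert f x) (on_vert f y)"
  using homI[OF ot_vert[OF assms(2)] ot_vert[OF assms(2)] comp_in[OF homD[OF assms(3)] hom_edge[OF assms]]]
    hom_vert[OF assms(3)] by blast

lemma ot_unit_el:
  assumes X: "original_graph V X" and Y: "original_graph V Y" and f: "f \<in> original_transports V X Y"
    and x: "x \<in> Vert X" and z: "z \<in> Ob V"
  shows "unit_el X z x \<cdot> on_edge f x x = unit_el Y z (on_vert f x)"
  unfolding unit_el_def assoc[OF bang_in[OF z] Unt_in[OF X x] ot_edge[OF X Y f x x]]
  using f x by (simp add: original_transports_def)

text \<open>
  Units are tested at every stage, which by naturality is the same as testing them at \<open>\<star>\<close>.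
\<close>

lemma otI:
  assumes X: "original_graph V X" and Y: "original_graph V Y"
    and v: "\<And>x. x \<in> Vert X \<Longrightarrow> f0 x \<in> Vert Y"
    and e: "\<And>x y. x \<in> Vert X \<Longrightarrow> y \<in> Vert X \<Longrightarrow> f1 x y \<in> Edg X x y \<leadsto> Edg Y (f0 x) (f0 y)"
    and u: "\<And>x z. x \<in> Vert X \<Longrightarrow> z \<in> Ob V \<Longrightarrow> unit_el X z x \<cdot> f1 x x = unit_el Y z (f0 x)"
  shows "mk_transport (Vert X) f0 f1 \<in> original_transports V X Y"
proof -
  have "Unt X x \<cdot> f1 x x = Unt Y (f0 x)" if x: "x \<in> Vert X" for x
    using u[OF x unit_ob] unit_el_unit[OF X x] unit_el_unit[OF Y v[OF x]] by simp
  moreover have "f1 x y \<in> Hom V (Edg X x y) (Edg Y (f0 x) (f0 y))" if "x \<in> Vert X" "y \<in> Vert X" for x y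
    using e[OF that] by (simp add: arrows_def)
  ultimately show ?thesis
    unfolding original_transports_def using v by (simp add: mk_transport_idem on_vert_mk on_edge_mk)
qed

text \<open>
  Transports are extensional records, so equality on vertices and on elements of edges is equality.
\<close>

lemma ot_eqI:
  assumes X: "original_graph V X" and Y: "original_graph V Y"
    and f: "f \<in> original_transports V X Y" and g: "g \<in> original_transports V X Y"
    and v: "\<And>x. x \<in> Vert X \<Longrightarrow> on_vert f x = on_vert g x"
    and e: "\<And>z x y a. a \<in> hom X z x y \<Longrightarrow> a \<cdot> on_edge f x y = a \<cdot> on_edge g x y"
  shows "f = g"
proof -
  have "on_edge f x y = on_edge g x y" if x: "x \<in> Vert X" and y: "y \<in> Vert X" for x y
  proof (rule arrow_eqI)
    show "on_edge f x y \<in> Edg X x y \<leadsto> Edg Y (on_vert g x) (on_vert g y)"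
      using ot_edge[OF X Y f x y] v[OF x] v[OF y] by simp
    show "on_edge g x y \<in> Edg X x y \<leadsto> Edg Y (on_vert g x) (on_vert g y)"
      by (rule ot_edge[OF X Y g x y])
    show "a \<cdot> on_edge f x y = a \<cdot> on_edge g x y" if "a \<in> z \<leadsto> Edg X x y" for z a
      by (rule e[OF homI[OF x y that]])
  qed
  with v have "mk_transport (Vert X) (on_vert f) (on_edge f) = mk_transport (Vert X) (on_vert g) (on_edge g)"
    by (intro mk_transport_cong)
  then show ?thesis using ot_mk[OF f] ot_mk[OF g] by simp
qed

lemma id_act: "a \<in> hom X z x y \<Longrightarrow> a \<cdot> on_edge (id_transport V X) x y = a"
  using hom_vert[of a X z x y] id_right[OF homD[of a X z x y]] by (simp add: id_transport_def on_edge_mk)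

lemma id_ot:
  assumes X: "original_graph V X"
  shows "id_transport V X \<in> original_transports V X X"
  unfolding id_transport_def
  by (rule otI[OF X X _ id_in[OF Edg_ob[OF X]] id_right[OF homD[OF unit_el_in[OF X]]]])

lemma followed_by_act:
  assumes "original_graph V Y" "original_graph V W"
    "f \<in> original_transports V X Y" "g \<in> original_transports V Y W" "a \<in> hom X z x y"
  shows "a \<cdot> on_edge (followed_by V X f g) x y = a \<cdot> on_edge f x y \<cdot> on_edge g (on_vert f x) (on_vert f y)"
  using hom_vert[OF assms(5)] 
    assoc[OF homD[OF assms(5)] hom_edge[OF assms(1,3,5)] hom_edge[OF assms(2,4) ot_act[OF assms(1,3,5)]]]
  by (simp add: followed_by_def on_edge_mk)

lemma followed_by_ot:
  assumes X: "original_graph V X" and Y: "original_graph V Y" and W: "original_graph V W"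
    and f: "f \<in> original_transports V X Y" and g: "g \<in> original_transports V Y W"
  shows "followed_by V X f g \<in> original_transports V X W"
  unfolding followed_by_def
proof (rule otI[OF X W])
  show "on_vert g (on_vert f x) \<in> Vert W" if "x \<in> Vert X" for x
    using ot_vert[OF g ot_vert[OF f that]] .
  show "on_edge f x y \<cdot> on_edge g (on_vert f x) (on_vert f y) \<in> Edg X x y \<leadsto> Edg W (on_vert g (on_vert f x)) (on_vert g
      (on_vert f y))"
    if x: "x \<in> Vert X" and y: "y \<in> Vert X" for x y
    by (rule comp_in[OF ot_edge[OF X Y f x y] ot_edge[OF Y W g ot_vert[OF f x] ot_vert[OF f y]]])
  show "unit_el X z x \<cdot> (on_edge f x x \<cdot> on_edge g (on_vert f x) (on_vert f x)) = unit_el W z (on_vert g (on_vert f x))"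
    if x: "x \<in> Vert X" and z: "z \<in> Ob V" for x z
    by (simp only: assoc[OF homD[OF unit_el_in[OF X x z]] ot_edge[OF X Y f x x] ot_edge[OF Y W g ot_vert[OF f x] ot_vert[OF
        f x]], symmetric]
       ot_unit_el[OF X Y f x z] ot_unit_el[OF Y W g ot_vert[OF f x] z])
qed

lemma followed_by_id_right:
  assumes X: "original_graph V X" and Y: "original_graph V Y" and f: "f \<in> original_transports V X Y"
  shows "followed_by V X f (id_transport V Y) = f"
proof (rule ot_eqI[OF X Y followed_by_ot[OF X Y Y f id_ot[OF Y]] f])
  show "on_vert (followed_by V X f (id_transport V Y)) x = on_vert f x" if "x \<in> Vert X" for x
    using that ot_vert[OF f that] by (simp add: followed_by_vert id_transport_vert)
  show "a \<cdot> on_edge (followed_by V X f (id_transport V Y)) x y = a \<cdot> on_edge f x y" if a: "a \<in> hom X z x y" for z x y a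
    by (simp only: followed_by_act[OF Y Y f id_ot[OF Y] a] id_act[OF ot_act[OF Y f a]])
qed

lemma followed_by_id_left:
  assumes X: "original_graph V X" and Y: "original_graph V Y" and f: "f \<in> original_transports V X Y"
  shows "followed_by V X (id_transport V X) f = f"
proof (rule ot_eqI[OF X Y followed_by_ot[OF X X Y id_ot[OF X] f] f])
  show "on_vert (followed_by V X (id_transport V X) f) x = on_vert f x" if "x \<in> Vert X" for x
    using that by (simp add: followed_by_vert id_transport_vert)
  show "a \<cdot> on_edge (followed_by V X (id_transport V X) f) x y = a \<cdot> on_edge f x y" if a: "a \<in> hom X z x y" for z x y a
    using hom_vert[OF a]
    by (simp only: followed_by_act[OF X Y id_ot[OF X] f a] id_act[OF a] id_transport_vert)
qed

lemma followed_by_assoc: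
  assumes X: "original_graph V X" and Y: "original_graph V Y" and Z: "original_graph V Z" and W: "original_graph V W"
    and f: "f \<in> original_transports V X Y" and g: "g \<in> original_transports V Y Z" and h: "h \<in> original_transports V Z W"
  shows "followed_by V X (followed_by V X f g) h = followed_by V X f (followed_by V Y g h)"
proof (rule ot_eqI[OF X W followed_by_ot[OF X Z W followed_by_ot[OF X Y Z f g] h] followed_by_ot[OF X Y W f
    followed_by_ot[OF Y Z W g h]]])
  show "on_vert (followed_by V X (followed_by V X f g) h) x = on_vert (followed_by V X f (followed_by V Y g h)) x" if "x \<in>
      Vert X" for x
    using that ot_vert[OF f that] by (simp add: followed_by_vert)
  show "a \<cdot> on_edge (followed_by V X (followed_by V X f g) h) x y = a \<cdot> on_edge (followed_by V X f (followed_by V Y g h)) x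
      y" if a: "a \<in> hom X z x y" for z x y a
    by (simp only: followed_by_act[OF Z W followed_by_ot[OF X Y Z f g] h a] followed_by_act[OF Y Z f g a]
      followed_by_act[OF Y W f followed_by_ot[OF Y Z W g h] a] followed_by_act[OF Z W g h ot_act[OF Y f a]]
      followed_by_vert[OF hom_vert(1)[OF a]] followed_by_vert[OF hom_vert(2)[OF a]])
qed

lemma nf_ot: "f \<in> natural_functors V X Y \<Longrightarrow> f \<in> original_transports V X Y"
  by (simp add: natural_functors_def)

lemma nf_comp_el:
  assumes X: "composable X" and Y: "composable Y" and f: "f \<in> natural_functors V X Y"
    and a: "a \<in> hom X z x y" and b: "b \<in> hom X z y w"
  shows "comp_el X z x y w a b \<cdot> on_edge f x w =
    comp_el Y z (on_vert f x) (on_vert f y) (on_vert f w) (a \<cdot> on_edge f x y) (b \<cdot> on_edge f y w)"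
proof -
  note v = hom_vert(1)[OF a] hom_vert[OF b]
  note GX = composable_graph[OF X] and GY = composable_graph[OF Y] and fo = nf_ot[OF f]
  note fv = ot_vert[OF fo v(1)] ot_vert[OF fo v(2)] ot_vert[OF fo v(3)]
  note ab = pair_in[OF homD[OF a] homD[OF b]]
  note e = ot_edge[OF GX GY fo]
  have "Comps X x y w \<cdot> on_edge f x w =
      (on_edge f x y \<odot> on_edge f y w) \<cdot> Comps Y (on_vert f x) (on_vert f y) (on_vert f w)"
    using f v unfolding natural_functors_def by blast
  then show ?thesis unfolding comp_el_def
    by (simp only: assoc[OF ab Comps_in[OF X v] e[OF v(1,3)]]
        assoc[OF ab tensor_in[OF e[OF v(1,2)] e[OF v(2,3)]] Comps_in[OF Y fv], symmetric]
        pair_tensor[OF homD[OF a] homD[OF b] e[OF v(1,2)] e[OF v(2,3)]])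
qed

lemma nfI:
  assumes X: "composable X" and Y: "composable Y" and f: "f \<in> original_transports V X Y"
    and *: "\<And>z x y w a b. a \<in> hom X z x y \<Longrightarrow> b \<in> hom X z y w \<Longrightarrow>
      comp_el X z x y w a b \<cdot> on_edge f x w =
      comp_el Y z (on_vert f x) (on_vert f y) (on_vert f w) (a \<cdot> on_edge f x y) (b \<cdot> on_edge f y w)"
  shows "f \<in> natural_functors V X Y"
proof -
  note GX = composable_graph[OF X] and GY = composable_graph[OF Y]
  note e = ot_edge[OF GX GY f]
  have "Comps X x y w \<cdot> on_edge f x w =
      (on_edge f x y \<odot> on_edge f y w) \<cdot> Comps Y (on_vert f x) (on_vert f y) (on_vert f w)"
    if v: "x \<in> Vert X" "y \<in> Vert X" "w \<in> Vert X" for x y w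
  proof -
    note fv = ot_vert[OF f v(1)] ot_vert[OF f v(2)] ot_vert[OF f v(3)]
    note E = Edg_ob[OF GX v(1,2)] Edg_ob[OF GX v(2,3)]
    note ee = tensor_in[OF e[OF v(1,2)] e[OF v(2,3)]]
    show ?thesis
    proof (rule arrow_eqI[OF comp_in[OF Comps_in[OF X v] e[OF v(1,3)]] comp_in[OF ee Comps_in[OF Y fv]]])
      fix z u assume u: "u \<in> z \<leadsto> Edg X x y \<otimes> Edg X y w"
      obtain a b where ab: "a \<in> z \<leadsto> Edg X x y" "b \<in> z \<leadsto> Edg X y w" and u': "u = pair z (Edg X x y) (Edg X y w) a b"
        using pair_cases[OF u E] by metis
      show "u \<cdot> (Comps X x y w \<cdot> on_edge f x w) =
        u \<cdot> ((on_edge f x y \<odot> on_edge f y w) \<cdot> Comps Y (on_vert f x) (on_vert f y) (on_vert f w))"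
        using *[OF homI[OF v(1,2) ab(1)] homI[OF v(2,3) ab(2)], unfolded comp_el_def]
        by (simp only: u' assoc[OF pair_in[OF ab] Comps_in[OF X v] e[OF v(1,3)], symmetric]
          assoc[OF pair_in[OF ab] ee Comps_in[OF Y fv], symmetric] pair_tensor[OF ab e[OF v(1,2)] e[OF v(2,3)]])
    qed
  qed
  with f show ?thesis unfolding natural_functors_def by blast
qed

lemma id_nf: "composable X \<Longrightarrow> id_transport V X \<in> natural_functors V X X"
proof (rule nfI[OF _ _ id_ot[OF composable_graph]])
  fix z x y w a b assume X: "composable X" and a: "a \<in> hom X z x y" and b: "b \<in> hom X z y w"
  show "comp_el X z x y w a b \<cdot> on_edge (id_transport V X) x w = comp_el X z (on_vert (id_transport V X) x)
      (on_vert (id_transport V X) y) (on_vert (id_transport V X) w)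
      (a \<cdot> on_edge (id_transport V X) x y) (b \<cdot> on_edge (id_transport V X) y w)"
    by (simp only: id_act[OF a] id_act[OF b] id_act[OF comp_el_in[OF X a b]]
        id_transport_vert[OF hom_vert(1)[OF a]] id_transport_vert[OF hom_vert(1)[OF b]] id_transport_vert[OF hom_vert(2)[OF
            b]])
qed

lemma followed_by_nf:
  assumes X: "composable X" and Y: "composable Y" and W: "composable W"
    and f: "f \<in> natural_functors V X Y" and g: "g \<in> natural_functors V Y W"
  shows "followed_by V X f g \<in> natural_functors V X W"
proof (rule nfI[OF X W])
  note GX = composable_graph[OF X] and GY = composable_graph[OF Y] and GW = composable_graph[OF W]
    and fo = nf_ot[OF f] and go = nf_ot[OF g]
  show "followed_by V X f g \<in> original_transports V X W" by (rule followed_by_ot[OF GX GY GW fo go])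
  fix z x y w a b assume a: "a \<in> hom X z x y" and b: "b \<in> hom X z y w"
  note act = followed_by_act[OF GY GW fo go]
  show "comp_el X z x y w a b \<cdot> on_edge (followed_by V X f g) x w =
    comp_el W z (on_vert (followed_by V X f g) x) (on_vert (followed_by V X f g) y) (on_vert (followed_by V X f g) w)
      (a \<cdot> on_edge (followed_by V X f g) x y) (b \<cdot> on_edge (followed_by V X f g) y w)"
    by (simp only: act[OF a] act[OF b] act[OF comp_el_in[OF X a b]] nf_comp_el[OF X Y f a b]
      nf_comp_el[OF Y W g ot_act[OF GY fo a] ot_act[OF GY fo b]]
      followed_by_vert[OF hom_vert(1)[OF a]] followed_by_vert[OF hom_vert(1)[OF b]] followed_by_vert[OF hom_vert(2)[OF b]])
qed

section \<open>The tensor product of enriched categories\<close>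

lemma ten_graph_simps:
  "Vert (ten_graph V X T) = Vert X \<times> Vert T"
  "Edg (ten_graph V X T) (x, s) (y, t) = Edg X x y \<otimes> Edg T s t"
  "Unt (ten_graph V X T) (x, s) = lun_inv V \<star> \<cdot> (Unt X x \<odot> Unt T s)"
  by (simp_all add: ten_graph_def)

lemma hom_ten_cat: "hom (ten_cat V X T) = hom (ten_graph V X T)"
  by (simp add: hom_def ten_cat_def fun_eq_iff)

lemma unit_el_ten_cat: "unit_el (ten_cat V X T) = unit_el (ten_graph V X T)"
  by (simp add: unit_el_def ten_cat_def fun_eq_iff)

lemma Vert_ten_cat: "Vert (ten_cat V X T) = Vert X \<times> Vert T"
  by (simp add: ten_cat_def ten_graph_def)

lemma ot_ten_cat_source: "original_transports V (ten_cat V X T) = original_transports V (ten_graph V X T)"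
  by (simp add: original_transports_def ten_cat_def fun_eq_iff)

lemma ot_ten_cat_target: "original_transports V Y (ten_cat V X T) = original_transports V Y (ten_graph V X T)"
  by (simp add: original_transports_def ten_cat_def)

lemma original_ten_cat: "original_graph V (ten_cat V X T) = original_graph V (ten_graph V X T)"
  by (simp add: original_graph_def ten_cat_def)

context
  fixes X :: "('x, 'o, 'm, 'd) ovgraph_scheme" and T :: "('t, 'o, 'm, 'e) ovgraph_scheme"
  assumes X: "original_graph V X" and T: "original_graph V T"
begin

lemma ten_pair_in:
  assumes "a \<in> hom X z x y" "\<tau> \<in> hom T z s t"
  shows "pair z (Edg X x y) (Edg T s t) a \<tau> \<in> hom (ten_graph V X T) z (x, s) (y, t)"
  using assms unfolding hom_def by (auto simp: ten_graph_simps intro: pair_in)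

lemma ten_cases:
  assumes "e \<in> hom (ten_graph V X T) z p q"
  obtains x s y t a \<tau> where "p = (x, s)" "q = (y, t)" "a \<in> hom X z x y" "\<tau> \<in> hom T z s t"
    "e = pair z (Edg X x y) (Edg T s t) a \<tau>"
proof -
  obtain x s y t where p: "p = (x, s)" "q = (y, t)" "x \<in> Vert X" "s \<in> Vert T" "y \<in> Vert X" "t \<in> Vert T"
    using hom_vert[OF assms] by (cases p; cases q) (auto simp: ten_graph_simps)
  have "e \<in> z \<leadsto> Edg X x y \<otimes> Edg T s t"
    using homD[OF assms] p by (simp add: ten_graph_simps)
  then obtain a \<tau> where "a \<in> z \<leadsto> Edg X x y" "\<tau> \<in> z \<leadsto> Edg T s t" "e = pair z (Edg X x y) (Edg T s t) a \<tau>"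
    using pair_cases[OF _ Edg_ob[OF X p(3,5)] Edg_ob[OF T p(4,6)]] by metis
  then show ?thesis using that p homI by metis
qed

lemma ten_unit_el:
  assumes x: "x \<in> Vert X" and s: "s \<in> Vert T" and z: "z \<in> Ob V"
  shows "unit_el (ten_graph V X T) z (x, s) = pair z (Edg X x x) (Edg T s s) (unit_el X z x) (unit_el T z s)"
proof -
  note b = bang_in[OF z] and u = tensor_in[OF Unt_in[OF X x] Unt_in[OF T s]]
  show ?thesis unfolding unit_el_def ten_graph_simps
    by (simp only: assoc[OF b lun_inv_in[OF unit_ob] u, symmetric] comp_lun_inv[OF b]
        pair_tensor[OF b b Unt_in[OF X x] Unt_in[OF T s]])
qed

lemma original_ten: "original_graph V (ten_graph V X T)"
proof -
  have "Unt (ten_graph V X T) (x, s) \<in> \<star> \<leadsto> Edg X x x \<otimes> Edg T s s" if "x \<in> Vert X" "s \<in> Vert T" for x s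
    unfolding ten_graph_simps
    by (rule comp_in[OF lun_inv_in[OF unit_ob] tensor_in[OF Unt_in[OF X that(1)] Unt_in[OF T that(2)]]])
  then show ?thesis
    unfolding original_graph_def
    using Edg_ob[OF X] Edg_ob[OF T] by (auto simp: ten_graph_simps(1,2) tensor_ob arrows_def)
qed

end

lemma ten_transport_act:
  assumes X: "original_graph V X'" and T: "original_graph V T'"
    and f: "f \<in> original_transports V X X'" and k: "k \<in> original_transports V T T'"
    and a: "a \<in> hom X z x y" and \<tau>: "\<tau> \<in> hom T z s t"
  shows "pair z (Edg X x y) (Edg T s t) a \<tau> \<cdot> on_edge (ten_transport V X T f k) (x, s) (y, t) =
     pair z (Edg X' (on_vert f x) (on_vert f y)) (Edg T' (on_vert k s) (on_vert k t))
       (a \<cdot> on_edge f x y) (\<tau> \<cdot> on_edge k s t)"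
  using pair_tensor[OF homD[OF a] homD[OF \<tau>] hom_edge[OF X f a] hom_edge[OF T k \<tau>]]
    hom_vert[OF a] hom_vert[OF \<tau>]
  by (simp add: ten_transport_def on_edge_mk)

lemma ten_transport_vert: "x \<in> Vert X \<Longrightarrow> s \<in> Vert T \<Longrightarrow>
    on_vert (ten_transport V X T f k) (x, s) = (on_vert f x, on_vert k s)"
  by (simp add: ten_transport_def on_vert_mk)

lemma ten_transport_ot:
  assumes X: "original_graph V X" and T: "original_graph V T" and X': "original_graph V X'" and T': "original_graph V T'"
    and f: "f \<in> original_transports V X X'" and k: "k \<in> original_transports V T T'"
  shows "ten_transport V X T f k \<in> original_transports V (ten_graph V X T) (ten_graph V X' T')"
proof -
  let ?v = "\<lambda>(x, s). (on_vert f x, on_vert k s)" and ?e = "\<lambda>(x, s) (y, t). on_edge f x y \<odot> on_edge k s t"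
  have "mk_transport (Vert (ten_graph V X T)) ?v ?e \<in> original_transports V (ten_graph V X T) (ten_graph V X' T')"
  proof (rule otI[OF original_ten[OF X T] original_ten[OF X' T']])
    show "?v p \<in> Vert (ten_graph V X' T')" if "p \<in> Vert (ten_graph V X T)" for p
      using that ot_vert[OF f] ot_vert[OF k] by (auto simp: ten_graph_simps)
    show "?e p q \<in> Edg (ten_graph V X T) p q \<leadsto> Edg (ten_graph V X' T') (?v p) (?v q)"
      if "p \<in> Vert (ten_graph V X T)" "q \<in> Vert (ten_graph V X T)" for p q
      using that tensor_in[OF ot_edge[OF X X' f] ot_edge[OF T T' k]] by (auto simp: ten_graph_simps)
    show "unit_el (ten_graph V X T) z p \<cdot> ?e p p = unit_el (ten_graph V X' T') z (?v p)"
      if p: "p \<in> Vert (ten_graph V X T)" and z: "z \<in> Ob V" for p z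
    proof -
      obtain x s where xs: "p = (x, s)" "x \<in> Vert X" "s \<in> Vert T" using p by (auto simp: ten_graph_simps)
      show ?thesis unfolding xs(1) case_prod_conv
        by (simp only: ten_unit_el[OF X T xs(2,3) z] ten_unit_el[OF X' T' ot_vert[OF f xs(2)] ot_vert[OF k xs(3)] z]
          pair_tensor[OF homD[OF unit_el_in[OF X xs(2) z]] homD[OF unit_el_in[OF T xs(3) z]]
             ot_edge[OF X X' f xs(2,2)] ot_edge[OF T T' k xs(3,3)]]
          ot_unit_el[OF X X' f xs(2) z] ot_unit_el[OF T T' k xs(3) z])
    qed
  qed
  then show ?thesis by (simp add: ten_transport_def ten_graph_simps)
qed

lemma ten_composable:
  assumes X: "composable X" and T: "composable T"
  shows "composable (ten_cat V X T)"
proof -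
  note GX = composable_graph[OF X] and GT = composable_graph[OF T]
  have "Comps (ten_cat V X T) p q r \<in> Edg (ten_cat V X T) p q \<otimes> Edg (ten_cat V X T) q r \<leadsto> Edg (ten_cat V X T) p r"
    if pqr: "p \<in> Vert (ten_cat V X T)" "q \<in> Vert (ten_cat V X T)" "r \<in> Vert (ten_cat V X T)" for p q r
  proof -
    obtain x s y t w u where v: "p = (x, s)" "q = (y, t)" "r = (w, u)" 
      "x \<in> Vert X" "s \<in> Vert T" "y \<in> Vert X" "t \<in> Vert T" "w \<in> Vert X" "u \<in> Vert T"
      using pqr by (auto simp: Vert_ten_cat)
    show ?thesis unfolding v ten_cat_def
      using comp_in[OF Mid_in[OF Edg_ob[OF GX v(4,6)] Edg_ob[OF GT v(5,7)] Edg_ob[OF GX v(6,8)] Edg_ob[OF GT v(7,9)]]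
        tensor_in[OF Comps_in[OF X v(4,6,8)] Comps_in[OF T v(5,7,9)]]]
      by (simp add: ten_graph_simps)
  qed
  then show ?thesis unfolding composable_def original_ten_cat using original_ten[OF GX GT] by blast
qed

text \<open>
  The interchange brings the two entries of each factor together, so composition in \<open>X \<otimes> T\<close> is
  componentwise.
\<close>

lemma ten_comp_el:
  assumes X: "composable X" and T: "composable T"
    and a: "a \<in> hom X z x y" and b: "b \<in> hom X z y w" and \<tau>: "\<tau> \<in> hom T z s t" and \<sigma>: "\<sigma> \<in> hom T z t u"
  shows "comp_el (ten_cat V X T) z (x, s) (y, t) (w, u)
      (pair z (Edg X x y) (Edg T s t) a \<tau>) (pair z (Edg X y w) (Edg T t u) b \<sigma>) =
    pair z (Edg X x w) (Edg T s u) (comp_el X z x y w a b) (comp_el T z s t u \<tau> \<sigma>)"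
proof -
  note GX = composable_graph[OF X] and GT = composable_graph[OF T]
  note v = hom_vert(1)[OF a] hom_vert[OF b] and r = hom_vert(1)[OF \<tau>] hom_vert[OF \<sigma>]
  note K = Comps_in[OF X v] and L = Comps_in[OF T r]
  note M = Mid_in[OF Edg_ob[OF GX v(1,2)] Edg_ob[OF GT r(1,2)] Edg_ob[OF GX v(2,3)] Edg_ob[OF GT r(2,3)]]
  note a' = homD[OF a] and b' = homD[OF b] and \<tau>' = homD[OF \<tau>] and \<sigma>' = homD[OF \<sigma>]
  have C: "Comps (ten_cat V X T) (x, s) (y, t) (w, u) = 
     Mid V (Edg X x y) (Edg T s t) (Edg X y w) (Edg T t u) \<cdot> (Comps X x y w \<odot> Comps T s t u)"
    and E: "Edg (ten_cat V X T) (x, s) (y, t) = Edg X x y \<otimes> Edg T s t"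
     "Edg (ten_cat V X T) (y, t) (w, u) = Edg X y w \<otimes> Edg T t u"
    by (simp_all add: ten_cat_def ten_graph_simps)
  show ?thesis unfolding comp_el_def C E
    by (simp only: assoc[OF pair_in[OF pair_in[OF a' \<tau>'] pair_in[OF b' \<sigma>']] M tensor_in[OF K L], symmetric]
       pair_Mid[OF a' \<tau>' b' \<sigma>'] pair_tensor[OF pair_in[OF a' b'] pair_in[OF \<tau>' \<sigma>'] K L])
qed

lemma ten_enriched:
  assumes X: "enriched V X" and T: "enriched V T"
  shows "enriched V (ten_cat V X T)"
proof -
  note CX = enriched_composable[OF X] and CT = enriched_composable[OF T]
  note GX = composable_graph[OF CX] and GT = composable_graph[OF CT]
  note cases = ten_cases[OF GX GT]
  show ?thesis unfolding enriched_iff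
  proof (intro conjI allI impI)
    show "composable (ten_cat V X T)" by (rule ten_composable[OF CX CT])
    fix z p q r v f g h
    assume f: "f \<in> hom (ten_cat V X T) z p q" and g: "g \<in> hom (ten_cat V X T) z q r"
      and h: "h \<in> hom (ten_cat V X T) z r v"
    obtain x s y t a \<tau> where 1: "p = (x, s)" "q = (y, t)" and a: "a \<in> hom X z x y" and \<tau>: "\<tau> \<in> hom T z s t"
      and f': "f = pair z (Edg X x y) (Edg T s t) a \<tau>"
      using cases[OF f[unfolded hom_ten_cat]] by metis
    obtain w u b \<sigma> where 2: "r = (w, u)" and b: "b \<in> hom X z y w" and \<sigma>: "\<sigma> \<in> hom T z t u"
      and g': "g = pair z (Edg X y w) (Edg T t u) b \<sigma>"
      using cases[OF g[unfolded hom_ten_cat]] 1 by (metis prod.inject)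
    obtain w' u' c \<rho> where 3: "v = (w', u')" and c: "c \<in> hom X z w w'" and \<rho>: "\<rho> \<in> hom T z u u'"
      and h': "h = pair z (Edg X w w') (Edg T u u') c \<rho>"
      using cases[OF h[unfolded hom_ten_cat]] 2 by (metis prod.inject)
    show "comp_el (ten_cat V X T) z p r v (comp_el (ten_cat V X T) z p q r f g) h =
       comp_el (ten_cat V X T) z p q v f (comp_el (ten_cat V X T) z q r v g h)"
      unfolding 1 2 3 f' g' h'
      by (simp only: ten_comp_el[OF CX CT a b \<tau> \<sigma>] ten_comp_el[OF CX CT b c \<sigma> \<rho>]
         ten_comp_el[OF CX CT comp_el_in[OF CX a b] c comp_el_in[OF CT \<tau> \<sigma>] \<rho>] ten_comp_el[OF CX CT a comp_el_in[OF CX b c]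
             \<tau> comp_el_in[OF CT \<sigma> \<rho>]]
         comp_el_assoc[OF X a b c] comp_el_assoc[OF T \<tau> \<sigma> \<rho>])
  next
    fix z p q f
    assume f: "f \<in> hom (ten_cat V X T) z p q"
    obtain x s y t a \<tau> where 1: "p = (x, s)" "q = (y, t)" and a: "a \<in> hom X z x y" and \<tau>: "\<tau> \<in> hom T z s t"
      and f': "f = pair z (Edg X x y) (Edg T s t) a \<tau>"
      using cases[OF f[unfolded hom_ten_cat]] by metis
    note z = hom_ob[OF a] and v = hom_vert[OF a] and r = hom_vert[OF \<tau>]
    show "comp_el (ten_cat V X T) z p p q (unit_el (ten_cat V X T) z p) f = f"
      unfolding 1 f' unit_el_ten_cat
      by (simp only: ten_unit_el[OF GX GT v(1) r(1) z] ten_comp_el[OF CX CT unit_el_in[OF GX v(1) z] a unit_el_in[OF GT r(1)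
          z] \<tau>]
        comp_el_unit_el_left[OF X a] comp_el_unit_el_left[OF T \<tau>])
    show "comp_el (ten_cat V X T) z p q q f (unit_el (ten_cat V X T) z q) = f"
      unfolding 1 f' unit_el_ten_cat
      by (simp only: ten_unit_el[OF GX GT v(2) r(2) z] ten_comp_el[OF CX CT a unit_el_in[OF GX v(2) z] \<tau> unit_el_in[OF GT
          r(2) z]]
        comp_el_unit_el_right[OF X a] comp_el_unit_el_right[OF T \<tau>])
  qed
qed

end

locale power_base = relator_category V U for V :: "('o, 'm) relcat" (structure) and U :: "'s itself" +
  fixes T :: "('s, 'o, 'm) vcat"
  assumes T: "enriched V T"
begin

lemma T_comp: "composable T" by (rule enriched_composable[OF T])
lemma T_graph: "original_graph V T" by (rule enriched_graph[OF T])

section \<open>The space of transports\<close>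

text \<open>
  The entry at \<open>s\<close> of an element \<open>e\<close> of the full product of the edges \<open>Y(\<phi>(s);\<psi>(s))\<close>.
\<close>

definition pow_component :: "('y, 'o, 'm, 'e) ovgraph_scheme \<Rightarrow> ('s, 'y, 'm) transport \<Rightarrow> ('s, 'y, 'm) transport \<Rightarrow> 'm \<Rightarrow> 's \<Rightarrow>
    'm" where
  "pow_component Y \<phi> \<psi> e s = e \<cdot> proj V (Vert T) (comp_family Y \<phi> \<psi>) s"

lemma pow_graph_simps:
  "Vert (pow_graph V T Y) = original_transports V T Y"
  "Edg (pow_graph V T Y) \<phi> \<psi> = prod_ob V (Vert T) (comp_family Y \<phi> \<psi>)"
  "Unt (pow_graph V T Y) \<phi> = tuple V (Vert T) (comp_family Y \<phi> \<phi>) \<star> (\<lambda>s. Unt Y (on_vert \<phi> s))"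
  by (simp_all add: pow_graph_def)

lemma hom_pow_cat: "hom (pow_cat V T Y) = hom (pow_graph V T Y)"
  by (simp add: hom_def pow_cat_def fun_eq_iff)

lemma ot_pow_cat_source: "original_transports V (pow_cat V T X) = original_transports V (pow_graph V T X)"
  by (simp add: original_transports_def pow_cat_def fun_eq_iff)

lemma ot_pow_cat_target: "original_transports V X (pow_cat V T Y) = original_transports V X (pow_graph V T Y)"
  by (simp add: original_transports_def pow_cat_def)

lemma original_pow_cat: "original_graph V (pow_cat V T Y) = original_graph V (pow_graph V T Y)"
  by (simp add: original_graph_def pow_cat_def)

lemma comp_family_ob:
  assumes "original_graph V Y" "\<phi> \<in> original_transports V T Y" "\<psi> \<in> original_transports V T Y" "s \<in> Vert T"
  shows "Edg Y (on_vert \<phi> s) (on_vert \<psi> s) \<in> Ob V"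
  by (rule Edg_ob[OF assms(1) ot_vert[OF assms(2,4)] ot_vert[OF assms(3,4)]])

lemma pow_proj:
  assumes Y: "original_graph V Y" and \<phi>: "\<phi> \<in> original_transports V T Y" and \<psi>: "\<psi> \<in> original_transports V T Y"
    and s: "s \<in> Vert T"
  shows "proj V (Vert T) (comp_family Y \<phi> \<psi>) s \<in> Edg (pow_graph V T Y) \<phi> \<psi> \<leadsto> Edg Y (on_vert \<phi> s) (on_vert \<psi> s)"
  unfolding pow_graph_simps
  using proj_in[where p = "comp_family Y \<phi> \<psi>", OF small_index_small comp_family_ob[OF Y \<phi> \<psi>] s] by simp

lemma hom_pow_vert: "e \<in> hom (pow_graph V T Y) z \<phi> \<psi> \<Longrightarrow> \<phi> \<in> original_transports V T Y"
  "e \<in> hom (pow_graph V T Y) z \<phi> \<psi> \<Longrightarrow> \<psi> \<in> original_transports V T Y"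
  by (auto dest: hom_vert simp: pow_graph_simps)

lemma hom_pow_proj:
  assumes Y: "original_graph V Y" and e: "e \<in> hom (pow_graph V T Y) z \<phi> \<psi>" and s: "s \<in> Vert T"
  shows "proj V (Vert T) (comp_family Y \<phi> \<psi>) s \<in> Edg (pow_graph V T Y) \<phi> \<psi> \<leadsto> Edg Y (on_vert \<phi> s) (on_vert \<psi> s)"
  by (rule pow_proj[OF Y hom_pow_vert[OF e] s])

lemma pow_component_in:
  assumes Y: "original_graph V Y" and e: "e \<in> hom (pow_graph V T Y) z \<phi> \<psi>" and s: "s \<in> Vert T"
  shows "pow_component Y \<phi> \<psi> e s \<in> hom Y z (on_vert \<phi> s) (on_vert \<psi> s)"
  unfolding pow_component_def
  by (rule homI[OF ot_vert[OF hom_pow_vert(1)[OF e] s] ot_vert[OF hom_pow_vert(2)[OF e] s]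
       comp_in[OF homD[OF e] hom_pow_proj[OF Y e s]]])

lemma comp_pow_component:
  assumes Y: "original_graph V Y" and e: "e \<in> hom (pow_graph V T Y) z \<phi> \<psi>" and s: "s \<in> Vert T"
    and h: "h \<in> w \<leadsto> z"
  shows "pow_component Y \<phi> \<psi> (h \<cdot> e) s = h \<cdot> pow_component Y \<phi> \<psi> e s"
  unfolding pow_component_def by (rule assoc[OF h homD[OF e] hom_pow_proj[OF Y e s]])

lemma pow_component_eqI:
  assumes Y: "original_graph V Y"
    and e: "e \<in> hom (pow_graph V T Y) z \<phi> \<psi>" and e': "e' \<in> hom (pow_graph V T Y) z \<phi> \<psi>"
    and eq: "\<And>s. s \<in> Vert T \<Longrightarrow> pow_component Y \<phi> \<psi> e s = pow_component Y \<phi> \<psi> e' s"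
  shows "e = e'"
  using prod_eqI[where p = "comp_family Y \<phi> \<psi>", OF small_index_small comp_family_ob[OF Y hom_pow_vert[OF e]]
      homD[OF e, unfolded pow_graph_simps] homD[OF e', unfolded pow_graph_simps]] eq
  unfolding pow_component_def by blast

lemma tuple_pow:
  assumes Y: "original_graph V Y" and \<phi>: "\<phi> \<in> original_transports V T Y" and \<psi>: "\<psi> \<in> original_transports V T Y"
    and z: "z \<in> Ob V" and k: "\<And>s. s \<in> Vert T \<Longrightarrow> k s \<in> hom Y z (on_vert \<phi> s) (on_vert \<psi> s)"
  shows "tuple V (Vert T) (comp_family Y \<phi> \<psi>) z k \<in> hom (pow_graph V T Y) z \<phi> \<psi>"
    and "s \<in> Vert T \<Longrightarrow> pow_component Y \<phi> \<psi> (tuple V (Vert T) (comp_family Y \<phi> \<psi>) z k) s = k s"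
proof -
  note t = tuple_char[where p = "comp_family Y \<phi> \<psi>", OF small_index_small comp_family_ob[OF Y \<phi> \<psi>] z homD[OF k]]
  show "tuple V (Vert T) (comp_family Y \<phi> \<psi>) z k \<in> hom (pow_graph V T Y) z \<phi> \<psi>"
    using t \<phi> \<psi> by (simp add: hom_def pow_graph_simps)
  show "s \<in> Vert T \<Longrightarrow> pow_component Y \<phi> \<psi> (tuple V (Vert T) (comp_family Y \<phi> \<psi>) z k) s = k s"
    using t unfolding pow_component_def by blast
qed

context
  fixes Y :: "('y, 'o, 'm, 'e) ovgraph_scheme"
  assumes Y: "original_graph V Y"
begin

lemma Unt_pow:
  assumes \<phi>: "\<phi> \<in> original_transports V T Y"
  shows "Unt (pow_graph V T Y) \<phi> \<in> hom (pow_graph V T Y) \<star> \<phi> \<phi>"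
    and "s \<in> Vert T \<Longrightarrow> pow_component Y \<phi> \<phi> (Unt (pow_graph V T Y) \<phi>) s = Unt Y (on_vert \<phi> s)"
  unfolding pow_graph_simps(3)
  using tuple_pow[OF Y \<phi> \<phi> unit_ob homI[OF ot_vert[OF \<phi>] ot_vert[OF \<phi>] Unt_in[OF Y ot_vert[OF \<phi>]]]]
  by blast+

lemma original_pow: "original_graph V (pow_graph V T Y)"
proof -
  have "Edg (pow_graph V T Y) \<phi> \<psi> \<in> Ob V" if "\<phi> \<in> original_transports V T Y" "\<psi> \<in> original_transports V T Y" for \<phi> \<psi>
    unfolding pow_graph_simps
    by (rule prod_ob[where p = "comp_family Y \<phi> \<psi>", OF small_index_small comp_family_ob[OF Y that]])
  moreover have "Unt (pow_graph V T Y) \<phi> \<in> Hom V \<star> (Edg (pow_graph V T Y) \<phi> \<phi>)" if "\<phi> \<in> original_transports V T Y" for \<phi>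
    using homD[OF Unt_pow(1)[OF that]] by (simp add: arrows_def)
  ultimately show ?thesis unfolding original_graph_def by (simp add: pow_graph_simps(1))
qed

lemma pow_component_unit_el:
  assumes \<phi>: "\<phi> \<in> original_transports V T Y" and z: "z \<in> Ob V" and s: "s \<in> Vert T"
  shows "pow_component Y \<phi> \<phi> (unit_el (pow_graph V T Y) z \<phi>) s = unit_el Y z (on_vert \<phi> s)"
  unfolding unit_el_def using comp_pow_component[OF Y Unt_pow(1)[OF \<phi>] s bang_in[OF z]] Unt_pow(2)[OF \<phi> s] by simp

end

lemma pow_transport_vert: "\<phi> \<in> original_transports V T X \<Longrightarrow>
   on_vert (pow_transport V T X Y f) \<phi> = followed_by V T \<phi> f"
  by (simp add: pow_transport_def pow_graph_simps on_vert_mk)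

context
  fixes X :: "('x, 'o, 'm, 'd) ovgraph_scheme" and Y :: "('y, 'o, 'm, 'e) ovgraph_scheme"
    and f :: "('x, 'y, 'm) transport"
  assumes X: "original_graph V X" and Y: "original_graph V Y" and f: "f \<in> original_transports V X Y"
begin

lemma pow_transport_edge:
  assumes \<phi>: "\<phi> \<in> original_transports V T X" and \<psi>: "\<psi> \<in> original_transports V T X"
  shows "on_edge (pow_transport V T X Y f) \<phi> \<psi> \<in> hom (pow_graph V T Y) (Edg (pow_graph V T X) \<phi> \<psi>)
     (followed_by V T \<phi> f) (followed_by V T \<psi> f)" (is ?A)
    and "s \<in> Vert T \<Longrightarrow> pow_component Y (followed_by V T \<phi> f) (followed_by V T \<psi> f) (on_edge (pow_transport V T X Y f) \<phi> \<psi>) s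
        =
     proj V (Vert T) (comp_family X \<phi> \<psi>) s \<cdot> on_edge f (on_vert \<phi> s) (on_vert \<psi> s)" (is "_ \<Longrightarrow> ?B s")
proof -
  let ?k = "\<lambda>s. proj V (Vert T) (comp_family X \<phi> \<psi>) s \<cdot> on_edge f (on_vert \<phi> s) (on_vert \<psi> s)"
  have e: "on_edge (pow_transport V T X Y f) \<phi> \<psi> = 
    tuple V (Vert T) (comp_family Y (followed_by V T \<phi> f) (followed_by V T \<psi> f)) (Edg (pow_graph V T X) \<phi> \<psi>) ?k"
    using \<phi> \<psi> by (simp add: pow_transport_def pow_graph_simps on_edge_mk)
  have k: "?k s \<in> hom Y (Edg (pow_graph V T X) \<phi> \<psi>) (on_vert (followed_by V T \<phi> f) s) (on_vert (followed_by V T \<psi> f) s)"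
    if s: "s \<in> Vert T" for s
    using ot_act[OF Y f homI[OF ot_vert[OF \<phi> s] ot_vert[OF \<psi> s] pow_proj[OF X \<phi> \<psi> s]]] s
    by (simp add: followed_by_vert)
  have ob: "Edg (pow_graph V T X) \<phi> \<psi> \<in> Ob V"
    using original_pow[OF X] \<phi> \<psi> by (auto intro: Edg_ob simp: pow_graph_simps(1))
  note t = tuple_pow[OF Y followed_by_ot[OF T_graph X Y \<phi> f] followed_by_ot[OF T_graph X Y \<psi> f] ob k]
  show ?A unfolding e by (rule t(1))
  show "s \<in> Vert T \<Longrightarrow> ?B s" unfolding e by (rule t(2))
qed

lemma pow_component_pow_transport:
  assumes e: "e \<in> hom (pow_graph V T X) z \<phi> \<psi>" and s: "s \<in> Vert T"
  shows "pow_component Y (followed_by V T \<phi> f) (followed_by V T \<psi> f) (e \<cdot> on_edge (pow_transport V T X Y f) \<phi> \<psi>) s =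
    pow_component X \<phi> \<psi> e s \<cdot> on_edge f (on_vert \<phi> s) (on_vert \<psi> s)"
proof -
  note v = hom_pow_vert[OF e]
  note p = pow_proj[OF X v s]
  show ?thesis
    unfolding comp_pow_component[OF Y pow_transport_edge(1)[OF v] s homD[OF e]] pow_transport_edge(2)[OF v s]
    unfolding pow_component_def
    by (rule assoc[OF homD[OF e] p hom_edge[OF Y f homI[OF ot_vert[OF v(1) s] ot_vert[OF v(2) s] p]], symmetric])
qed

lemma pow_transport_ot: "pow_transport V T X Y f \<in> original_transports V (pow_graph V T X) (pow_graph V T Y)"
proof -
  let ?v = "\<lambda>\<phi>. followed_by V T \<phi> f" and ?g = "pow_transport V T X Y f"
  have "mk_transport (Vert (pow_graph V T X)) ?v (on_edge ?g) \<in> original_transports V (pow_graph V T X) (pow_graph V T Y)"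
  proof (rule otI[OF original_pow[OF X] original_pow[OF Y]])
    show 1: "?v \<phi> \<in> Vert (pow_graph V T Y)" if "\<phi> \<in> Vert (pow_graph V T X)" for \<phi>
      using that followed_by_ot[OF T_graph X Y _ f] by (simp add: pow_graph_simps)
    show 2: "on_edge ?g \<phi> \<psi> \<in> Edg (pow_graph V T X) \<phi> \<psi> \<leadsto> Edg (pow_graph V T Y) (?v \<phi>) (?v \<psi>)"
      if "\<phi> \<in> Vert (pow_graph V T X)" "\<psi> \<in> Vert (pow_graph V T X)" for \<phi> \<psi>
      using homD[OF pow_transport_edge(1)] that by (simp add: pow_graph_simps(1))
    show "unit_el (pow_graph V T X) z \<phi> \<cdot> on_edge ?g \<phi> \<phi> = unit_el (pow_graph V T Y) z (?v \<phi>)"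
      if \<phi>: "\<phi> \<in> Vert (pow_graph V T X)" and z: "z \<in> Ob V" for \<phi> z
    proof (rule pow_component_eqI[OF Y])
      note u = unit_el_in[OF original_pow[OF X] \<phi> z]
      note \<phi>' = \<phi>[unfolded pow_graph_simps]
      show "unit_el (pow_graph V T X) z \<phi> \<cdot> on_edge ?g \<phi> \<phi> \<in> hom (pow_graph V T Y) z (?v \<phi>) (?v \<phi>)"
        by (rule homI[OF 1[OF \<phi>] 1[OF \<phi>] comp_in[OF homD[OF u] 2[OF \<phi> \<phi>]]])
      show "unit_el (pow_graph V T Y) z (?v \<phi>) \<in> hom (pow_graph V T Y) z (?v \<phi>) (?v \<phi>)"
        by (rule unit_el_in[OF original_pow[OF Y] 1[OF \<phi>] z])
      show "pow_component Y (?v \<phi>) (?v \<phi>) (unit_el (pow_graph V T X) z \<phi> \<cdot> on_edge ?g \<phi> \<phi>) s =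
         pow_component Y (?v \<phi>) (?v \<phi>) (unit_el (pow_graph V T Y) z (?v \<phi>)) s" if s: "s \<in> Vert T" for s
        by (simp only: pow_component_pow_transport[OF u s] pow_component_unit_el[OF X \<phi>' z s] ot_unit_el[OF X Y f ot_vert[OF
            \<phi>' s] z]
          pow_component_unit_el[OF Y followed_by_ot[OF T_graph X Y \<phi>' f] z s] followed_by_vert[OF s])
    qed
  qed
  moreover have "mk_transport (Vert (pow_graph V T X)) ?v (on_edge ?g) = ?g"
    unfolding pow_transport_def by (rule mk_transport_cong) (simp_all add: on_edge_mk)
  ultimately show ?thesis by simp
qed

end

lemma Comps_pow:
  assumes Y: "composable Y" and \<phi>: "\<phi> \<in> original_transports V T Y" and \<psi>: "\<psi> \<in> original_transports V T Y"
    and \<chi>: "\<chi> \<in> original_transports V T Y"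
  shows "Comps (pow_cat V T Y) \<phi> \<psi> \<chi> \<in> hom (pow_graph V T Y) (Edg (pow_graph V T Y) \<phi> \<psi> \<otimes> Edg (pow_graph V T Y) \<psi> \<chi>) \<phi> \<chi>"
   and "s \<in> Vert T \<Longrightarrow> pow_component Y \<phi> \<chi> (Comps (pow_cat V T Y) \<phi> \<psi> \<chi>) s =
       (proj V (Vert T) (comp_family Y \<phi> \<psi>) s \<odot> proj V (Vert T) (comp_family Y \<psi> \<chi>) s) \<cdot>
              Comps Y (on_vert \<phi> s) (on_vert \<psi> s) (on_vert \<chi> s)"
proof -
  note G = composable_graph[OF Y]
  have ob: "Edg (pow_graph V T Y) \<phi> \<psi> \<otimes> Edg (pow_graph V T Y) \<psi> \<chi> \<in> Ob V"
    using tensor_ob[OF Edg_ob[OF original_pow[OF G]] Edg_ob[OF original_pow[OF G]]] \<phi> \<psi> \<chi>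
    by (simp only: pow_graph_simps(1))
  have k: "(proj V (Vert T) (comp_family Y \<phi> \<psi>) s \<odot> proj V (Vert T) (comp_family Y \<psi> \<chi>) s) \<cdot>
              Comps Y (on_vert \<phi> s) (on_vert \<psi> s) (on_vert \<chi> s) \<in>
     hom Y (Edg (pow_graph V T Y) \<phi> \<psi> \<otimes> Edg (pow_graph V T Y) \<psi> \<chi>) (on_vert \<phi> s) (on_vert \<chi> s)" if s: "s \<in> Vert T" for s
    by (rule homI[OF ot_vert[OF \<phi> s] ot_vert[OF \<chi> s] comp_in[OF tensor_in[OF pow_proj[OF G \<phi> \<psi> s] pow_proj[OF G \<psi> \<chi> s]]
       Comps_in[OF Y ot_vert[OF \<phi> s] ot_vert[OF \<psi> s] ot_vert[OF \<chi> s]]]])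
  have e: "Comps (pow_cat V T Y) \<phi> \<psi> \<chi> = tuple V (Vert T) (comp_family Y \<phi> \<chi>)
      (Edg (pow_graph V T Y) \<phi> \<psi> \<otimes> Edg (pow_graph V T Y) \<psi> \<chi>)
      (\<lambda>s. (proj V (Vert T) (comp_family Y \<phi> \<psi>) s \<odot> proj V (Vert T) (comp_family Y \<psi> \<chi>) s) \<cdot>
              Comps Y (on_vert \<phi> s) (on_vert \<psi> s) (on_vert \<chi> s))"
    by (simp add: pow_cat_def)
  note t = tuple_pow[OF G \<phi> \<chi> ob k]
  show "Comps (pow_cat V T Y) \<phi> \<psi> \<chi> \<in> hom (pow_graph V T Y) (Edg (pow_graph V T Y) \<phi> \<psi> \<otimes> Edg (pow_graph V T Y) \<psi> \<chi>) \<phi> \<chi>"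
    unfolding e by (rule t(1))
  show "s \<in> Vert T \<Longrightarrow> pow_component Y \<phi> \<chi> (Comps (pow_cat V T Y) \<phi> \<psi> \<chi>) s =
       (proj V (Vert T) (comp_family Y \<phi> \<psi>) s \<odot> proj V (Vert T) (comp_family Y \<psi> \<chi>) s) \<cdot>
              Comps Y (on_vert \<phi> s) (on_vert \<psi> s) (on_vert \<chi> s)"
    unfolding e by (rule t(2))
qed

lemma pow_composable: 
  assumes Y: "composable Y"
  shows "composable (pow_cat V T Y)"
proof -
  have "Vert (pow_cat V T Y) = original_transports V T Y" "Edg (pow_cat V T Y) = Edg (pow_graph V T Y)"
    by (simp_all add: pow_cat_def pow_graph_simps(1))
  then show ?thesis
    unfolding composable_def original_pow_cat
    using original_pow[OF composable_graph[OF Y]] homD[OF Comps_pow(1)[OF Y]] by simp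
qed

lemma pow_component_comp_el:
  assumes Y: "composable Y" and e: "e \<in> hom (pow_graph V T Y) z \<phi> \<psi>" and e': "e' \<in> hom (pow_graph V T Y) z \<psi> \<chi>"
    and s: "s \<in> Vert T"
  shows "pow_component Y \<phi> \<chi> (comp_el (pow_cat V T Y) z \<phi> \<psi> \<chi> e e') s =
    comp_el Y z (on_vert \<phi> s) (on_vert \<psi> s) (on_vert \<chi> s) (pow_component Y \<phi> \<psi> e s) (pow_component Y \<psi> \<chi> e' s)"
proof -
  note G = composable_graph[OF Y]
  note v = hom_pow_vert[OF e] hom_pow_vert(2)[OF e']
  have E: "Edg (pow_cat V T Y) = Edg (pow_graph V T Y)" by (simp add: pow_cat_def)
  note p = pair_in[OF homD[OF e] homD[OF e']]
  note q = pow_proj[OF G v(1,2) s] and r = pow_proj[OF G v(2,3) s]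
  show ?thesis unfolding comp_el_def[of "pow_cat V T Y"] E
    unfolding comp_pow_component[OF G Comps_pow(1)[OF Y v] s p] Comps_pow(2)[OF Y v s]
    unfolding comp_el_def pow_component_def
    by (simp only: assoc[OF p tensor_in[OF q r] Comps_in[OF Y ot_vert[OF v(1) s] ot_vert[OF v(2) s] ot_vert[OF v(3) s]],
        symmetric]
      pair_tensor[OF homD[OF e] homD[OF e'] q r])
qed

lemma pow_transport_nf:
  assumes X: "composable X" and Y: "composable Y" and f: "f \<in> natural_functors V X Y"
  shows "pow_transport V T X Y f \<in> natural_functors V (pow_cat V T X) (pow_cat V T Y)"
proof (rule nfI[OF pow_composable[OF X] pow_composable[OF Y]])
  note GX = composable_graph[OF X] and GY = composable_graph[OF Y] and fo = nf_ot[OF f]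
  show g: "pow_transport V T X Y f \<in> original_transports V (pow_cat V T X) (pow_cat V T Y)"
    unfolding ot_pow_cat_source ot_pow_cat_target by (rule pow_transport_ot[OF GX GY fo])
  fix z \<phi> \<psi> \<chi> a b assume a: "a \<in> hom (pow_cat V T X) z \<phi> \<psi>" and b: "b \<in> hom (pow_cat V T X) z \<psi> \<chi>"
  note PY = composable_graph[OF pow_composable[OF Y]]
  note c = comp_el_in[OF pow_composable[OF X] a b]
  note a' = a[unfolded hom_pow_cat] and b' = b[unfolded hom_pow_cat] and c' = c[unfolded hom_pow_cat]
  note v = hom_pow_vert[OF a'] hom_pow_vert(2)[OF b']
  note ga = ot_act[OF PY g a] and gb = ot_act[OF PY g b] and gc = ot_act[OF PY g c]
  note gab = comp_el_in[OF pow_composable[OF Y] ga gb]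
  let ?g = "pow_transport V T X Y f"
  show "comp_el (pow_cat V T X) z \<phi> \<psi> \<chi> a b \<cdot> on_edge ?g \<phi> \<chi> =
    comp_el (pow_cat V T Y) z (on_vert ?g \<phi>) (on_vert ?g \<psi>) (on_vert ?g \<chi>) (a \<cdot> on_edge ?g \<phi> \<psi>) (b \<cdot> on_edge ?g \<psi> \<chi>)"
  proof (rule pow_component_eqI[OF GY gc[unfolded hom_pow_cat] gab[unfolded hom_pow_cat]])
    fix s assume s: "s \<in> Vert T"
    note pa = pow_component_in[OF GX a' s] and pb = pow_component_in[OF GX b' s]
    show "pow_component Y (on_vert ?g \<phi>) (on_vert ?g \<chi>) (comp_el (pow_cat V T X) z \<phi> \<psi> \<chi> a b \<cdot> on_edge ?g \<phi> \<chi>) s =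
     pow_component Y (on_vert ?g \<phi>) (on_vert ?g \<chi>) (comp_el (pow_cat V T Y) z (on_vert ?g \<phi>) (on_vert ?g \<psi>) (on_vert ?g \<chi>)
         (a \<cdot> on_edge ?g \<phi> \<psi>) (b \<cdot> on_edge ?g \<psi> \<chi>)) s"
      unfolding pow_component_comp_el[OF Y ga[unfolded hom_pow_cat] gb[unfolded hom_pow_cat] s]
      unfolding pow_transport_vert[OF v(1)] pow_transport_vert[OF v(2)] pow_transport_vert[OF v(3)]
      by (simp only: pow_component_pow_transport[OF GX GY fo a' s] pow_component_pow_transport[OF GX GY fo b' s]
          pow_component_pow_transport[OF GX GY fo c' s]
        pow_component_comp_el[OF X a' b' s] nf_comp_el[OF X Y f pa pb] followed_by_vert[OF s])
  qed
qed

section \<open>The space of natural functors\<close>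

text \<open>
  Naturality of a family at stage \<open>z\<close> must be required at all later stages \<open>w\<close>, since elements of
  \<open>T(s;t)\<close> need not exist at stage \<open>z\<close> itself.
\<close>

definition natural_at :: "('y, 'o, 'm) vcat \<Rightarrow> ('s, 'y, 'm) transport \<Rightarrow> ('s, 'y, 'm) transport \<Rightarrow> 'o \<Rightarrow> 'm \<Rightarrow> bool" where
  "natural_at Y \<phi> \<psi> z h \<longleftrightarrow> (\<forall>w k s t \<tau>. k \<in> w \<leadsto> z \<longrightarrow> \<tau> \<in> hom T w s t \<longrightarrow>
     comp_el Y w (on_vert \<phi> s) (on_vert \<psi> s) (on_vert \<psi> t) (pow_component Y \<phi> \<psi> (k \<cdot> h) s) (\<tau> \<cdot> on_edge \<psi> s t) =
     comp_el Y w (on_vert \<phi> s) (on_vert \<phi> t) (on_vert \<psi> t) (\<tau> \<cdot> on_edge \<phi> s t) (pow_component Y \<phi> \<psi> (k \<cdot> h) t))"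

context
  fixes Y :: "('y, 'o, 'm) vcat" and \<phi> \<psi> :: "('s, 'y, 'm) transport"
  assumes Y: "composable Y" and \<phi>: "\<phi> \<in> original_transports V T Y" and \<psi>: "\<psi> \<in> original_transports V T Y"
begin

lemma YG: "original_graph V Y" by (rule composable_graph[OF Y])

text \<open>
  The object from which the two mappings of the equalizer start, and the arrows of which they are
  names at \<open>s\<close>, \<open>t\<close>.
\<close>

abbreviation (input) component_product where "component_product \<equiv> prod_ob V (Vert T) (comp_family Y \<phi> \<psi>)"

abbreviation (input) left_side where "left_side s t \<equiv>
  (proj V (Vert T) (comp_family Y \<phi> \<psi>) s \<odot> on_edge \<psi> s t) \<cdot> Comps Y (on_vert \<phi> s) (on_vert \<psi> s) (on_vert \<psi> t)"

abbreviation (input) right_side where "right_side s t \<equiv>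
  swap V component_product (Edg T s t) \<cdot> (on_edge \<phi> s t \<odot> proj V (Vert T) (comp_family Y \<phi> \<psi>) t) \<cdot>
          Comps Y (on_vert \<phi> s) (on_vert \<phi> t) (on_vert \<psi> t)"

lemma component_product_ob: "component_product \<in> Ob V"
  by (rule prod_ob[where p = "comp_family Y \<phi> \<psi>", OF small_index_small comp_family_ob[OF YG \<phi> \<psi>]])

lemma left_side_in: assumes s: "s \<in> Vert T" and t: "t \<in> Vert T"
  shows "left_side s t \<in> component_product \<otimes> Edg T s t \<leadsto> Edg Y (on_vert \<phi> s) (on_vert \<psi> t)"
  by (rule comp_in[OF tensor_in[OF pow_proj[OF YG \<phi> \<psi> s, unfolded pow_graph_simps] ot_edge[OF T_graph YG \<psi> s t]]
     Comps_in[OF Y ot_vert[OF \<phi> s] ot_vert[OF \<psi> s] ot_vert[OF \<psi> t]]])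

lemma right_side_in: assumes s: "s \<in> Vert T" and t: "t \<in> Vert T"
  shows "right_side s t \<in> component_product \<otimes> Edg T s t \<leadsto> Edg Y (on_vert \<phi> s) (on_vert \<psi> t)"
  by (rule comp_in[OF comp_in[OF swap_in[OF component_product_ob Edg_ob[OF T_graph s t]]
       tensor_in[OF ot_edge[OF T_graph YG \<phi> s t] pow_proj[OF YG \<phi> \<psi> t, unfolded pow_graph_simps]]]
     Comps_in[OF Y ot_vert[OF \<phi> s] ot_vert[OF \<phi> t] ot_vert[OF \<psi> t]]])

lemma pair_left_side:
  assumes p: "p \<in> z \<leadsto> component_product" and \<tau>: "\<tau> \<in> hom T z s t"
  shows "pair z component_product (Edg T s t) p \<tau> \<cdot> left_side s t =
    comp_el Y z (on_vert \<phi> s) (on_vert \<psi> s) (on_vert \<psi> t) (pow_component Y \<phi> \<psi> p s) (\<tau> \<cdot> on_edge \<psi> s t)"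
proof -
  note s = hom_vert(1)[OF \<tau>] and t = hom_vert(2)[OF \<tau>]
  note q = pow_proj[OF YG \<phi> \<psi> s, unfolded pow_graph_simps] and r = ot_edge[OF T_graph YG \<psi> s t]
  show ?thesis unfolding comp_el_def pow_component_def
    by (simp only: assoc[OF pair_in[OF p homD[OF \<tau>]] tensor_in[OF q r] Comps_in[OF Y ot_vert[OF \<phi> s] ot_vert[OF \<psi> s]
        ot_vert[OF \<psi> t]], symmetric]
      pair_tensor[OF p homD[OF \<tau>] q r])
qed

lemma pair_right_side:
  assumes p: "p \<in> z \<leadsto> component_product" and \<tau>: "\<tau> \<in> hom T z s t"
  shows "pair z component_product (Edg T s t) p \<tau> \<cdot> right_side s t =
    comp_el Y z (on_vert \<phi> s) (on_vert \<phi> t) (on_vert \<psi> t) (\<tau> \<cdot> on_edge \<phi> s t) (pow_component Y \<phi> \<psi> p t)"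
proof -
  note s = hom_vert(1)[OF \<tau>] and t = hom_vert(2)[OF \<tau>]
  note q = pow_proj[OF YG \<phi> \<psi> t, unfolded pow_graph_simps] and r = ot_edge[OF T_graph YG \<phi> s t]
  note S = swap_in[OF component_product_ob Edg_ob[OF T_graph s t]] and C = Comps_in[OF Y ot_vert[OF \<phi> s] ot_vert[OF \<phi> t]
      ot_vert[OF \<psi> t]]
  note x = pair_in[OF p homD[OF \<tau>]]
  show ?thesis unfolding comp_el_def pow_component_def
    by (simp only: assoc[OF x comp_in[OF S tensor_in[OF r q]] C, symmetric] assoc[OF x S tensor_in[OF r q], symmetric]
      pair_swap[OF p homD[OF \<tau>]] pair_tensor[OF homD[OF \<tau>] p r q])
qed

text \<open>
  Equality of the two mappings into the product of exponentials is equality of names at each pair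
  \<open>s\<close>, \<open>t\<close>, which \<open>names_agree_iff\<close> turns into a naturality square for every later element of
  \<open>T(s;t)\<close>.
\<close>

lemma squares:
  shows "square_first V T Y \<phi> \<psi> \<in> component_product \<leadsto> prod_ob V (Vert T \<times> Vert T) (square_family V T Y \<phi> \<psi>)"
    and "square_second V T Y \<phi> \<psi> \<in> component_product \<leadsto> prod_ob V (Vert T \<times> Vert T) (square_family V T Y \<phi> \<psi>)"
    and "h \<in> z \<leadsto> component_product \<Longrightarrow> h \<cdot> square_first V T Y \<phi> \<psi> = h \<cdot> square_second V T Y \<phi> \<psi> \<longleftrightarrow> natural_at Y \<phi> \<psi> z h"
proof -
  let ?I = "Vert T \<times> Vert T" and ?q = "square_family V T Y \<phi> \<psi>"
  let ?k = "\<lambda>(s, t). Nam V component_product (Edg T s t) (Edg Y (on_vert \<phi> s) (on_vert \<psi> t)) (left_side s t)"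
  let ?l = "\<lambda>(s, t). Nam V component_product (Edg T s t) (Edg Y (on_vert \<phi> s) (on_vert \<psi> t)) (right_side s t)"
  have q: "?q i \<in> Ob V" if "i \<in> ?I" for i
    using that by (auto intro!: Exp_ob Edg_ob[OF T_graph] Edg_ob[OF YG] ot_vert[OF \<phi>] ot_vert[OF \<psi>])
  have k: "?k i \<in> component_product \<leadsto> ?q i" if "i \<in> ?I" for i
    using that Nam_in[OF Edg_ob[OF T_graph] component_product_ob left_side_in] by auto
  have l: "?l i \<in> component_product \<leadsto> ?q i" if "i \<in> ?I" for i
    using that Nam_in[OF Edg_ob[OF T_graph] component_product_ob right_side_in] by auto
  have first: "square_first V T Y \<phi> \<psi> = tuple V ?I ?q component_product ?k"
    and second: "square_second V T Y \<phi> \<psi> = tuple V ?I ?q component_product ?l"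
    by (simp_all only: square_first_def square_second_def Let_def)
  note tk = tuple_char[where p = ?q and k = ?k, OF small_index_pairs q component_product_ob k]
  note tl = tuple_char[where p = ?q and k = ?l, OF small_index_pairs q component_product_ob l]
  show F: "square_first V T Y \<phi> \<psi> \<in> component_product \<leadsto> prod_ob V ?I ?q" unfolding first using tk by blast
  show S: "square_second V T Y \<phi> \<psi> \<in> component_product \<leadsto> prod_ob V ?I ?q" unfolding second using tl by blast
  assume h: "h \<in> z \<leadsto> component_product"
  have pr: "proj V ?I ?q i \<in> prod_ob V ?I ?q \<leadsto> ?q i" if "i \<in> ?I" for i
    by (rule proj_in[where p = ?q, OF small_index_pairs q that])
  have "h \<cdot> square_first V T Y \<phi> \<psi> = h \<cdot> square_second V T Y \<phi> \<psi> \<longleftrightarrow> (\<forall>i\<in>?I. h \<cdot> ?k i = h \<cdot> ?l i)"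
  proof -
    have 1: "h \<cdot> square_first V T Y \<phi> \<psi> \<cdot> proj V ?I ?q i = h \<cdot> ?k i" if "i \<in> ?I" for i
      unfolding assoc[OF h F pr[OF that]] unfolding first using tk that by simp
    have 2: "h \<cdot> square_second V T Y \<phi> \<psi> \<cdot> proj V ?I ?q i = h \<cdot> ?l i" if "i \<in> ?I" for i
      unfolding assoc[OF h S pr[OF that]] unfolding second using tl that by simp
    show ?thesis
    proof
      assume "h \<cdot> square_first V T Y \<phi> \<psi> = h \<cdot> square_second V T Y \<phi> \<psi>"
      then show "\<forall>i\<in>?I. h \<cdot> ?k i = h \<cdot> ?l i" using 1 2 by simp
    next
      assume *: "\<forall>i\<in>?I. h \<cdot> ?k i = h \<cdot> ?l i"
      show "h \<cdot> square_first V T Y \<phi> \<psi> = h \<cdot> square_second V T Y \<phi> \<psi>"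
      proof (rule prod_eqI[where p = ?q, OF small_index_pairs q comp_in[OF h F] comp_in[OF h S]])
        fix i assume i: "i \<in> ?I"
        show "h \<cdot> square_first V T Y \<phi> \<psi> \<cdot> proj V ?I ?q i = h \<cdot> square_second V T Y \<phi> \<psi> \<cdot> proj V ?I ?q i"
          unfolding 1[OF i] 2[OF i] using * i by blast
      qed
    qed
  qed
  also have "\<dots> \<longleftrightarrow> (\<forall>s\<in>Vert T. \<forall>t\<in>Vert T. 
      h \<cdot> Nam V component_product (Edg T s t) (Edg Y (on_vert \<phi> s) (on_vert \<psi> t)) (left_side s t) =
      h \<cdot> Nam V component_product (Edg T s t) (Edg Y (on_vert \<phi> s) (on_vert \<psi> t)) (right_side s t))"
    by simp
  also have "\<dots> \<longleftrightarrow> natural_at Y \<phi> \<psi> z h"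
  proof
    assume a: "\<forall>s\<in>Vert T. \<forall>t\<in>Vert T. 
      h \<cdot> Nam V component_product (Edg T s t) (Edg Y (on_vert \<phi> s) (on_vert \<psi> t)) (left_side s t) =
      h \<cdot> Nam V component_product (Edg T s t) (Edg Y (on_vert \<phi> s) (on_vert \<psi> t)) (right_side s t)"
    show "natural_at Y \<phi> \<psi> z h" unfolding natural_at_def
    proof (intro allI impI)
      fix w k s t \<tau> assume kk: "k \<in> w \<leadsto> z" and \<tau>: "\<tau> \<in> hom T w s t"
      note st = hom_vert[OF \<tau>]
      have "pair w component_product (Edg T s t) (k \<cdot> h) \<tau> \<cdot> left_side s t = pair w component_product (Edg T s t) (k \<cdot> h) \<tau>
          \<cdot> right_side s t"
        using a st names_agree_iff[OF Edg_ob[OF T_graph st] h left_side_in[OF st] right_side_in[OF st]] kk homD[OF \<tau>] by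
            blast
      then show "comp_el Y w (on_vert \<phi> s) (on_vert \<psi> s) (on_vert \<psi> t) (pow_component Y \<phi> \<psi> (k \<cdot> h) s) (\<tau> \<cdot> on_edge \<psi> s t) =
        comp_el Y w (on_vert \<phi> s) (on_vert \<phi> t) (on_vert \<psi> t) (\<tau> \<cdot> on_edge \<phi> s t) (pow_component Y \<phi> \<psi> (k \<cdot> h) t)"
        unfolding pair_left_side[OF comp_in[OF kk h] \<tau>] pair_right_side[OF comp_in[OF kk h] \<tau>] .
    qed
  next
    assume n: "natural_at Y \<phi> \<psi> z h"
    show "\<forall>s\<in>Vert T. \<forall>t\<in>Vert T. 
      h \<cdot> Nam V component_product (Edg T s t) (Edg Y (on_vert \<phi> s) (on_vert \<psi> t)) (left_side s t) =
      h \<cdot> Nam V component_product (Edg T s t) (Edg Y (on_vert \<phi> s) (on_vert \<psi> t)) (right_side s t)"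
    proof (intro ballI)
      fix s t assume st: "s \<in> Vert T" "t \<in> Vert T"
      show "h \<cdot> Nam V component_product (Edg T s t) (Edg Y (on_vert \<phi> s) (on_vert \<psi> t)) (left_side s t) =
          h \<cdot> Nam V component_product (Edg T s t) (Edg Y (on_vert \<phi> s) (on_vert \<psi> t)) (right_side s t)"
        unfolding names_agree_iff[OF Edg_ob[OF T_graph st] h left_side_in[OF st] right_side_in[OF st]]
      proof (intro allI impI)
        fix w k \<tau> assume kk: "k \<in> w \<leadsto> z" and \<tau>: "\<tau> \<in> w \<leadsto> Edg T s t"
        note \<tau>' = homI[OF st \<tau>]
        show "pair w component_product (Edg T s t) (k \<cdot> h) \<tau> \<cdot> left_side s t = pair w component_product (Edg T s t) (k \<cdot> h)
            \<tau> \<cdot> right_side s t"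
          unfolding pair_left_side[OF comp_in[OF kk h] \<tau>'] pair_right_side[OF comp_in[OF kk h] \<tau>']
          using n kk \<tau>' unfolding natural_at_def by blast
      qed
    qed
  qed
  finally show "h \<cdot> square_first V T Y \<phi> \<psi> = h \<cdot> square_second V T Y \<phi> \<psi> \<longleftrightarrow> natural_at Y \<phi> \<psi> z h" .
qed

lemma nat_equalizer:
  "is_equalizer V component_product (prod_ob V (Vert T \<times> Vert T) (square_family V T Y \<phi> \<psi>))
     (square_first V T Y \<phi> \<psi>) (square_second V T Y \<phi> \<psi>) (nat_ob V T Y \<phi> \<psi>) (nat_incl V T Y \<phi> \<psi>)"
  unfolding nat_cone_def by (rule chosen_equalizer[OF squares(1,2)])

lemma nat_ob: "nat_ob V T Y \<phi> \<psi> \<in> Ob V"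
  using nat_equalizer unfolding is_equalizer_def by blast

lemma nat_incl_in: "nat_incl V T Y \<phi> \<psi> \<in> hom (pow_graph V T Y) (nat_ob V T Y \<phi> \<psi>) \<phi> \<psi>"
  using nat_equalizer component_product_ob nat_ob \<phi> \<psi> unfolding is_equalizer_def by (simp add: hom_def arrows_def
      pow_graph_simps)

lemma nat_incl_natural: "natural_at Y \<phi> \<psi> (nat_ob V T Y \<phi> \<psi>) (nat_incl V T Y \<phi> \<psi>)"
  using squares(3)[OF homD[OF nat_incl_in, unfolded pow_graph_simps]] nat_equalizer unfolding is_equalizer_def by blast

lemma nat_lift:
  assumes h: "h \<in> hom (pow_graph V T Y) z \<phi> \<psi>" and n: "natural_at Y \<phi> \<psi> z h"
  shows "nat_lift V T Y \<phi> \<psi> z h \<in> z \<leadsto> nat_ob V T Y \<phi> \<psi>"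
    and "nat_lift V T Y \<phi> \<psi> z h \<cdot> nat_incl V T Y \<phi> \<psi> = h"
proof -
  note h' = homD[OF h, unfolded pow_graph_simps]
  have "\<exists>!u. u \<in> Hom V z (nat_ob V T Y \<phi> \<psi>) \<and> u \<cdot> nat_incl V T Y \<phi> \<psi> = h"
    using nat_equalizer squares(3)[OF h'] n h' unfolding is_equalizer_def arrows_def by blast
  from theI'[OF this] have "nat_lift V T Y \<phi> \<psi> z h \<in> Hom V z (nat_ob V T Y \<phi> \<psi>) \<and> nat_lift V T Y \<phi> \<psi> z h \<cdot> nat_incl V T Y \<phi>
      \<psi> = h"
    unfolding nat_lift_def .
  then show "nat_lift V T Y \<phi> \<psi> z h \<in> z \<leadsto> nat_ob V T Y \<phi> \<psi>"
    "nat_lift V T Y \<phi> \<psi> z h \<cdot> nat_incl V T Y \<phi> \<psi> = h" using nat_ob h' by (auto simp: arrows_def)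
qed

lemma nat_incl_mono:
  assumes e: "e \<in> z \<leadsto> nat_ob V T Y \<phi> \<psi>" and e': "e' \<in> z \<leadsto> nat_ob V T Y \<phi> \<psi>"
    and eq: "e \<cdot> nat_incl V T Y \<phi> \<psi> = e' \<cdot> nat_incl V T Y \<phi> \<psi>"
  shows "e = e'"
proof -
  note i = homD[OF nat_incl_in, unfolded pow_graph_simps]
  note h' = comp_in[OF e i]
  have "e \<cdot> nat_incl V T Y \<phi> \<psi> \<cdot> square_first V T Y \<phi> \<psi> = e \<cdot> nat_incl V T Y \<phi> \<psi> \<cdot> square_second V T Y \<phi> \<psi>"
    using nat_equalizer unfolding is_equalizer_def by (simp only: assoc[OF e i squares(1)] assoc[OF e i squares(2)])
  then have "\<exists>!u. u \<in> Hom V z (nat_ob V T Y \<phi> \<psi>) \<and> u \<cdot> nat_incl V T Y \<phi> \<psi> = e \<cdot> nat_incl V T Y \<phi> \<psi>"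
    using nat_equalizer h' unfolding is_equalizer_def arrows_def by blast
  moreover have "e \<in> Hom V z (nat_ob V T Y \<phi> \<psi>)" "e' \<in> Hom V z (nat_ob V T Y \<phi> \<psi>)"
    using e e' by (simp_all add: arrows_def)
  ultimately show ?thesis using eq by metis
qed

end

text \<open>
  The entry at \<open>s\<close> of an element of the space of natural transforms.
\<close>

definition nat_component :: "('y, 'o, 'm) vcat \<Rightarrow> ('s, 'y, 'm) transport \<Rightarrow> ('s, 'y, 'm) transport \<Rightarrow> 'm \<Rightarrow> 's \<Rightarrow> 'm" where
  "nat_component Y \<phi> \<psi> e s = pow_component Y \<phi> \<psi> (e \<cdot> nat_incl V T Y \<phi> \<psi>) s"

lemma exp_cat_simps:
  "Vert (exp_cat V T Y) = natural_functors V T Y"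
  "Edg (exp_cat V T Y) = nat_ob V T Y"
  by (simp_all add: exp_cat_def)

lemma hom_exp_vert:
  assumes "e \<in> hom (exp_cat V T Y) z \<phi> \<psi>"
  shows "\<phi> \<in> natural_functors V T Y" "\<psi> \<in> natural_functors V T Y"
  using hom_vert[OF assms] by (simp_all add: exp_cat_simps)

context
  fixes Y :: "('y, 'o, 'm) vcat"
  assumes Y: "composable Y"
begin

lemma exp_incl_hom:
  assumes e: "e \<in> hom (exp_cat V T Y) z \<phi> \<psi>"
  shows "e \<cdot> nat_incl V T Y \<phi> \<psi> \<in> hom (pow_graph V T Y) z \<phi> \<psi>"
  using hom_comp[OF homD[OF e, unfolded exp_cat_simps] nat_incl_in[OF Y nf_ot[OF hom_exp_vert(1)[OF e]] nf_ot[OF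
      hom_exp_vert(2)[OF e]]]] .

lemma nat_component_in:
  assumes e: "e \<in> hom (exp_cat V T Y) z \<phi> \<psi>" and s: "s \<in> Vert T"
  shows "nat_component Y \<phi> \<psi> e s \<in> hom Y z (on_vert \<phi> s) (on_vert \<psi> s)"
  unfolding nat_component_def by (rule pow_component_in[OF composable_graph[OF Y] exp_incl_hom[OF e] s])

lemma nat_component_eqI:
  assumes e: "e \<in> hom (exp_cat V T Y) z \<phi> \<psi>" and e': "e' \<in> hom (exp_cat V T Y) z \<phi> \<psi>"
    and eq: "\<And>s. s \<in> Vert T \<Longrightarrow> nat_component Y \<phi> \<psi> e s = nat_component Y \<phi> \<psi> e' s"
  shows "e = e'"
proof -
  have "e \<cdot> nat_incl V T Y \<phi> \<psi> = e' \<cdot> nat_incl V T Y \<phi> \<psi>"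
    by (rule pow_component_eqI[OF composable_graph[OF Y] exp_incl_hom[OF e] exp_incl_hom[OF e'] eq[unfolded
        nat_component_def]])
  then show ?thesis
    by (rule nat_incl_mono[OF Y nf_ot[OF hom_exp_vert(1)[OF e]] nf_ot[OF hom_exp_vert(2)[OF e]]
      homD[OF e, unfolded exp_cat_simps] homD[OF e', unfolded exp_cat_simps]])
qed

lemma nat_component_natural:
  assumes e: "e \<in> hom (exp_cat V T Y) z \<phi> \<psi>" and \<tau>: "\<tau> \<in> hom T z s t"
  shows "comp_el Y z (on_vert \<phi> s) (on_vert \<psi> s) (on_vert \<psi> t) (nat_component Y \<phi> \<psi> e s) (\<tau> \<cdot> on_edge \<psi> s t) =
    comp_el Y z (on_vert \<phi> s) (on_vert \<phi> t) (on_vert \<psi> t) (\<tau> \<cdot> on_edge \<phi> s t) (nat_component Y \<phi> \<psi> e t)"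
  using nat_incl_natural[OF Y nf_ot[OF hom_exp_vert(1)[OF e]] nf_ot[OF hom_exp_vert(2)[OF e]]]
    homD[OF e, unfolded exp_cat_simps] \<tau>
  unfolding natural_at_def nat_component_def by blast

text \<open>
  Natural families are exactly the elements of the exponential space: with \<open>nat_component_in\<close>,
  \<open>nat_component_natural\<close> and \<open>nat_component_eqI\<close> this describes it without reference to the
  equalizer.
\<close>

lemma exp_lift:
  assumes \<phi>: "\<phi> \<in> natural_functors V T Y" and \<psi>: "\<psi> \<in> natural_functors V T Y"
    and h: "h \<in> hom (pow_graph V T Y) z \<phi> \<psi>" and n: "natural_at Y \<phi> \<psi> z h"
  shows "nat_lift V T Y \<phi> \<psi> z h \<in> hom (exp_cat V T Y) z \<phi> \<psi>"
    and "nat_lift V T Y \<phi> \<psi> z h \<cdot> nat_incl V T Y \<phi> \<psi> = h"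
    and "nat_component Y \<phi> \<psi> (nat_lift V T Y \<phi> \<psi> z h) s = pow_component Y \<phi> \<psi> h s"
proof -
  note l = nat_lift[OF Y nf_ot[OF \<phi>] nf_ot[OF \<psi>] h n]
  show "nat_lift V T Y \<phi> \<psi> z h \<in> hom (exp_cat V T Y) z \<phi> \<psi>"
    using l(1) \<phi> \<psi> by (simp add: hom_def exp_cat_simps)
  show "nat_lift V T Y \<phi> \<psi> z h \<cdot> nat_incl V T Y \<phi> \<psi> = h" by (rule l(2))
  show "nat_component Y \<phi> \<psi> (nat_lift V T Y \<phi> \<psi> z h) s = pow_component Y \<phi> \<psi> h s"
    unfolding nat_component_def l(2) ..
qed

end

context
  fixes Y :: "('y, 'o, 'm) vcat"
  assumes Y: "enriched V Y"
begin

lemma YC: "composable Y" by (rule enriched_composable[OF Y])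
lemma YG': "original_graph V Y" by (rule enriched_graph[OF Y])

lemma Unt_exp:
  assumes \<phi>: "\<phi> \<in> natural_functors V T Y"
  shows "Unt (exp_cat V T Y) \<phi> \<in> hom (exp_cat V T Y) \<star> \<phi> \<phi>"
    and "Unt (exp_cat V T Y) \<phi> \<cdot> nat_incl V T Y \<phi> \<phi> = Unt (pow_graph V T Y) \<phi>"
proof -
  note \<phi>' = nf_ot[OF \<phi>]
  have e: "Unt (exp_cat V T Y) \<phi> = nat_lift V T Y \<phi> \<phi> \<star> (Unt (pow_graph V T Y) \<phi>)"
    by (simp add: exp_cat_def pow_cat_def)
  have n: "natural_at Y \<phi> \<phi> \<star> (Unt (pow_graph V T Y) \<phi>)"
    unfolding natural_at_def
  proof (intro allI impI)
    fix w k s t \<tau> assume k: "k \<in> w \<leadsto> \<star>" and \<tau>: "\<tau> \<in> hom T w s t"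
    have *: "pow_component Y \<phi> \<phi> (k \<cdot> Unt (pow_graph V T Y) \<phi>) s = unit_el Y w (on_vert \<phi> s)" if "s \<in> Vert T" for s
      using pow_component_unit_el[OF YG' \<phi>' arrows_ob(1)[OF k] that] to_unit_unique[OF k bang_in[OF arrows_ob(1)[OF k]]]
      unfolding unit_el_def by simp
    note a = ot_act[OF YG' \<phi>' \<tau>]
    show "comp_el Y w (on_vert \<phi> s) (on_vert \<phi> s) (on_vert \<phi> t) (pow_component Y \<phi> \<phi> (k \<cdot> Unt (pow_graph V T Y) \<phi>) s) (\<tau> \<cdot>
        on_edge \<phi> s t) =
      comp_el Y w (on_vert \<phi> s) (on_vert \<phi> t) (on_vert \<phi> t) (\<tau> \<cdot> on_edge \<phi> s t) (pow_component Y \<phi> \<phi> (k \<cdot> Unt (pow_graph V T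
          Y) \<phi>) t)"
      by (simp only: *[OF hom_vert(1)[OF \<tau>]] *[OF hom_vert(2)[OF \<tau>]] comp_el_unit_el_left[OF Y a] comp_el_unit_el_right[OF Y
          a])
  qed
  note l = exp_lift[OF YC \<phi> \<phi> Unt_pow(1)[OF YG' \<phi>'] n]
  show "Unt (exp_cat V T Y) \<phi> \<in> hom (exp_cat V T Y) \<star> \<phi> \<phi>"
    and "Unt (exp_cat V T Y) \<phi> \<cdot> nat_incl V T Y \<phi> \<phi> = Unt (pow_graph V T Y) \<phi>"
    unfolding e by (rule l(1), rule l(2))
qed

lemma original_exp: "original_graph V (exp_cat V T Y)"
proof -
  have "Edg (exp_cat V T Y) \<phi> \<psi> \<in> Ob V" if "\<phi> \<in> natural_functors V T Y" "\<psi> \<in> natural_functors V T Y" for \<phi> \<psi>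
    unfolding exp_cat_simps by (rule nat_ob[OF YC nf_ot[OF that(1)] nf_ot[OF that(2)]])
  moreover have "Unt (exp_cat V T Y) \<phi> \<in> Hom V \<star> (Edg (exp_cat V T Y) \<phi> \<phi>)" if "\<phi> \<in> natural_functors V T Y" for \<phi>
    using homD[OF Unt_exp(1)[OF that]] by (simp add: arrows_def)
  ultimately show ?thesis unfolding original_graph_def by (simp add: exp_cat_simps(1))
qed

lemma unit_el_exp_incl:
  assumes \<phi>: "\<phi> \<in> natural_functors V T Y" and z: "z \<in> Ob V"
  shows "unit_el (exp_cat V T Y) z \<phi> \<cdot> nat_incl V T Y \<phi> \<phi> = unit_el (pow_graph V T Y) z \<phi>"
  unfolding unit_el_def
  by (simp only: assoc[OF bang_in[OF z] homD[OF Unt_exp(1)[OF \<phi>], unfolded exp_cat_simps] homD[OF nat_incl_in[OF YC nf_ot[OF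
      \<phi>] nf_ot[OF \<phi>]]]]
     Unt_exp(2)[OF \<phi>])

lemma nat_component_unit_el:
  assumes \<phi>: "\<phi> \<in> natural_functors V T Y" and z: "z \<in> Ob V" and s: "s \<in> Vert T"
  shows "nat_component Y \<phi> \<phi> (unit_el (exp_cat V T Y) z \<phi>) s = unit_el Y z (on_vert \<phi> s)"
  unfolding nat_component_def unit_el_exp_incl[OF \<phi> z] by (rule pow_component_unit_el[OF YG' nf_ot[OF \<phi>] z s])

text \<open>
  A composite of natural families is natural, by pasting two naturality squares.
\<close>

lemma Comps_exp:
  assumes \<phi>: "\<phi> \<in> natural_functors V T Y" and \<psi>: "\<psi> \<in> natural_functors V T Y" and \<chi>: "\<chi> \<in> natural_functors V T Y"
  shows "Comps (exp_cat V T Y) \<phi> \<psi> \<chi> \<in> hom (exp_cat V T Y) (nat_ob V T Y \<phi> \<psi> \<otimes> nat_ob V T Y \<psi> \<chi>) \<phi> \<chi>"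
    and "Comps (exp_cat V T Y) \<phi> \<psi> \<chi> \<cdot> nat_incl V T Y \<phi> \<chi> =
      (nat_incl V T Y \<phi> \<psi> \<odot> nat_incl V T Y \<psi> \<chi>) \<cdot> Comps (pow_cat V T Y) \<phi> \<psi> \<chi>" 
proof -
  note \<phi>' = nf_ot[OF \<phi>] and \<psi>' = nf_ot[OF \<psi>] and \<chi>' = nf_ot[OF \<chi>]
  let ?A = "nat_ob V T Y \<phi> \<psi>" and ?B = "nat_ob V T Y \<psi> \<chi>"
  let ?h = "(nat_incl V T Y \<phi> \<psi> \<odot> nat_incl V T Y \<psi> \<chi>) \<cdot> Comps (pow_cat V T Y) \<phi> \<psi> \<chi>"
  note i = homD[OF nat_incl_in[OF YC \<phi>' \<psi>']] and j = homD[OF nat_incl_in[OF YC \<psi>' \<chi>']]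
  note h = hom_comp[OF tensor_in[OF i j] Comps_pow(1)[OF YC \<phi>' \<psi>' \<chi>']]
  have e: "Comps (exp_cat V T Y) \<phi> \<psi> \<chi> = nat_lift V T Y \<phi> \<chi> (?A \<otimes> ?B) ?h"
    by (simp add: exp_cat_def)
  have n: "natural_at Y \<phi> \<chi> (?A \<otimes> ?B) ?h"
    unfolding natural_at_def
  proof (intro allI impI)
    fix w k s t \<tau> assume k: "k \<in> w \<leadsto> ?A \<otimes> ?B" and \<tau>: "\<tau> \<in> hom T w s t"
    obtain e e' where e: "e \<in> w \<leadsto> ?A" and e': "e' \<in> w \<leadsto> ?B" and kk: "k = pair w ?A ?B e e'"
      using pair_cases[OF k nat_ob[OF YC \<phi>' \<psi>'] nat_ob[OF YC \<psi>' \<chi>']] by metis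
    have E: "e \<in> hom (exp_cat V T Y) w \<phi> \<psi>" and E': "e' \<in> hom (exp_cat V T Y) w \<psi> \<chi>"
      using e e' \<phi> \<psi> \<chi> by (simp_all add: hom_def exp_cat_simps)
    have "k \<cdot> ?h = comp_el (pow_cat V T Y) w \<phi> \<psi> \<chi> (e \<cdot> nat_incl V T Y \<phi> \<psi>) (e' \<cdot> nat_incl V T Y \<psi> \<chi>)"
    proof -
      have "Edg (pow_cat V T Y) = Edg (pow_graph V T Y)" by (simp add: pow_cat_def)
      then show ?thesis unfolding comp_el_def kk
        by (simp only: assoc[OF pair_in[OF e e'] tensor_in[OF i j] homD[OF Comps_pow(1)[OF YC \<phi>' \<psi>' \<chi>']], symmetric]
          pair_tensor[OF e e' i j])
    qed
    then have c: "pow_component Y \<phi> \<chi> (k \<cdot> ?h) s = comp_el Y w (on_vert \<phi> s) (on_vert \<psi> s) (on_vert \<chi> s) (nat_component Y \<phi>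
        \<psi> e s) (nat_component Y \<psi> \<chi> e' s)"
      if "s \<in> Vert T" for s
      using pow_component_comp_el[OF YC exp_incl_hom[OF YC E] exp_incl_hom[OF YC E'] that] unfolding nat_component_def by
          simp
    note s = hom_vert(1)[OF \<tau>] and t = hom_vert(2)[OF \<tau>]
    note x = nat_component_in[OF YC E s] and x' = nat_component_in[OF YC E' s]
    note y = nat_component_in[OF YC E t] and y' = nat_component_in[OF YC E' t]
    note a = ot_act[OF YG' \<phi>' \<tau>] and b = ot_act[OF YG' \<psi>' \<tau>] and d = ot_act[OF YG' \<chi>' \<tau>]
    show "comp_el Y w (on_vert \<phi> s) (on_vert \<chi> s) (on_vert \<chi> t) (pow_component Y \<phi> \<chi> (k \<cdot> ?h) s) (\<tau> \<cdot> on_edge \<chi> s t) =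
      comp_el Y w (on_vert \<phi> s) (on_vert \<phi> t) (on_vert \<chi> t) (\<tau> \<cdot> on_edge \<phi> s t) (pow_component Y \<phi> \<chi> (k \<cdot> ?h) t)"
      by (simp only: c[OF s] c[OF t] comp_el_assoc[OF Y x x' d] nat_component_natural[OF YC E' \<tau>] comp_el_assoc[OF Y x b y',
          symmetric]
        nat_component_natural[OF YC E \<tau>] comp_el_assoc[OF Y a y y'])
  qed
  note l = exp_lift[OF YC \<phi> \<chi> h n]
  show "Comps (exp_cat V T Y) \<phi> \<psi> \<chi> \<in> hom (exp_cat V T Y) (?A \<otimes> ?B) \<phi> \<chi>"
    and "Comps (exp_cat V T Y) \<phi> \<psi> \<chi> \<cdot> nat_incl V T Y \<phi> \<chi> = ?h"
    unfolding e by (rule l(1), rule l(2))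
qed

lemma exp_composable: "composable (exp_cat V T Y)"
  unfolding composable_def
  using original_exp homD[OF Comps_exp(1)] by (simp add: exp_cat_simps)

lemma comp_el_exp_incl:
  assumes e: "e \<in> hom (exp_cat V T Y) z \<phi> \<psi>" and e': "e' \<in> hom (exp_cat V T Y) z \<psi> \<chi>"
  shows "comp_el (exp_cat V T Y) z \<phi> \<psi> \<chi> e e' \<cdot> nat_incl V T Y \<phi> \<chi> =
    comp_el (pow_cat V T Y) z \<phi> \<psi> \<chi> (e \<cdot> nat_incl V T Y \<phi> \<psi>) (e' \<cdot> nat_incl V T Y \<psi> \<chi>)"
proof -
  note v = hom_exp_vert[OF e] hom_exp_vert(2)[OF e'] 
  note v' = nf_ot[OF v(1)] nf_ot[OF v(2)] nf_ot[OF v(3)]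
  note i = homD[OF nat_incl_in[OF YC v'(1,2)]] and j = homD[OF nat_incl_in[OF YC v'(2,3)]] and k = homD[OF nat_incl_in[OF YC
      v'(1,3)]]
  note a = homD[OF e, unfolded exp_cat_simps] and b = homD[OF e', unfolded exp_cat_simps]
  have E: "Edg (pow_cat V T Y) = Edg (pow_graph V T Y)" by (simp add: pow_cat_def)
  show ?thesis unfolding comp_el_def E exp_cat_simps
    by (simp only: assoc[OF pair_in[OF a b] homD[OF Comps_exp(1)[OF v], unfolded exp_cat_simps] k] Comps_exp(2)[OF v]
       assoc[OF pair_in[OF a b] tensor_in[OF i j] homD[OF Comps_pow(1)[OF YC v']], symmetric]
          pair_tensor[OF a b i j])
qed

lemma nat_component_comp_el:
  assumes e: "e \<in> hom (exp_cat V T Y) z \<phi> \<psi>" and e': "e' \<in> hom (exp_cat V T Y) z \<psi> \<chi>" and s: "s \<in> Vert T"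
  shows "nat_component Y \<phi> \<chi> (comp_el (exp_cat V T Y) z \<phi> \<psi> \<chi> e e') s =
    comp_el Y z (on_vert \<phi> s) (on_vert \<psi> s) (on_vert \<chi> s) (nat_component Y \<phi> \<psi> e s) (nat_component Y \<psi> \<chi> e' s)"
  unfolding nat_component_def comp_el_exp_incl[OF e e'] by (rule pow_component_comp_el[OF YC exp_incl_hom[OF YC e]
      exp_incl_hom[OF YC e'] s])

lemma exp_enriched: "enriched V (exp_cat V T Y)"
  unfolding enriched_iff
proof (intro conjI allI impI)
  note E = exp_composable
  show "composable (exp_cat V T Y)" by (rule E)
  fix z \<phi> \<psi> \<chi> \<omega> f g h
  assume f: "f \<in> hom (exp_cat V T Y) z \<phi> \<psi>" and g: "g \<in> hom (exp_cat V T Y) z \<psi> \<chi>" and h: "h \<in> hom (exp_cat V T Y) z \<chi> \<omega>"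
  note fg = comp_el_in[OF E f g] and gh = comp_el_in[OF E g h]
  show "comp_el (exp_cat V T Y) z \<phi> \<chi> \<omega> (comp_el (exp_cat V T Y) z \<phi> \<psi> \<chi> f g) h =
     comp_el (exp_cat V T Y) z \<phi> \<psi> \<omega> f (comp_el (exp_cat V T Y) z \<psi> \<chi> \<omega> g h)"
  proof (rule nat_component_eqI[OF YC comp_el_in[OF E fg h] comp_el_in[OF E f gh]])
    fix s assume s: "s \<in> Vert T"
    show "nat_component Y \<phi> \<omega> (comp_el (exp_cat V T Y) z \<phi> \<chi> \<omega> (comp_el (exp_cat V T Y) z \<phi> \<psi> \<chi> f g) h) s =
     nat_component Y \<phi> \<omega> (comp_el (exp_cat V T Y) z \<phi> \<psi> \<omega> f (comp_el (exp_cat V T Y) z \<psi> \<chi> \<omega> g h)) s"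
     by (simp only: nat_component_comp_el[OF fg h s] nat_component_comp_el[OF f gh s] nat_component_comp_el[OF f g s]
         nat_component_comp_el[OF g h s]
       comp_el_assoc[OF Y nat_component_in[OF YC f s] nat_component_in[OF YC g s] nat_component_in[OF YC h s]])
  qed
next
  note E = exp_composable
  fix z \<phi> \<psi> f assume f: "f \<in> hom (exp_cat V T Y) z \<phi> \<psi>"
  note v = hom_vert[OF f] and v' = hom_exp_vert[OF f] and z = hom_ob[OF f]
  note u1 = unit_el_in[OF original_exp v(1) z] and u2 = unit_el_in[OF original_exp v(2) z]
  show "comp_el (exp_cat V T Y) z \<phi> \<phi> \<psi> (unit_el (exp_cat V T Y) z \<phi>) f = f"
  proof (rule nat_component_eqI[OF YC comp_el_in[OF E u1 f] f])
    fix s assume s: "s \<in> Vert T"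
    show "nat_component Y \<phi> \<psi> (comp_el (exp_cat V T Y) z \<phi> \<phi> \<psi> (unit_el (exp_cat V T Y) z \<phi>) f) s = nat_component Y \<phi> \<psi> f s"
      by (simp only: nat_component_comp_el[OF u1 f s] nat_component_unit_el[OF v'(1) z s] comp_el_unit_el_left[OF Y
          nat_component_in[OF YC f s]])
  qed
  show "comp_el (exp_cat V T Y) z \<phi> \<psi> \<psi> f (unit_el (exp_cat V T Y) z \<psi>) = f"
  proof (rule nat_component_eqI[OF YC comp_el_in[OF E f u2] f])
    fix s assume s: "s \<in> Vert T"
    show "nat_component Y \<phi> \<psi> (comp_el (exp_cat V T Y) z \<phi> \<psi> \<psi> f (unit_el (exp_cat V T Y) z \<psi>)) s = nat_component Y \<phi> \<psi> f s"
      by (simp only: nat_component_comp_el[OF f u2 s] nat_component_unit_el[OF v'(2) z s] comp_el_unit_el_right[OF Y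
          nat_component_in[OF YC f s]])
  qed
qed

lemma exp_incl_vert: "\<phi> \<in> natural_functors V T Y \<Longrightarrow> on_vert (exp_incl V T Y) \<phi> = \<phi>"
  by (simp add: exp_incl_def on_vert_mk)

lemma exp_incl_edge: "\<phi> \<in> natural_functors V T Y \<Longrightarrow> \<psi> \<in> natural_functors V T Y \<Longrightarrow>
    on_edge (exp_incl V T Y) \<phi> \<psi> = nat_incl V T Y \<phi> \<psi>"
  by (simp add: exp_incl_def on_edge_mk)

lemma exp_incl_nf: "exp_incl V T Y \<in> natural_functors V (exp_cat V T Y) (pow_cat V T Y)"
proof (rule nfI[OF exp_composable pow_composable[OF YC]])
  have "mk_transport (Vert (exp_cat V T Y)) (\<lambda>\<phi>. \<phi>) (nat_incl V T Y) \<in> original_transports V (exp_cat V T Y) (pow_graph V T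
      Y)"
  proof (rule otI[OF original_exp original_pow[OF YG']])
    show "\<phi> \<in> Vert (pow_graph V T Y)" if "\<phi> \<in> Vert (exp_cat V T Y)" for \<phi>
      using that nf_ot by (simp add: exp_cat_simps pow_graph_simps)
    show "nat_incl V T Y \<phi> \<psi> \<in> Edg (exp_cat V T Y) \<phi> \<psi> \<leadsto> Edg (pow_graph V T Y) \<phi> \<psi>"
      if "\<phi> \<in> Vert (exp_cat V T Y)" "\<psi> \<in> Vert (exp_cat V T Y)" for \<phi> \<psi>
      using homD[OF nat_incl_in[OF YC nf_ot nf_ot]] that by (simp add: exp_cat_simps)
    show "unit_el (exp_cat V T Y) z \<phi> \<cdot> nat_incl V T Y \<phi> \<phi> = unit_el (pow_graph V T Y) z \<phi>"
      if "\<phi> \<in> Vert (exp_cat V T Y)" "z \<in> Ob V" for \<phi> z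
      using unit_el_exp_incl that by (simp add: exp_cat_simps)
  qed
  then show "exp_incl V T Y \<in> original_transports V (exp_cat V T Y) (pow_cat V T Y)"
    by (simp add: exp_incl_def exp_cat_simps ot_pow_cat_target)
  fix z \<phi> \<psi> \<chi> a b assume a: "a \<in> hom (exp_cat V T Y) z \<phi> \<psi>" and b: "b \<in> hom (exp_cat V T Y) z \<psi> \<chi>"
  note v = hom_exp_vert[OF a] hom_exp_vert(2)[OF b]
  show "comp_el (exp_cat V T Y) z \<phi> \<psi> \<chi> a b \<cdot> on_edge (exp_incl V T Y) \<phi> \<chi> = comp_el (pow_cat V T Y) z
     (on_vert (exp_incl V T Y) \<phi>) (on_vert (exp_incl V T Y) \<psi>) (on_vert (exp_incl V T Y) \<chi>)
     (a \<cdot> on_edge (exp_incl V T Y) \<phi> \<psi>) (b \<cdot> on_edge (exp_incl V T Y) \<psi> \<chi>)"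
    by (simp only: exp_incl_vert[OF v(1)] exp_incl_vert[OF v(2)] exp_incl_vert[OF v(3)] exp_incl_edge[OF v(1,2)]
       exp_incl_edge[OF v(2,3)] exp_incl_edge[OF v(1,3)] comp_el_exp_incl[OF a b])
qed

end

section \<open>Change of target space\<close>

lemma exp_transport_vert: "\<phi> \<in> natural_functors V T X \<Longrightarrow>
   on_vert (exp_transport V T X Y f) \<phi> = followed_by V T \<phi> f"
  by (simp add: exp_transport_def on_vert_mk)

context
  fixes X :: "('x, 'o, 'm) vcat" and Y :: "('y, 'o, 'm) vcat" and f :: "('x, 'y, 'm) transport"
  assumes X: "enriched V X" and Y: "enriched V Y" and f: "f \<in> natural_functors V X Y"
begin

lemma XC: "composable X" and YC': "composable Y" and XG: "original_graph V X" and YG'': "original_graph V Y"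
  and fo: "f \<in> original_transports V X Y"
  by (rule enriched_composable[OF X] enriched_composable[OF Y] enriched_graph[OF X] enriched_graph[OF Y] nf_ot[OF f])+

text \<open>
  A functor \<open>f\<close> preserves both composites of a naturality square, so it sends natural families to
  natural families.
\<close>

lemma exp_transport_edge:
  assumes \<phi>: "\<phi> \<in> natural_functors V T X" and \<psi>: "\<psi> \<in> natural_functors V T X"
  shows "on_edge (exp_transport V T X Y f) \<phi> \<psi> \<in> hom (exp_cat V T Y) (nat_ob V T X \<phi> \<psi>) (followed_by V T \<phi> f) (followed_by V
      T \<psi> f)"
    and "on_edge (exp_transport V T X Y f) \<phi> \<psi> \<cdot> nat_incl V T Y (followed_by V T \<phi> f) (followed_by V T \<psi> f) =
      nat_incl V T X \<phi> \<psi> \<cdot> on_edge (pow_transport V T X Y f) \<phi> \<psi>"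
proof -
  note \<phi>' = nf_ot[OF \<phi>] and \<psi>' = nf_ot[OF \<psi>]
  let ?\<phi> = "followed_by V T \<phi> f" and ?\<psi> = "followed_by V T \<psi> f" and ?z = "nat_ob V T X \<phi> \<psi>"
  let ?h = "nat_incl V T X \<phi> \<psi> \<cdot> on_edge (pow_transport V T X Y f) \<phi> \<psi>"
  have e: "on_edge (exp_transport V T X Y f) \<phi> \<psi> = nat_lift V T Y ?\<phi> ?\<psi> ?z ?h"
    using \<phi> \<psi> by (simp add: exp_transport_def on_edge_mk)
  note fb = followed_by_nf[OF T_comp XC YC' \<phi> f] followed_by_nf[OF T_comp XC YC' \<psi> f]
  note i = nat_incl_in[OF XC \<phi>' \<psi>'] and p = pow_transport_edge(1)[OF XG YG'' fo \<phi>' \<psi>']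
  note h = hom_comp[OF homD[OF i] p]
  have n: "natural_at Y ?\<phi> ?\<psi> ?z ?h"
    unfolding natural_at_def
  proof (intro allI impI)
    fix w k s t \<tau> assume k: "k \<in> w \<leadsto> ?z" and \<tau>: "\<tau> \<in> hom T w s t"
    note s = hom_vert(1)[OF \<tau>] and t = hom_vert(2)[OF \<tau>]
    have E: "k \<in> hom (exp_cat V T X) w \<phi> \<psi>" using k \<phi> \<psi> by (simp add: hom_def exp_cat_simps)
    have c: "pow_component Y ?\<phi> ?\<psi> (k \<cdot> ?h) r = nat_component X \<phi> \<psi> k r \<cdot> on_edge f (on_vert \<phi> r) (on_vert \<psi> r)" if r: "r \<in>
        Vert T" for r
      unfolding nat_component_def
      by (simp only: assoc[OF k homD[OF i] homD[OF p], symmetric] pow_component_pow_transport[OF XG YG'' fo exp_incl_hom[OF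
          XC E] r])
    note a = nat_component_in[OF XC E s] and b = nat_component_in[OF XC E t] and c1 = ot_act[OF XG \<phi>' \<tau>] and d = ot_act[OF
        XG \<psi>' \<tau>]
    show "comp_el Y w (on_vert ?\<phi> s) (on_vert ?\<psi> s) (on_vert ?\<psi> t) (pow_component Y ?\<phi> ?\<psi> (k \<cdot> ?h) s) (\<tau> \<cdot> on_edge ?\<psi> s t) =
      comp_el Y w (on_vert ?\<phi> s) (on_vert ?\<phi> t) (on_vert ?\<psi> t) (\<tau> \<cdot> on_edge ?\<phi> s t) (pow_component Y ?\<phi> ?\<psi> (k \<cdot> ?h) t)"
      by (simp only: c[OF s] c[OF t] followed_by_act[OF XG YG'' \<phi>' fo \<tau>] followed_by_act[OF XG YG'' \<psi>' fo \<tau>]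
        followed_by_vert[OF s] followed_by_vert[OF t] nf_comp_el[OF XC YC' f a d, symmetric] nf_comp_el[OF XC YC' f c1 b,
            symmetric]
        nat_component_natural[OF XC E \<tau>])
  qed
  note l = exp_lift[OF YC' fb h n]
  show "on_edge (exp_transport V T X Y f) \<phi> \<psi> \<in> hom (exp_cat V T Y) ?z ?\<phi> ?\<psi>"
    "on_edge (exp_transport V T X Y f) \<phi> \<psi> \<cdot> nat_incl V T Y ?\<phi> ?\<psi> = ?h"
    unfolding e by (rule l(1), rule l(2))
qed

lemma exp_transport_incl:
  assumes e: "e \<in> hom (exp_cat V T X) z \<phi> \<psi>"
  shows "e \<cdot> on_edge (exp_transport V T X Y f) \<phi> \<psi> \<cdot> nat_incl V T Y (followed_by V T \<phi> f) (followed_by V T \<psi> f) =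
    e \<cdot> nat_incl V T X \<phi> \<psi> \<cdot> on_edge (pow_transport V T X Y f) \<phi> \<psi>"
proof -
  note v = hom_exp_vert[OF e] note v' = nf_ot[OF v(1)] nf_ot[OF v(2)]
  note fb = followed_by_nf[OF T_comp XC YC' v(1) f] followed_by_nf[OF T_comp XC YC' v(2) f]
  note i = homD[OF nat_incl_in[OF XC v']] and p = homD[OF pow_transport_edge(1)[OF XG YG'' fo v']]
  note q = homD[OF exp_transport_edge(1)[OF v], unfolded exp_cat_simps] and j = homD[OF nat_incl_in[OF YC' nf_ot[OF fb(1)]
      nf_ot[OF fb(2)]]]
  show ?thesis
    by (simp only: assoc[OF homD[OF e, unfolded exp_cat_simps] q j] exp_transport_edge(2)[OF v] assoc[OF homD[OF e, unfolded
        exp_cat_simps] i p])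
qed

lemma nat_component_exp_transport:
  assumes e: "e \<in> hom (exp_cat V T X) z \<phi> \<psi>" and s: "s \<in> Vert T"
  shows "nat_component Y (followed_by V T \<phi> f) (followed_by V T \<psi> f) (e \<cdot> on_edge (exp_transport V T X Y f) \<phi> \<psi>) s =
    nat_component X \<phi> \<psi> e s \<cdot> on_edge f (on_vert \<phi> s) (on_vert \<psi> s)"
  unfolding nat_component_def exp_transport_incl[OF e]
  by (rule pow_component_pow_transport[OF XG YG'' fo exp_incl_hom[OF XC e] s])

lemma exp_transport_ot: "exp_transport V T X Y f \<in> original_transports V (exp_cat V T X) (exp_cat V T Y)"
proof -
  let ?v = "\<lambda>\<phi>. followed_by V T \<phi> f" and ?g = "exp_transport V T X Y f"
  have "mk_transport (Vert (exp_cat V T X)) ?v (on_edge ?g) \<in> original_transports V (exp_cat V T X) (exp_cat V T Y)"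
  proof (rule otI[OF original_exp[OF X] original_exp[OF Y]])
    show 1: "?v \<phi> \<in> Vert (exp_cat V T Y)" if "\<phi> \<in> Vert (exp_cat V T X)" for \<phi>
      using that followed_by_nf[OF T_comp XC YC' _ f] by (simp add: exp_cat_simps)
    show 2: "on_edge ?g \<phi> \<psi> \<in> Edg (exp_cat V T X) \<phi> \<psi> \<leadsto> Edg (exp_cat V T Y) (?v \<phi>) (?v \<psi>)"
      if "\<phi> \<in> Vert (exp_cat V T X)" "\<psi> \<in> Vert (exp_cat V T X)" for \<phi> \<psi>
      using homD[OF exp_transport_edge(1)] that by (simp add: exp_cat_simps)
    show "unit_el (exp_cat V T X) z \<phi> \<cdot> on_edge ?g \<phi> \<phi> = unit_el (exp_cat V T Y) z (?v \<phi>)"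
      if \<phi>: "\<phi> \<in> Vert (exp_cat V T X)" and z: "z \<in> Ob V" for \<phi> z
    proof (rule nat_component_eqI[OF YC'])
      note u = unit_el_in[OF original_exp[OF X] \<phi> z]
      note \<phi>' = \<phi>[unfolded exp_cat_simps]
      show "unit_el (exp_cat V T X) z \<phi> \<cdot> on_edge ?g \<phi> \<phi> \<in> hom (exp_cat V T Y) z (?v \<phi>) (?v \<phi>)"
        by (rule homI[OF 1[OF \<phi>] 1[OF \<phi>] comp_in[OF homD[OF u] 2[OF \<phi> \<phi>]]])
      show "unit_el (exp_cat V T Y) z (?v \<phi>) \<in> hom (exp_cat V T Y) z (?v \<phi>) (?v \<phi>)"
        by (rule unit_el_in[OF original_exp[OF Y] 1[OF \<phi>] z])
      show "nat_component Y (?v \<phi>) (?v \<phi>) (unit_el (exp_cat V T X) z \<phi> \<cdot> on_edge ?g \<phi> \<phi>) s =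
         nat_component Y (?v \<phi>) (?v \<phi>) (unit_el (exp_cat V T Y) z (?v \<phi>)) s" if s: "s \<in> Vert T" for s
        by (simp only: nat_component_exp_transport[OF u s] nat_component_unit_el[OF X \<phi>' z s] ot_unit_el[OF XG YG'' fo
            ot_vert[OF nf_ot[OF \<phi>'] s] z]
          nat_component_unit_el[OF Y followed_by_nf[OF T_comp XC YC' \<phi>' f] z s] followed_by_vert[OF s])
    qed
  qed
  moreover have "mk_transport (Vert (exp_cat V T X)) ?v (on_edge ?g) = ?g"
    unfolding exp_transport_def exp_cat_simps by (rule mk_transport_cong) (simp_all add: on_edge_mk)
  ultimately show ?thesis by simp
qed

lemma exp_transport_nf: "exp_transport V T X Y f \<in> natural_functors V (exp_cat V T X) (exp_cat V T Y)"
proof (rule nfI[OF exp_composable[OF X] exp_composable[OF Y] exp_transport_ot])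
  let ?g = "exp_transport V T X Y f"
  fix z \<phi> \<psi> \<chi> a b assume a: "a \<in> hom (exp_cat V T X) z \<phi> \<psi>" and b: "b \<in> hom (exp_cat V T X) z \<psi> \<chi>"
  note c = comp_el_in[OF exp_composable[OF X] a b]
  note v = hom_exp_vert[OF a] hom_exp_vert(2)[OF b]
  note g = exp_transport_ot and PY = original_exp[OF Y]
  note ga = ot_act[OF PY g a] and gb = ot_act[OF PY g b] and gc = ot_act[OF PY g c]
  note gab = comp_el_in[OF exp_composable[OF Y] ga gb]
  show "comp_el (exp_cat V T X) z \<phi> \<psi> \<chi> a b \<cdot> on_edge ?g \<phi> \<chi> =
    comp_el (exp_cat V T Y) z (on_vert ?g \<phi>) (on_vert ?g \<psi>) (on_vert ?g \<chi>) (a \<cdot> on_edge ?g \<phi> \<psi>) (b \<cdot> on_edge ?g \<psi> \<chi>)"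
  proof (rule nat_component_eqI[OF YC' gc gab])
    fix s assume s: "s \<in> Vert T"
    note pa = nat_component_in[OF XC a s] and pb = nat_component_in[OF XC b s]
    show "nat_component Y (on_vert ?g \<phi>) (on_vert ?g \<chi>) (comp_el (exp_cat V T X) z \<phi> \<psi> \<chi> a b \<cdot> on_edge ?g \<phi> \<chi>) s =
     nat_component Y (on_vert ?g \<phi>) (on_vert ?g \<chi>) (comp_el (exp_cat V T Y) z (on_vert ?g \<phi>) (on_vert ?g \<psi>) (on_vert ?g \<chi>)
         (a \<cdot> on_edge ?g \<phi> \<psi>) (b \<cdot> on_edge ?g \<psi> \<chi>)) s"
      unfolding nat_component_comp_el[OF Y ga gb s]
      unfolding exp_transport_vert[OF v(1)] exp_transport_vert[OF v(2)] exp_transport_vert[OF v(3)]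
      by (simp only: nat_component_exp_transport[OF a s] nat_component_exp_transport[OF b s] nat_component_exp_transport[OF
          c s]
        nat_component_comp_el[OF X a b s] nf_comp_el[OF XC YC' f pa pb] followed_by_vert[OF s])
  qed
qed

lemma exp_transport_restricts:
  "followed_by V (exp_cat V T X) (exp_transport V T X Y f) (exp_incl V T Y) =
   followed_by V (exp_cat V T X) (exp_incl V T X) (pow_transport V T X Y f)"
proof -
  note PX = original_pow[OF XG] and PY = original_pow[OF YG''] and EX = original_exp[OF X] and EY = original_exp[OF Y]
  note iX = nf_ot[OF exp_incl_nf[OF X], unfolded ot_pow_cat_target] and iY = nf_ot[OF exp_incl_nf[OF Y], unfolded
      ot_pow_cat_target]
  note g = exp_transport_ot and p = pow_transport_ot[OF XG YG'' fo]
  show ?thesis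
  proof (rule ot_eqI[OF EX PY followed_by_ot[OF EX EY PY g iY] followed_by_ot[OF EX PX PY iX p]])
    fix \<phi> assume "\<phi> \<in> Vert (exp_cat V T X)"
    then show "on_vert (followed_by V (exp_cat V T X) (exp_transport V T X Y f) (exp_incl V T Y)) \<phi> =
       on_vert (followed_by V (exp_cat V T X) (exp_incl V T X) (pow_transport V T X Y f)) \<phi>"
      using followed_by_nf[OF T_comp XC YC' _ f]
      by (simp add: followed_by_vert exp_cat_simps exp_transport_vert exp_incl_vert[OF X] exp_incl_vert[OF Y]
          pow_transport_vert[OF nf_ot])
  next
    fix z \<phi> \<psi> a assume a: "a \<in> hom (exp_cat V T X) z \<phi> \<psi>"
    note v = hom_exp_vert[OF a]
    note fb = followed_by_nf[OF T_comp XC YC' v(1) f] followed_by_nf[OF T_comp XC YC' v(2) f]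
    show "a \<cdot> on_edge (followed_by V (exp_cat V T X) (exp_transport V T X Y f) (exp_incl V T Y)) \<phi> \<psi> =
       a \<cdot> on_edge (followed_by V (exp_cat V T X) (exp_incl V T X) (pow_transport V T X Y f)) \<phi> \<psi>"
      by (simp only: followed_by_act[OF EY PY g iY a] followed_by_act[OF PX PY iX p a] exp_transport_vert[OF v(1)]
        exp_transport_vert[OF v(2)] exp_incl_edge[OF Y fb] exp_incl_vert[OF X v(1)] exp_incl_vert[OF X v(2)]
            exp_incl_edge[OF X v]
        exp_transport_incl[OF a])
  qed
qed

end

lemma exp_transport_id:
  assumes Y: "enriched V Y"
  shows "exp_transport V T Y Y (id_transport V Y) = id_transport V (exp_cat V T Y)"
proof -
  note C = enriched_composable[OF Y] and G = enriched_graph[OF Y] and E = original_exp[OF Y]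
  note i = id_nf[OF C]
  have fb: "followed_by V T \<phi> (id_transport V Y) = \<phi>" if "\<phi> \<in> natural_functors V T Y" for \<phi>
    by (rule followed_by_id_right[OF T_graph G nf_ot[OF that]])
  note g = exp_transport_ot[OF Y Y i]
  show ?thesis
  proof (rule ot_eqI[OF E E g id_ot[OF E]])
    show "on_vert (exp_transport V T Y Y (id_transport V Y)) \<phi> = on_vert (id_transport V (exp_cat V T Y)) \<phi>"
      if "\<phi> \<in> Vert (exp_cat V T Y)" for \<phi>
      using that fb by (simp add: exp_cat_simps exp_transport_vert id_transport_vert)
    fix z \<phi> \<psi> a assume a: "a \<in> hom (exp_cat V T Y) z \<phi> \<psi>"
    note v = hom_exp_vert[OF a]
    have "a \<cdot> on_edge (exp_transport V T Y Y (id_transport V Y)) \<phi> \<psi> = a"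
    proof (rule nat_component_eqI[OF C _ a])
      show "a \<cdot> on_edge (exp_transport V T Y Y (id_transport V Y)) \<phi> \<psi> \<in> hom (exp_cat V T Y) z \<phi> \<psi>"
        using ot_act[OF E g a] by (simp only: exp_transport_vert[OF v(1)] exp_transport_vert[OF v(2)] fb[OF v(1)] fb[OF
            v(2)])
      show "nat_component Y \<phi> \<psi> (a \<cdot> on_edge (exp_transport V T Y Y (id_transport V Y)) \<phi> \<psi>) s = nat_component Y \<phi> \<psi> a s"
        if s: "s \<in> Vert T" for s
        using nat_component_exp_transport[OF Y Y i a s] by (simp only: fb[OF v(1)] fb[OF v(2)] id_act[OF nat_component_in[OF
            C a s]])
    qed
    then show "a \<cdot> on_edge (exp_transport V T Y Y (id_transport V Y)) \<phi> \<psi> = a \<cdot> on_edge (id_transport V (exp_cat V T Y)) \<phi>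
        \<psi>"
      by (simp only: id_act[OF a])
  qed
qed

lemma exp_transport_followed_by:
  assumes X: "enriched V X" and Y: "enriched V Y" and Z: "enriched V Z"
    and f: "f \<in> natural_functors V X Y" and h: "h \<in> natural_functors V Y Z"
  shows "exp_transport V T X Z (followed_by V X f h) =
    followed_by V (exp_cat V T X) (exp_transport V T X Y f) (exp_transport V T Y Z h)"
proof -
  note XC = enriched_composable[OF X] and YC = enriched_composable[OF Y] and ZC = enriched_composable[OF Z]
  note XG = enriched_graph[OF X] and YG = enriched_graph[OF Y] and ZG = enriched_graph[OF Z]
  note EX = original_exp[OF X] and EY = original_exp[OF Y] and EZ = original_exp[OF Z]
  note fh = followed_by_nf[OF XC YC ZC f h]
  note gf = exp_transport_ot[OF X Y f] and gh = exp_transport_ot[OF Y Z h] and gfh = exp_transport_ot[OF X Z fh]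
  have as: "followed_by V T \<phi> (followed_by V X f h) = followed_by V T (followed_by V T \<phi> f) h"
    if "\<phi> \<in> natural_functors V T X" for \<phi>
    by (rule followed_by_assoc[OF T_graph XG YG ZG nf_ot[OF that] nf_ot[OF f] nf_ot[OF h], symmetric])
  note fb = followed_by_nf[OF T_comp XC YC _ f]
  show ?thesis
  proof (rule ot_eqI[OF EX EZ gfh followed_by_ot[OF EX EY EZ gf gh]])
    show "on_vert (exp_transport V T X Z (followed_by V X f h)) \<phi> =
       on_vert (followed_by V (exp_cat V T X) (exp_transport V T X Y f) (exp_transport V T Y Z h)) \<phi>"
      if "\<phi> \<in> Vert (exp_cat V T X)" for \<phi>
      using that as fb by (simp add: exp_cat_simps exp_transport_vert followed_by_vert)
    fix z \<phi> \<psi> a assume a: "a \<in> hom (exp_cat V T X) z \<phi> \<psi>"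
    note v = hom_exp_vert[OF a]
    note m = ot_act[OF EY gf a]
    note vm = exp_transport_vert[OF v(1)] exp_transport_vert[OF v(2)]
    note m' = m[unfolded vm]
    note vv = exp_transport_vert[OF fb[OF v(1)]] exp_transport_vert[OF fb[OF v(2)]]
    show "a \<cdot> on_edge (exp_transport V T X Z (followed_by V X f h)) \<phi> \<psi> =
      a \<cdot> on_edge (followed_by V (exp_cat V T X) (exp_transport V T X Y f) (exp_transport V T Y Z h)) \<phi> \<psi>"
      unfolding followed_by_act[OF EY EZ gf gh a] vm
    proof (rule nat_component_eqI[OF ZC])
      show "a \<cdot> on_edge (exp_transport V T X Z (followed_by V X f h)) \<phi> \<psi> \<in>
         hom (exp_cat V T Z) z (followed_by V T (followed_by V T \<phi> f) h) (followed_by V T (followed_by V T \<psi> f) h)"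
        using ot_act[OF EZ gfh a] by (simp only: exp_transport_vert[OF v(1)] exp_transport_vert[OF v(2)] as[OF v(1)] as[OF
            v(2)])
      show "a \<cdot> on_edge (exp_transport V T X Y f) \<phi> \<psi> \<cdot> on_edge (exp_transport V T Y Z h) (followed_by V T \<phi> f) (followed_by
          V T \<psi> f) \<in>
         hom (exp_cat V T Z) z (followed_by V T (followed_by V T \<phi> f) h) (followed_by V T (followed_by V T \<psi> f) h)"
        using ot_act[OF EZ gh m'] by (simp only: vv)
      fix s assume s: "s \<in> Vert T"
      show "nat_component Z (followed_by V T (followed_by V T \<phi> f) h) (followed_by V T (followed_by V T \<psi> f) h)
         (a \<cdot> on_edge (exp_transport V T X Z (followed_by V X f h)) \<phi> \<psi>) s =
        nat_component Z (followed_by V T (followed_by V T \<phi> f) h) (followed_by V T (followed_by V T \<psi> f) h)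
         (a \<cdot> on_edge (exp_transport V T X Y f) \<phi> \<psi> \<cdot> on_edge (exp_transport V T Y Z h) (followed_by V T \<phi> f) (followed_by V
             T \<psi> f)) s"
        using nat_component_exp_transport[OF X Z fh a s]
        by (simp only: as[OF v(1)] as[OF v(2)] nat_component_exp_transport[OF Y Z h m' s] nat_component_exp_transport[OF X Y
            f a s]
          followed_by_act[OF YG ZG nf_ot[OF f] nf_ot[OF h] nat_component_in[OF XC a s]] followed_by_vert[OF s])
    qed
  qed
qed

section \<open>Tensoring with a fixed category as a functor\<close>

lemma ten_id_vert: "x \<in> Vert X \<Longrightarrow> s \<in> Vert T \<Longrightarrow> on_vert (ten_id V X T f) (x, s) = (on_vert f x, s)"
  by (simp add: ten_transport_vert id_transport_vert)

lemma ten_id_act: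
  assumes Y: "original_graph V Y" and f: "f \<in> original_transports V X Y"
    and a: "a \<in> hom X z x y" and \<tau>: "\<tau> \<in> hom T z s t"
  shows "pair z (Edg X x y) (Edg T s t) a \<tau> \<cdot> on_edge (ten_id V X T f) (x, s) (y, t) =
     pair z (Edg Y (on_vert f x) (on_vert f y)) (Edg T s t) (a \<cdot> on_edge f x y) \<tau>"
  using ten_transport_act[OF Y T_graph f id_ot[OF T_graph] a \<tau>]
  by (simp only: id_act[OF \<tau>] id_transport_vert[OF hom_vert(1)[OF \<tau>]] id_transport_vert[OF hom_vert(2)[OF \<tau>]])

lemma ten_id_ot:
  assumes "original_graph V X" "original_graph V Y" "f \<in> original_transports V X Y"
  shows "ten_id V X T f \<in> original_transports V (ten_graph V X T) (ten_graph V Y T)"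
  by (rule ten_transport_ot[OF assms(1) T_graph assms(2) T_graph assms(3) id_ot[OF T_graph]])

lemma ten_eqI:
  assumes X: "original_graph V X" and W: "original_graph V W"
    and f: "f \<in> original_transports V (ten_graph V X T) W" and g: "g \<in> original_transports V (ten_graph V X T) W"
    and v: "\<And>x s. x \<in> Vert X \<Longrightarrow> s \<in> Vert T \<Longrightarrow> on_vert f (x, s) = on_vert g (x, s)"
    and e: "\<And>z x y s t a \<tau>. a \<in> hom X z x y \<Longrightarrow> \<tau> \<in> hom T z s t \<Longrightarrow>
       pair z (Edg X x y) (Edg T s t) a \<tau> \<cdot> on_edge f (x, s) (y, t) =
       pair z (Edg X x y) (Edg T s t) a \<tau> \<cdot> on_edge g (x, s) (y, t)"
  shows "f = g"
proof (rule ot_eqI[OF original_ten[OF X T_graph] W f g])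
  show "on_vert f p = on_vert g p" if "p \<in> Vert (ten_graph V X T)" for p
    using that v by (auto simp: ten_graph_simps(1))
  show "u \<cdot> on_edge f p q = u \<cdot> on_edge g p q" if "u \<in> hom (ten_graph V X T) z p q" for z p q u
    using ten_cases[OF X T_graph that] e by metis
qed

lemma ten_id_nf:
  assumes X: "composable X" and Y: "composable Y" and f: "f \<in> natural_functors V X Y"
  shows "ten_id V X T f \<in> natural_functors V (ten_cat V X T) (ten_cat V Y T)"
proof (rule nfI[OF ten_composable[OF X T_comp] ten_composable[OF Y T_comp]])
  note XG = composable_graph[OF X] and YG = composable_graph[OF Y] and fo = nf_ot[OF f]
  show "ten_id V X T f \<in> original_transports V (ten_cat V X T) (ten_cat V Y T)"
    unfolding ot_ten_cat_source ot_ten_cat_target by (rule ten_id_ot[OF XG YG fo])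
  fix z p q r u v assume u: "u \<in> hom (ten_cat V X T) z p q" and v: "v \<in> hom (ten_cat V X T) z q r"
  obtain x s y t a \<tau> where 1: "p = (x, s)" "q = (y, t)" and a: "a \<in> hom X z x y" and \<tau>: "\<tau> \<in> hom T z s t"
    and u': "u = pair z (Edg X x y) (Edg T s t) a \<tau>"
    using ten_cases[OF XG T_graph u[unfolded hom_ten_cat]] by metis
  obtain w o' b \<sigma> where 2: "r = (w, o')" and b: "b \<in> hom X z y w" and \<sigma>: "\<sigma> \<in> hom T z t o'"
    and v': "v = pair z (Edg X y w) (Edg T t o') b \<sigma>"
    using ten_cases[OF XG T_graph v[unfolded hom_ten_cat]] 1 by (metis prod.inject)
  note act = ten_id_act[OF YG fo]
  show "comp_el (ten_cat V X T) z p q r u v \<cdot> on_edge (ten_id V X T f) p r =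
    comp_el (ten_cat V Y T) z (on_vert (ten_id V X T f) p) (on_vert (ten_id V X T f) q) (on_vert (ten_id V X T f) r)
      (u \<cdot> on_edge (ten_id V X T f) p q) (v \<cdot> on_edge (ten_id V X T f) q r)"
    unfolding 1 2 u' v'
    by (simp only: ten_comp_el[OF X T_comp a b \<tau> \<sigma>] act[OF a \<tau>] act[OF b \<sigma>] act[OF comp_el_in[OF X a b] comp_el_in[OF T_comp
        \<tau> \<sigma>]]
      nf_comp_el[OF X Y f a b] ten_comp_el[OF Y T_comp ot_act[OF YG fo a] ot_act[OF YG fo b] \<tau> \<sigma>]
      ten_id_vert[OF hom_vert(1)[OF a] hom_vert(1)[OF \<tau>]] ten_id_vert[OF hom_vert(1)[OF b] hom_vert(1)[OF \<sigma>]]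
      ten_id_vert[OF hom_vert(2)[OF b] hom_vert(2)[OF \<sigma>]])
qed

lemma id_ten_cat: "id_transport V (ten_cat V X T) = id_transport V (ten_graph V X T)"
  by (simp add: id_transport_def ten_cat_def)

lemma followed_by_ten_cat: "followed_by V (ten_cat V X T) = followed_by V (ten_graph V X T)"
  by (simp add: followed_by_def ten_cat_def fun_eq_iff)

lemma ten_id_id:
  assumes X: "original_graph V X"
  shows "ten_id V X T (id_transport V X) = id_transport V (ten_graph V X T)"
proof (rule ten_eqI[OF X original_ten[OF X T_graph] ten_id_ot[OF X X id_ot[OF X]] id_ot[OF original_ten[OF X T_graph]]])
  show "on_vert (ten_id V X T (id_transport V X)) (x, s) = on_vert (id_transport V (ten_graph V X T)) (x, s)"
    if "x \<in> Vert X" "s \<in> Vert T" for x s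
    using that by (simp add: ten_id_vert id_transport_vert ten_graph_simps(1))
  fix z x y s t a \<tau> assume a: "a \<in> hom X z x y" and \<tau>: "\<tau> \<in> hom T z s t"
  show "pair z (Edg X x y) (Edg T s t) a \<tau> \<cdot> on_edge (ten_id V X T (id_transport V X)) (x, s) (y, t) =
     pair z (Edg X x y) (Edg T s t) a \<tau> \<cdot> on_edge (id_transport V (ten_graph V X T)) (x, s) (y, t)"
    by (simp only: ten_id_act[OF X id_ot[OF X] a \<tau>] id_act[OF ten_pair_in[OF X T_graph a \<tau>]] id_act[OF a]
      id_transport_vert[OF hom_vert(1)[OF a]] id_transport_vert[OF hom_vert(2)[OF a]])
qed

lemma ten_id_followed_by:
  assumes X: "original_graph V X" and Y: "original_graph V Y" and Z: "original_graph V Z"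
    and g: "g \<in> original_transports V X Y" and h: "h \<in> original_transports V Y Z"
  shows "ten_id V X T (followed_by V X g h) =
     followed_by V (ten_graph V X T) (ten_id V X T g) (ten_id V Y T h)"
proof -
  note XT = original_ten[OF X T_graph] and YT = original_ten[OF Y T_graph] and ZT = original_ten[OF Z T_graph]
  note g' = ten_id_ot[OF X Y g] and h' = ten_id_ot[OF Y Z h] and gh = followed_by_ot[OF X Y Z g h]
  show ?thesis
  proof (rule ten_eqI[OF X ZT ten_id_ot[OF X Z gh] followed_by_ot[OF XT YT ZT g' h']])
    show "on_vert (ten_id V X T (followed_by V X g h)) (x, s) =
        on_vert (followed_by V (ten_graph V X T) (ten_id V X T g) (ten_id V Y T h)) (x, s)"
      if "x \<in> Vert X" "s \<in> Vert T" for x s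
      using that ot_vert[OF g that(1)] by (simp add: ten_id_vert followed_by_vert ten_graph_simps(1))
    fix z x y s t a \<tau> assume a: "a \<in> hom X z x y" and \<tau>: "\<tau> \<in> hom T z s t"
    note v = hom_vert[OF a] hom_vert[OF \<tau>]
    show "pair z (Edg X x y) (Edg T s t) a \<tau> \<cdot> on_edge (ten_id V X T (followed_by V X g h)) (x, s) (y, t) =
       pair z (Edg X x y) (Edg T s t) a \<tau> \<cdot> on_edge (followed_by V (ten_graph V X T) (ten_id V X T g) (ten_id V Y T h)) (x,
           s) (y, t)"
      by (simp only: ten_id_act[OF Z gh a \<tau>] followed_by_act[OF YT ZT g' h' ten_pair_in[OF X T_graph a \<tau>]]
        ten_id_act[OF Y g a \<tau>] ten_id_vert[OF v(1,3)] ten_id_vert[OF v(2,4)] ten_id_act[OF Z h ot_act[OF Y g a] \<tau>]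
        followed_by_act[OF Y Z g h a] followed_by_vert[OF v(1)] followed_by_vert[OF v(2)])
  qed
qed

section \<open>Sections\<close>

lemma section_at_vert: "s \<in> Vert T \<Longrightarrow> on_vert (section_at V X T x) s = (x, s)"
  by (simp add: section_at_def on_vert_mk)

lemma sections_pow_vert: "x \<in> Vert X \<Longrightarrow> on_vert (sections_pow V T X) x = section_at V X T x"
  by (simp add: sections_pow_def on_vert_mk)

context
  fixes X :: "('x, 'o, 'm, 'd) ovgraph_scheme"
  assumes X: "original_graph V X"
begin

lemma section_at_edge:
  assumes x: "x \<in> Vert X" and s: "s \<in> Vert T" and t: "t \<in> Vert T"
  shows "lun_inv V (Edg T s t) \<cdot> (Unt X x \<odot> Idn V (Edg T s t)) \<in> Edg T s t \<leadsto> Edg X x x \<otimes> Edg T s t"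
  by (rule comp_in[OF lun_inv_in tensor_in[OF Unt_in[OF X x] id_in]]) (rule Edg_ob[OF T_graph s t])+

lemma section_at_act:
  assumes x: "x \<in> Vert X" and \<tau>: "\<tau> \<in> hom T z s t"
  shows "\<tau> \<cdot> on_edge (section_at V X T x) s t = pair z (Edg X x x) (Edg T s t) (unit_el X z x) \<tau>"
proof -
  note v = hom_vert[OF \<tau>] and z = hom_ob[OF \<tau>]
  note E = Edg_ob[OF T_graph v] and b = bang_in[OF z] and \<tau>' = homD[OF \<tau>]
  have e: "on_edge (section_at V X T x) s t = lun_inv V (Edg T s t) \<cdot> (Unt X x \<odot> Idn V (Edg T s t))"
    using v by (simp add: section_at_def on_edge_mk)
  show ?thesis unfolding e unit_el_def
    by (simp only: assoc[OF \<tau>' lun_inv_in[OF E] tensor_in[OF Unt_in[OF X x] id_in[OF E]], symmetric]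
       comp_lun_inv[OF \<tau>'] pair_tensor[OF b \<tau>' Unt_in[OF X x] id_in[OF E]] id_right[OF \<tau>'])
qed

lemma section_at_ot:
  assumes x: "x \<in> Vert X"
  shows "section_at V X T x \<in> original_transports V T (ten_graph V X T)"
  unfolding section_at_def
proof (rule otI[OF T_graph original_ten[OF X T_graph]])
  show "(x, s) \<in> Vert (ten_graph V X T)" if "s \<in> Vert T" for s using that x by (simp add: ten_graph_simps)
  show "lun_inv V (Edg T s t) \<cdot> (Unt X x \<odot> Idn V (Edg T s t)) \<in> Edg T s t \<leadsto> Edg (ten_graph V X T) (x, s) (x, t)"
    if "s \<in> Vert T" "t \<in> Vert T" for s t
    unfolding ten_graph_simps by (rule section_at_edge[OF x that])
  fix s z assume s: "s \<in> Vert T" and z: "z \<in> Ob V"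
  have "unit_el T z s \<cdot> on_edge (section_at V X T x) s s = unit_el (ten_graph V X T) z (x, s)"
    by (simp only: section_at_act[OF x unit_el_in[OF T_graph s z]] ten_unit_el[OF X T_graph x s z])
  then show "unit_el T z s \<cdot> (lun_inv V (Edg T s s) \<cdot> (Unt X x \<odot> Idn V (Edg T s s))) = unit_el (ten_graph V X T) z (x, s)"
    using s by (simp add: section_at_def on_edge_mk)
qed

lemma sections_pow_edge:
  assumes x: "x \<in> Vert X" and y: "y \<in> Vert X"
  shows "on_edge (sections_pow V T X) x y \<in> hom (pow_graph V T (ten_graph V X T)) (Edg X x y) (section_at V X T x)
      (section_at V X T y)"
    and "s \<in> Vert T \<Longrightarrow> pow_component (ten_graph V X T) (section_at V X T x) (section_at V X T y) (on_edge (sections_pow V T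
        X) x y) s =
      run_inv V (Edg X x y) \<cdot> (Idn V (Edg X x y) \<odot> Unt T s)"
proof -
  note XT = original_ten[OF X T_graph] and E = Edg_ob[OF X x y]
  have e: "on_edge (sections_pow V T X) x y = tuple V (Vert T)
       (comp_family (ten_graph V X T) (section_at V X T x) (section_at V X T y)) (Edg X x y)
       (\<lambda>s. run_inv V (Edg X x y) \<cdot> (Idn V (Edg X x y) \<odot> Unt T s))"
    using x y by (simp add: sections_pow_def on_edge_mk)
  have k: "run_inv V (Edg X x y) \<cdot> (Idn V (Edg X x y) \<odot> Unt T s) \<in>
      hom (ten_graph V X T) (Edg X x y) (on_vert (section_at V X T x) s) (on_vert (section_at V X T y) s)"
    if s: "s \<in> Vert T" for s
    unfolding section_at_vert[OF s]
  proof (rule homI)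
    show "(x, s) \<in> Vert (ten_graph V X T)" "(y, s) \<in> Vert (ten_graph V X T)" using x y s by (simp_all add: ten_graph_simps)
    show "run_inv V (Edg X x y) \<cdot> (Idn V (Edg X x y) \<odot> Unt T s) \<in> Edg X x y \<leadsto> Edg (ten_graph V X T) (x, s) (y, s)"
      unfolding ten_graph_simps by (rule comp_in[OF run_inv_in[OF E] tensor_in[OF id_in[OF E] Unt_in[OF T_graph s]]])
  qed
  note t = tuple_pow[OF XT section_at_ot[OF x] section_at_ot[OF y] E k]
  show "on_edge (sections_pow V T X) x y \<in> hom (pow_graph V T (ten_graph V X T)) (Edg X x y) (section_at V X T x)
      (section_at V X T y)"
    unfolding e by (rule t(1))
  show "s \<in> Vert T \<Longrightarrow> pow_component (ten_graph V X T) (section_at V X T x) (section_at V X T y) (on_edge (sections_pow V T X)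
      x y) s =
      run_inv V (Edg X x y) \<cdot> (Idn V (Edg X x y) \<odot> Unt T s)"
    unfolding e by (rule t(2))
qed

lemma pow_component_sections:
  assumes a: "a \<in> hom X z x y" and s: "s \<in> Vert T"
  shows "pow_component (ten_graph V X T) (section_at V X T x) (section_at V X T y) (a \<cdot> on_edge (sections_pow V T X) x y) s
      =
    pair z (Edg X x y) (Edg T s s) a (unit_el T z s)"
proof -
  note v = hom_vert[OF a] and a' = homD[OF a] and E = Edg_ob[OF X hom_vert[OF a]] and b = bang_in[OF hom_ob[OF a]]
  show ?thesis unfolding unit_el_def
    by (simp only: comp_pow_component[OF original_ten[OF X T_graph] sections_pow_edge(1)[OF v] s a'] sections_pow_edge(2)[OF
        v s]
      assoc[OF a' run_inv_in[OF E] tensor_in[OF id_in[OF E] Unt_in[OF T_graph s]], symmetric]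
      comp_run_inv[OF a'] pair_tensor[OF a' b id_in[OF E] Unt_in[OF T_graph s]] id_right[OF a'])
qed

lemma sections_pow_ot: "sections_pow V T X \<in> original_transports V X (pow_graph V T (ten_graph V X T))"
proof -
  note XT = original_ten[OF X T_graph]
  have "mk_transport (Vert X) (section_at V X T) (on_edge (sections_pow V T X)) \<in> original_transports V X (pow_graph V T
      (ten_graph V X T))"
  proof (rule otI[OF X original_pow[OF XT]])
    show 1: "section_at V X T x \<in> Vert (pow_graph V T (ten_graph V X T))" if "x \<in> Vert X" for x
      using section_at_ot[OF that] by (simp add: pow_graph_simps)
    show "on_edge (sections_pow V T X) x y \<in> Edg X x y \<leadsto> Edg (pow_graph V T (ten_graph V X T)) (section_at V X T x)
        (section_at V X T y)"
      if "x \<in> Vert X" "y \<in> Vert X" for x y by (rule homD[OF sections_pow_edge(1)[OF that]])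
    fix x z assume x: "x \<in> Vert X" and z: "z \<in> Ob V"
    note u = unit_el_in[OF X x z]
    show "unit_el X z x \<cdot> on_edge (sections_pow V T X) x x = unit_el (pow_graph V T (ten_graph V X T)) z (section_at V X T
        x)"
    proof (rule pow_component_eqI[OF XT hom_comp[OF homD[OF u] sections_pow_edge(1)[OF x x]] unit_el_in[OF original_pow[OF
        XT] 1[OF x] z]])
      fix s assume s: "s \<in> Vert T"
      show "pow_component (ten_graph V X T) (section_at V X T x) (section_at V X T x) (unit_el X z x \<cdot> on_edge (sections_pow
          V T X) x x) s =
        pow_component (ten_graph V X T) (section_at V X T x) (section_at V X T x) (unit_el (pow_graph V T (ten_graph V X T))
            z (section_at V X T x)) s"
        by (simp only: pow_component_sections[OF u s] pow_component_unit_el[OF XT section_at_ot[OF x] z s]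
            section_at_vert[OF s] ten_unit_el[OF X T_graph x s z])
    qed
  qed
  moreover have "mk_transport (Vert X) (section_at V X T) (on_edge (sections_pow V T X)) = sections_pow V T X"
    unfolding sections_pow_def by (rule mk_transport_cong) (simp_all add: on_edge_mk)
  ultimately show ?thesis by simp
qed

end

lemma section_at_natural:
  assumes X: "original_graph V X" and Y: "original_graph V Y" and f: "f \<in> original_transports V X Y" and x: "x \<in> Vert X"
  shows "followed_by V T (section_at V X T x) (ten_id V X T f) = section_at V Y T (on_vert f x)"
proof -
  note XT = original_ten[OF X T_graph] and YT = original_ten[OF Y T_graph]
  note g = ten_id_ot[OF X Y f] and sx = section_at_ot[OF X x] and sy = section_at_ot[OF Y ot_vert[OF f x]]
  show ?thesis
  proof (rule ot_eqI[OF T_graph YT followed_by_ot[OF T_graph XT YT sx g] sy])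
    show "on_vert (followed_by V T (section_at V X T x) (ten_id V X T f)) s = on_vert (section_at V Y T (on_vert f x)) s"
      if "s \<in> Vert T" for s using that x by (simp add: followed_by_vert section_at_vert ten_id_vert)
    fix z s t \<tau> assume \<tau>: "\<tau> \<in> hom T z s t"
    note st = hom_vert[OF \<tau>] and z = hom_ob[OF \<tau>]
    show "\<tau> \<cdot> on_edge (followed_by V T (section_at V X T x) (ten_id V X T f)) s t = \<tau> \<cdot> on_edge (section_at V Y T (on_vert f
        x)) s t"
      by (simp only: followed_by_act[OF XT YT sx g \<tau>] section_at_act[OF X x \<tau>] section_at_act[OF Y ot_vert[OF f x] \<tau>]
         section_at_vert[OF st(1)] section_at_vert[OF st(2)] ten_id_act[OF Y f unit_el_in[OF X x z] \<tau>] ot_unit_el[OF X Y f x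
             z])
  qed
qed

text \<open>
  The section at \<open>x\<close> pairs \<open>\<tau>\<close> with the unit of \<open>x\<close>, and the family of an edge pairs it with units
  of \<open>T\<close>, so the square commutes as soon as \<open>f\<close> maintains units.
\<close>

lemma sections_pow_natural:
  assumes X: "original_graph V X" and Y: "original_graph V Y" and f: "f \<in> original_transports V X Y"
  shows "followed_by V X f (sections_pow V T Y) =
    followed_by V X (sections_pow V T X) (pow_transport V T (ten_graph V X T) (ten_graph V Y T) (ten_id V X T f))"
proof -
  note XT = original_ten[OF X T_graph] and YT = original_ten[OF Y T_graph]
  note PX = original_pow[OF XT] and PY = original_pow[OF YT]
  note g = ten_id_ot[OF X Y f] note p = pow_transport_ot[OF XT YT g]
  note sX = sections_pow_ot[OF X] and sY = sections_pow_ot[OF Y]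
  let ?p = "pow_transport V T (ten_graph V X T) (ten_graph V Y T) (ten_id V X T f)"
  show ?thesis
  proof (rule ot_eqI[OF X PY followed_by_ot[OF X Y PY f sY] followed_by_ot[OF X PX PY sX p]])
    show "on_vert (followed_by V X f (sections_pow V T Y)) x = on_vert (followed_by V X (sections_pow V T X) ?p) x"
      if x: "x \<in> Vert X" for x
      using x ot_vert[OF f x] section_at_natural[OF X Y f x] section_at_ot[OF X x]
      by (simp add: followed_by_vert sections_pow_vert pow_transport_vert)
    fix z x y a assume a: "a \<in> hom X z x y"
    note v = hom_vert[OF a] and fa = ot_act[OF Y f a] and z = hom_ob[OF a]
    note fv = ot_vert[OF f v(1)] ot_vert[OF f v(2)]
    note m = ot_act[OF PX sX a, unfolded sections_pow_vert[OF v(1)] sections_pow_vert[OF v(2)]]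
    note n = ot_act[OF PY sY fa, unfolded sections_pow_vert[OF fv(1)] sections_pow_vert[OF fv(2)]]
    note q = ot_act[OF PY p m, unfolded pow_transport_vert[OF section_at_ot[OF X v(1)]] pow_transport_vert[OF
        section_at_ot[OF X v(2)]]
      section_at_natural[OF X Y f v(1)] section_at_natural[OF X Y f v(2)]]
    show "a \<cdot> on_edge (followed_by V X f (sections_pow V T Y)) x y = a \<cdot> on_edge (followed_by V X (sections_pow V T X) ?p) x
        y"
      unfolding followed_by_act[OF Y PY f sY a] followed_by_act[OF PX PY sX p a] sections_pow_vert[OF v(1)]
          sections_pow_vert[OF v(2)]
    proof (rule pow_component_eqI[OF YT n q])
      fix s assume s: "s \<in> Vert T"
      have "pow_component (ten_graph V Y T) (section_at V Y T (on_vert f x)) (section_at V Y T (on_vert f y))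
         (a \<cdot> on_edge (sections_pow V T X) x y \<cdot> on_edge ?p (section_at V X T x) (section_at V X T y)) s =
         pair z (Edg X x y) (Edg T s s) a (unit_el T z s) \<cdot> on_edge (ten_id V X T f) (x, s) (y, s)"
        using pow_component_pow_transport[OF XT YT g m s]
        by (simp only: section_at_natural[OF X Y f v(1)] section_at_natural[OF X Y f v(2)] pow_component_sections[OF X a s]
            section_at_vert[OF s])
      then show "pow_component (ten_graph V Y T) (section_at V Y T (on_vert f x)) (section_at V Y T (on_vert f y))
         (a \<cdot> on_edge f x y \<cdot> on_edge (sections_pow V T Y) (on_vert f x) (on_vert f y)) s =
        pow_component (ten_graph V Y T) (section_at V Y T (on_vert f x)) (section_at V Y T (on_vert f y))
         (a \<cdot> on_edge (sections_pow V T X) x y \<cdot> on_edge ?p (section_at V X T x) (section_at V X T y)) s"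
        by (simp only: pow_component_sections[OF Y fa s] ten_id_act[OF Y f a unit_el_in[OF T_graph s z]])
    qed
  qed
qed

lemma pow_component_ten_cat: "pow_component (ten_cat V X T) = pow_component (ten_graph V X T)"
  by (simp add: pow_component_def ten_cat_def fun_eq_iff)

lemma pow_graph_ten_cat: "pow_graph V T (ten_cat V X T) = pow_graph V T (ten_graph V X T)"
  unfolding pow_graph_def ot_ten_cat_target by (simp add: ten_cat_def)

lemma sections_exp_vert: "x \<in> Vert X \<Longrightarrow> on_vert (sections_exp V T X) x = section_at V X T x"
  by (simp add: sections_exp_def on_vert_mk)

context
  fixes X :: "('x, 'o, 'm) vcat"
  assumes X: "enriched V X"
begin

lemma X_comp: "composable X" and X_graph: "original_graph V X" and XT_enr: "enriched V (ten_cat V X T)"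
  and XT_comp: "composable (ten_cat V X T)" and XT_graph: "original_graph V (ten_cat V X T)"
  using X T ten_enriched enriched_composable enriched_graph by blast+

lemma section_at_nf:
  assumes x: "x \<in> Vert X"
  shows "section_at V X T x \<in> natural_functors V T (ten_cat V X T)"
proof (rule nfI[OF T_comp XT_comp])
  show "section_at V X T x \<in> original_transports V T (ten_cat V X T)"
    unfolding ot_ten_cat_target by (rule section_at_ot[OF X_graph x])
  fix z s t r \<tau> \<sigma> assume \<tau>: "\<tau> \<in> hom T z s t" and \<sigma>: "\<sigma> \<in> hom T z t r"
  note u = unit_el_in[OF X_graph x hom_ob[OF \<tau>]]
  show "comp_el T z s t r \<tau> \<sigma> \<cdot> on_edge (section_at V X T x) s r =
    comp_el (ten_cat V X T) z (on_vert (section_at V X T x) s) (on_vert (section_at V X T x) t) (on_vert (section_at V X T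
        x) r)
      (\<tau> \<cdot> on_edge (section_at V X T x) s t) (\<sigma> \<cdot> on_edge (section_at V X T x) t r)"
    by (simp only: section_at_act[OF X_graph x \<tau>] section_at_act[OF X_graph x \<sigma>] section_at_act[OF X_graph x comp_el_in[OF
        T_comp \<tau> \<sigma>]]
      section_at_vert[OF hom_vert(1)[OF \<tau>]] section_at_vert[OF hom_vert(1)[OF \<sigma>]] section_at_vert[OF hom_vert(2)[OF \<sigma>]]
      ten_comp_el[OF X_comp T_comp u u \<tau> \<sigma>] comp_el_unit_el_left[OF X u])
qed

text \<open>
  The family \<open>\<langle>a, 1\<^sub>s\<rangle>\<close> is natural because both sides of the square are \<open>\<langle>a, \<tau>\<rangle>\<close>: \<open>\<langle>a, 1\<rangle> \<circ> \<langle>1, \<tau>\<rangle>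
  = \<langle>1, \<tau>\<rangle> \<circ> \<langle>a, 1\<rangle>\<close>.
\<close>

lemma sections_exp_edge:
  assumes x: "x \<in> Vert X" and y: "y \<in> Vert X"
  shows "on_edge (sections_exp V T X) x y \<in> hom (exp_cat V T (ten_cat V X T)) (Edg X x y) (section_at V X T x) (section_at V
      X T y)"
    and "on_edge (sections_exp V T X) x y \<cdot> nat_incl V T (ten_cat V X T) (section_at V X T x) (section_at V X T y) =
      on_edge (sections_pow V T X) x y"
proof -
  let ?h = "on_edge (sections_pow V T X) x y"
  have e: "on_edge (sections_exp V T X) x y = nat_lift V T (ten_cat V X T) (section_at V X T x) (section_at V X T y) (Edg X
      x y) ?h"
    using x y by (simp add: sections_exp_def on_edge_mk)
  have n: "natural_at (ten_cat V X T) (section_at V X T x) (section_at V X T y) (Edg X x y) ?h"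
    unfolding natural_at_def
  proof (intro allI impI)
    fix w k s t \<tau> assume k: "k \<in> w \<leadsto> Edg X x y" and \<tau>: "\<tau> \<in> hom T w s t"
    \<comment> \<open>\<open>k\<close> is an element of \<open>X(x;y)\<close> at stage \<open>w\<close>, and its family is the one to be tested\<close>
    note a = homI[OF x y k] and st = hom_vert[OF \<tau>] and w = hom_ob[OF \<tau>]
    note ux = unit_el_in[OF X_graph x w] and uy = unit_el_in[OF X_graph y w]
    note us = unit_el_in[OF T_graph st(1) w] and ut = unit_el_in[OF T_graph st(2) w]
    show "comp_el (ten_cat V X T) w (on_vert (section_at V X T x) s) (on_vert (section_at V X T y) s) (on_vert (section_at V
        X T y) t)
      (pow_component (ten_cat V X T) (section_at V X T x) (section_at V X T y) (k \<cdot> ?h) s) (\<tau> \<cdot> on_edge (section_at V X T y)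
          s t) =
     comp_el (ten_cat V X T) w (on_vert (section_at V X T x) s) (on_vert (section_at V X T x) t) (on_vert (section_at V X T
         y) t)
      (\<tau> \<cdot> on_edge (section_at V X T x) s t) (pow_component (ten_cat V X T) (section_at V X T x) (section_at V X T y) (k \<cdot>
          ?h) t)"
      by (simp only: pow_component_ten_cat pow_component_sections[OF X_graph a st(1)] pow_component_sections[OF X_graph a
          st(2)]
        section_at_act[OF X_graph x \<tau>] section_at_act[OF X_graph y \<tau>] section_at_vert[OF st(1)] section_at_vert[OF st(2)]
        ten_comp_el[OF X_comp T_comp a uy us \<tau>] ten_comp_el[OF X_comp T_comp ux a \<tau> ut]
        comp_el_unit_el_left[OF X a] comp_el_unit_el_right[OF X a] comp_el_unit_el_left[OF T \<tau>] comp_el_unit_el_right[OF T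
            \<tau>])
  qed
  note l = exp_lift[OF XT_comp section_at_nf[OF x] section_at_nf[OF y] sections_pow_edge(1)[OF X_graph x y, folded
      pow_graph_ten_cat] n]
  show "on_edge (sections_exp V T X) x y \<in> hom (exp_cat V T (ten_cat V X T)) (Edg X x y) (section_at V X T x) (section_at V
      X T y)"
    "on_edge (sections_exp V T X) x y \<cdot> nat_incl V T (ten_cat V X T) (section_at V X T x) (section_at V X T y) = ?h"
    unfolding e by (rule l(1), rule l(2))
qed

lemma sections_exp_incl_edge:
  assumes a: "a \<in> hom X z x y"
  shows "a \<cdot> on_edge (sections_exp V T X) x y \<cdot> nat_incl V T (ten_cat V X T) (section_at V X T x) (section_at V X T y) =
      a \<cdot> on_edge (sections_pow V T X) x y"
  by (simp only: assoc[OF homD[OF a] homD[OF sections_exp_edge(1)[OF hom_vert[OF a]], unfolded exp_cat_simps]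
      homD[OF nat_incl_in[OF XT_comp nf_ot[OF section_at_nf[OF hom_vert(1)[OF a]]] nf_ot[OF section_at_nf[OF hom_vert(2)[OF
          a]]]]]]
    sections_exp_edge(2)[OF hom_vert[OF a]])

lemma nat_component_sections:
  assumes a: "a \<in> hom X z x y" and s: "s \<in> Vert T"
  shows "nat_component (ten_cat V X T) (section_at V X T x) (section_at V X T y) (a \<cdot> on_edge (sections_exp V T X) x y) s =
    pair z (Edg X x y) (Edg T s s) a (unit_el T z s)"
  unfolding nat_component_def sections_exp_incl_edge[OF a] pow_component_ten_cat by (rule pow_component_sections[OF X_graph
      a s])

lemma sections_exp_ot: "sections_exp V T X \<in> original_transports V X (exp_cat V T (ten_cat V X T))"
proof -
  note EX = original_exp[OF XT_enr]
  have "mk_transport (Vert X) (section_at V X T) (on_edge (sections_exp V T X)) \<in> original_transports V X (exp_cat V T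
      (ten_cat V X T))"
  proof (rule otI[OF X_graph EX])
    show 1: "section_at V X T x \<in> Vert (exp_cat V T (ten_cat V X T))" if "x \<in> Vert X" for x
      using section_at_nf[OF that] by (simp add: exp_cat_simps)
    show "on_edge (sections_exp V T X) x y \<in> Edg X x y \<leadsto> Edg (exp_cat V T (ten_cat V X T)) (section_at V X T x) (section_at
        V X T y)"
      if "x \<in> Vert X" "y \<in> Vert X" for x y by (rule homD[OF sections_exp_edge(1)[OF that]])
    fix x z assume x: "x \<in> Vert X" and z: "z \<in> Ob V"
    note u = unit_el_in[OF X_graph x z]
    show "unit_el X z x \<cdot> on_edge (sections_exp V T X) x x = unit_el (exp_cat V T (ten_cat V X T)) z (section_at V X T x)"
    proof (rule nat_component_eqI[OF XT_comp hom_comp[OF homD[OF u] sections_exp_edge(1)[OF x x]] unit_el_in[OF EX 1[OF x]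
        z]])
      fix s assume s: "s \<in> Vert T"
      show "nat_component (ten_cat V X T) (section_at V X T x) (section_at V X T x) (unit_el X z x \<cdot> on_edge (sections_exp V
          T X) x x) s =
        nat_component (ten_cat V X T) (section_at V X T x) (section_at V X T x) (unit_el (exp_cat V T (ten_cat V X T)) z
            (section_at V X T x)) s"
        by (simp only: nat_component_sections[OF u s] nat_component_unit_el[OF XT_enr section_at_nf[OF x] z s]
            section_at_vert[OF s] unit_el_ten_cat
          ten_unit_el[OF X_graph T_graph x s z])
    qed
  qed
  moreover have "mk_transport (Vert X) (section_at V X T) (on_edge (sections_exp V T X)) = sections_exp V T X"
    unfolding sections_exp_def by (rule mk_transport_cong) (simp_all add: on_edge_mk)
  ultimately show ?thesis by simp
qed

lemma sections_exp_hom: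
  assumes a: "a \<in> hom X z x y"
  shows "a \<cdot> on_edge (sections_exp V T X) x y \<in> hom (exp_cat V T (ten_cat V X T)) z (section_at V X T x) (section_at V X T
      y)"
  by (rule hom_comp[OF homD[OF a] sections_exp_edge(1)[OF hom_vert[OF a]]])

lemma sections_exp_nf: "sections_exp V T X \<in> natural_functors V X (exp_cat V T (ten_cat V X T))"
proof (rule nfI[OF X_comp exp_composable[OF XT_enr] sections_exp_ot])
  fix z x y w a b assume a: "a \<in> hom X z x y" and b: "b \<in> hom X z y w"
  note v = hom_vert[OF a] hom_vert(2)[OF b] and z = hom_ob[OF a] and c = comp_el_in[OF X_comp a b]
  note ha = sections_exp_hom[OF a] and hb = sections_exp_hom[OF b] and hc = sections_exp_hom[OF c]
  show "comp_el X z x y w a b \<cdot> on_edge (sections_exp V T X) x w = comp_el (exp_cat V T (ten_cat V X T)) z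
      (on_vert (sections_exp V T X) x) (on_vert (sections_exp V T X) y) (on_vert (sections_exp V T X) w)
      (a \<cdot> on_edge (sections_exp V T X) x y) (b \<cdot> on_edge (sections_exp V T X) y w)"
    unfolding sections_exp_vert[OF v(1)] sections_exp_vert[OF v(2)] sections_exp_vert[OF v(3)]
  proof (rule nat_component_eqI[OF XT_comp hc comp_el_in[OF exp_composable[OF XT_enr] ha hb]])
    fix s assume s: "s \<in> Vert T"
    note u = unit_el_in[OF T_graph s z]
    show "nat_component (ten_cat V X T) (section_at V X T x) (section_at V X T w) (comp_el X z x y w a b \<cdot> on_edge
        (sections_exp V T X) x w) s =
      nat_component (ten_cat V X T) (section_at V X T x) (section_at V X T w) (comp_el (exp_cat V T (ten_cat V X T)) z
      (section_at V X T x) (section_at V X T y) (section_at V X T w)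
      (a \<cdot> on_edge (sections_exp V T X) x y) (b \<cdot> on_edge (sections_exp V T X) y w)) s"
      by (simp only: nat_component_comp_el[OF XT_enr ha hb s] nat_component_sections[OF a s] nat_component_sections[OF b s]
          nat_component_sections[OF c s]
        section_at_vert[OF s] ten_comp_el[OF X_comp T_comp a b u u] comp_el_unit_el_left[OF T u])
  qed
qed

lemma sections_exp_incl: "followed_by V X (sections_exp V T X) (exp_incl V T (ten_cat V X T)) = sections_pow V T X"
proof -
  note E = original_exp[OF XT_enr] and P = original_pow[OF XT_graph]
  note i = nf_ot[OF exp_incl_nf[OF XT_enr], unfolded ot_pow_cat_target]
  note s = sections_pow_ot[OF X_graph, folded pow_graph_ten_cat]
  show ?thesis
  proof (rule ot_eqI[OF X_graph P followed_by_ot[OF X_graph E P sections_exp_ot i] s])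
    show "on_vert (followed_by V X (sections_exp V T X) (exp_incl V T (ten_cat V X T))) x = on_vert (sections_pow V T X) x"
      if "x \<in> Vert X" for x
      using that by (simp add: followed_by_vert sections_exp_vert exp_incl_vert[OF XT_enr] section_at_nf sections_pow_vert)
    fix z x y a assume a: "a \<in> hom X z x y"
    note v = hom_vert[OF a]
    show "a \<cdot> on_edge (followed_by V X (sections_exp V T X) (exp_incl V T (ten_cat V X T))) x y = a \<cdot> on_edge (sections_pow
        V T X) x y"
      by (simp only: followed_by_act[OF E P sections_exp_ot i a] sections_exp_vert[OF v(1)] sections_exp_vert[OF v(2)]
        exp_incl_edge[OF XT_enr section_at_nf[OF v(1)] section_at_nf[OF v(2)]] sections_exp_incl_edge[OF a])
  qed
qed

end

lemma sections_exp_natural: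
  assumes X: "enriched V X" and Y: "enriched V Y" and f: "f \<in> natural_functors V X Y"
  shows "followed_by V X f (sections_exp V T Y) =
    followed_by V X (sections_exp V T X) (exp_transport V T (ten_cat V X T) (ten_cat V Y T) (ten_id V X T f))"
proof -
  note XG = enriched_graph[OF X] and YG = enriched_graph[OF Y] and fo = nf_ot[OF f]
  note XT = ten_enriched[OF X T] and YT = ten_enriched[OF Y T]
  note EX = original_exp[OF XT] and EY = original_exp[OF YT]
  note g = ten_id_nf[OF enriched_composable[OF X] enriched_composable[OF Y] f] note p = exp_transport_ot[OF XT YT g]
  note sX = sections_exp_ot[OF X] and sY = sections_exp_ot[OF Y]
  let ?p = "exp_transport V T (ten_cat V X T) (ten_cat V Y T) (ten_id V X T f)"
  note nat = section_at_natural[OF XG YG fo]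
  show ?thesis
  proof (rule ot_eqI[OF XG EY followed_by_ot[OF XG YG EY fo sY] followed_by_ot[OF XG EX EY sX p]])
    show "on_vert (followed_by V X f (sections_exp V T Y)) x = on_vert (followed_by V X (sections_exp V T X) ?p) x"
      if x: "x \<in> Vert X" for x
      using x ot_vert[OF fo x] nat[OF x] section_at_nf[OF X x]
      by (simp add: followed_by_vert sections_exp_vert exp_transport_vert)
    fix z x y a assume a: "a \<in> hom X z x y"
    note v = hom_vert[OF a] and fa = ot_act[OF YG fo a] and z = hom_ob[OF a]
    note m = sections_exp_hom[OF X a] and n = sections_exp_hom[OF Y fa]
    note q = ot_act[OF EY p m, unfolded exp_transport_vert[OF section_at_nf[OF X v(1)]] exp_transport_vert[OF
        section_at_nf[OF X v(2)]]
      nat[OF v(1)] nat[OF v(2)]]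
    show "a \<cdot> on_edge (followed_by V X f (sections_exp V T Y)) x y = a \<cdot> on_edge (followed_by V X (sections_exp V T X) ?p) x
        y"
      unfolding followed_by_act[OF YG EY fo sY a] followed_by_act[OF EX EY sX p a] sections_exp_vert[OF v(1)]
          sections_exp_vert[OF v(2)]
    proof (rule nat_component_eqI[OF enriched_composable[OF YT] n q])
      fix s assume s: "s \<in> Vert T"
      have "nat_component (ten_cat V Y T) (section_at V Y T (on_vert f x)) (section_at V Y T (on_vert f y))
         (a \<cdot> on_edge (sections_exp V T X) x y \<cdot> on_edge ?p (section_at V X T x) (section_at V X T y)) s =
         pair z (Edg X x y) (Edg T s s) a (unit_el T z s) \<cdot> on_edge (ten_id V X T f) (x, s) (y, s)"
        using nat_component_exp_transport[OF XT YT g m s]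
        by (simp only: nat[OF v(1)] nat[OF v(2)] nat_component_sections[OF X a s] section_at_vert[OF s])
      then show "nat_component (ten_cat V Y T) (section_at V Y T (on_vert f x)) (section_at V Y T (on_vert f y))
         (a \<cdot> on_edge f x y \<cdot> on_edge (sections_exp V T Y) (on_vert f x) (on_vert f y)) s =
        nat_component (ten_cat V Y T) (section_at V Y T (on_vert f x)) (section_at V Y T (on_vert f y))
         (a \<cdot> on_edge (sections_exp V T X) x y \<cdot> on_edge ?p (section_at V X T x) (section_at V X T y)) s"
        by (simp only: nat_component_sections[OF Y fa s] ten_id_act[OF YG fo a unit_el_in[OF T_graph s z]])
    qed
  qed
qed

section \<open>Evaluation\<close>

lemma evaluation_vert: "\<phi> \<in> natural_functors V T Y \<Longrightarrow> s \<in> Vert T \<Longrightarrow> on_vert (evaluation V T Y) (\<phi>, s) = on_vert \<phi> s"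
  by (simp add: evaluation_def on_vert_mk)

context
  fixes Y :: "('y, 'o, 'm) vcat"
  assumes Y: "enriched V Y"
begin

lemma Y_comp: "composable Y" and Y_graph: "original_graph V Y" and EY_enr: "enriched V (exp_cat V T Y)"
  and EY_comp: "composable (exp_cat V T Y)" and EY_graph: "original_graph V (exp_cat V T Y)"
  using Y exp_enriched enriched_composable enriched_graph by blast+

lemma evaluation_edge:
  assumes \<phi>: "\<phi> \<in> natural_functors V T Y" and \<psi>: "\<psi> \<in> natural_functors V T Y" and s: "s \<in> Vert T" and t: "t \<in> Vert T"
  shows "on_edge (evaluation V T Y) (\<phi>, s) (\<psi>, t) \<in> nat_ob V T Y \<phi> \<psi> \<otimes> Edg T s t \<leadsto> Edg Y (on_vert \<phi> s) (on_vert \<psi> t)"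
    and "\<lbrakk>e \<in> hom (exp_cat V T Y) z \<phi> \<psi>; \<tau> \<in> hom T z s t\<rbrakk> \<Longrightarrow>
      pair z (nat_ob V T Y \<phi> \<psi>) (Edg T s t) e \<tau> \<cdot> on_edge (evaluation V T Y) (\<phi>, s) (\<psi>, t) =
      comp_el Y z (on_vert \<phi> s) (on_vert \<psi> s) (on_vert \<psi> t) (nat_component Y \<phi> \<psi> e s) (\<tau> \<cdot> on_edge \<psi> s t)"
proof -
  note o = nf_ot[OF \<phi>] nf_ot[OF \<psi>]
  have e: "on_edge (evaluation V T Y) (\<phi>, s) (\<psi>, t) =
    ((nat_incl V T Y \<phi> \<psi> \<cdot> proj V (Vert T) (comp_family Y \<phi> \<psi>) s) \<odot> on_edge \<psi> s t) \<cdot> Comps Y (on_vert \<phi> s) (on_vert \<psi> s)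
        (on_vert \<psi> t)"
    using \<phi> \<psi> s t by (simp add: evaluation_def on_edge_mk)
  note i = homD[OF nat_incl_in[OF Y_comp o]] and p = pow_proj[OF Y_graph o s] and q = ot_edge[OF T_graph Y_graph o(2) s t]
  note C = Comps_in[OF Y_comp ot_vert[OF o(1) s] ot_vert[OF o(2) s] ot_vert[OF o(2) t]]
  show "on_edge (evaluation V T Y) (\<phi>, s) (\<psi>, t) \<in> nat_ob V T Y \<phi> \<psi> \<otimes> Edg T s t \<leadsto> Edg Y (on_vert \<phi> s) (on_vert \<psi> t)"
    unfolding e by (rule comp_in[OF tensor_in[OF comp_in[OF i p] q] C])
  assume x: "e \<in> hom (exp_cat V T Y) z \<phi> \<psi>" and \<tau>: "\<tau> \<in> hom T z s t"
  note x' = homD[OF x, unfolded exp_cat_simps] and \<tau>' = homD[OF \<tau>]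
  show "pair z (nat_ob V T Y \<phi> \<psi>) (Edg T s t) e \<tau> \<cdot> on_edge (evaluation V T Y) (\<phi>, s) (\<psi>, t) =
      comp_el Y z (on_vert \<phi> s) (on_vert \<psi> s) (on_vert \<psi> t) (nat_component Y \<phi> \<psi> e s) (\<tau> \<cdot> on_edge \<psi> s t)"
    unfolding e comp_el_def nat_component_def pow_component_def
    by (simp only: assoc[OF pair_in[OF x' \<tau>'] tensor_in[OF comp_in[OF i p] q] C, symmetric]
      pair_tensor[OF x' \<tau>' comp_in[OF i p] q] assoc[OF x' i p])
qed

lemma evaluation_act:
  assumes e: "e \<in> hom (exp_cat V T Y) z \<phi> \<psi>" and \<tau>: "\<tau> \<in> hom T z s t"
  shows "pair z (Edg (exp_cat V T Y) \<phi> \<psi>) (Edg T s t) e \<tau> \<cdot> on_edge (evaluation V T Y) (\<phi>, s) (\<psi>, t) =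
      comp_el Y z (on_vert \<phi> s) (on_vert \<psi> s) (on_vert \<psi> t) (nat_component Y \<phi> \<psi> e s) (\<tau> \<cdot> on_edge \<psi> s t)"
  using evaluation_edge(2)[OF hom_exp_vert[OF e] hom_vert[OF \<tau>] e \<tau>] unfolding exp_cat_simps .

lemma evaluation_ot: "evaluation V T Y \<in> original_transports V (ten_graph V (exp_cat V T Y) T) Y"
proof -
  let ?X = "ten_graph V (exp_cat V T Y) T" and ?v = "\<lambda>(\<phi>, s). on_vert \<phi> s"
  have "mk_transport (Vert ?X) ?v (on_edge (evaluation V T Y)) \<in> original_transports V ?X Y"
  proof (rule otI[OF original_ten[OF EY_graph T_graph] Y_graph])
    show "?v p \<in> Vert Y" if "p \<in> Vert ?X" for p
      using that ot_vert[OF nf_ot] by (auto simp: ten_graph_simps exp_cat_simps)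
    show "on_edge (evaluation V T Y) p q \<in> Edg ?X p q \<leadsto> Edg Y (?v p) (?v q)" if "p \<in> Vert ?X" "q \<in> Vert ?X" for p q
      using that evaluation_edge(1) by (auto simp: ten_graph_simps exp_cat_simps)
    fix p z assume p: "p \<in> Vert ?X" and z: "z \<in> Ob V"
    obtain \<phi> s where ps: "p = (\<phi>, s)" "\<phi> \<in> Vert (exp_cat V T Y)" "s \<in> Vert T" using p by (auto simp: ten_graph_simps)
    note \<phi> = ps(2)[unfolded exp_cat_simps] note \<phi>' = nf_ot[OF \<phi>]
    note u = unit_el_in[OF EY_graph ps(2) z] and w = unit_el_in[OF T_graph ps(3) z]
    show "unit_el ?X z p \<cdot> on_edge (evaluation V T Y) p p = unit_el Y z (?v p)"
      unfolding ps(1) case_prod_conv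
      by (simp only: ten_unit_el[OF EY_graph T_graph ps(2,3) z] evaluation_act[OF u w] nat_component_unit_el[OF Y \<phi> z ps(3)]
        ot_unit_el[OF T_graph Y_graph \<phi>' ps(3) z] comp_el_unit_el_left[OF Y unit_el_in[OF Y_graph ot_vert[OF \<phi>' ps(3)] z]])
  qed
  moreover have "mk_transport (Vert ?X) ?v (on_edge (evaluation V T Y)) = evaluation V T Y"
    unfolding evaluation_def ten_graph_simps exp_cat_simps by (rule mk_transport_cong) (simp_all add: on_edge_mk)
  ultimately show ?thesis by simp
qed

text \<open>
  Evaluating a composite gives \<open>(e\<^sub>s \<circ> e'\<^sub>s) \<circ> (\<chi>(\<tau>) \<circ> \<chi>(\<sigma>))\<close>, composing two evaluations gives
  \<open>(e\<^sub>s \<circ> \<psi>(\<tau>)) \<circ> (e'\<^sub>t \<circ> \<chi>(\<sigma>))\<close>; the naturality square \<open>e'\<^sub>s \<circ> \<chi>(\<tau>) = \<psi>(\<tau>) \<circ> e'\<^sub>t\<close> identifies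
  them.
\<close>

lemma evaluation_nf: "evaluation V T Y \<in> natural_functors V (ten_cat V (exp_cat V T Y) T) Y"
proof (rule nfI[OF ten_composable[OF EY_comp T_comp] Y_comp])
  show "evaluation V T Y \<in> original_transports V (ten_cat V (exp_cat V T Y) T) Y"
    unfolding ot_ten_cat_source by (rule evaluation_ot)
  fix z p q r u v assume u: "u \<in> hom (ten_cat V (exp_cat V T Y) T) z p q" and v: "v \<in> hom (ten_cat V (exp_cat V T Y) T) z q
      r"
  obtain \<phi> s \<psi> t a \<tau> where 1: "p = (\<phi>, s)" "q = (\<psi>, t)" and a: "a \<in> hom (exp_cat V T Y) z \<phi> \<psi>" and \<tau>: "\<tau> \<in> hom T z s t"
    and u': "u = pair z (Edg (exp_cat V T Y) \<phi> \<psi>) (Edg T s t) a \<tau>"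
    using ten_cases[OF EY_graph T_graph u[unfolded hom_ten_cat]] by metis
  obtain \<chi> w b \<sigma> where 2: "r = (\<chi>, w)" and b: "b \<in> hom (exp_cat V T Y) z \<psi> \<chi>" and \<sigma>: "\<sigma> \<in> hom T z t w"
    and v': "v = pair z (Edg (exp_cat V T Y) \<psi> \<chi>) (Edg T t w) b \<sigma>"
    using ten_cases[OF EY_graph T_graph v[unfolded hom_ten_cat]] 1 by (metis prod.inject)
  note f = hom_exp_vert[OF a] hom_exp_vert(2)[OF b] and st = hom_vert[OF \<tau>] hom_vert(2)[OF \<sigma>]
  note a1 = nat_component_in[OF Y_comp a st(1)] and b1 = nat_component_in[OF Y_comp b st(1)] and b2 = nat_component_in[OF
      Y_comp b st(2)]
  note t1 = ot_act[OF Y_graph nf_ot[OF f(2)] \<tau>] and t2 = ot_act[OF Y_graph nf_ot[OF f(3)] \<tau>] and s2 = ot_act[OF Y_graph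
      nf_ot[OF f(3)] \<sigma>]
  show "comp_el (ten_cat V (exp_cat V T Y) T) z p q r u v \<cdot> on_edge (evaluation V T Y) p r =
    comp_el Y z (on_vert (evaluation V T Y) p) (on_vert (evaluation V T Y) q) (on_vert (evaluation V T Y) r)
      (u \<cdot> on_edge (evaluation V T Y) p q) (v \<cdot> on_edge (evaluation V T Y) q r)"
    unfolding 1 2 u' v'
    by (simp only: ten_comp_el[OF EY_comp T_comp a b \<tau> \<sigma>] evaluation_act[OF a \<tau>] evaluation_act[OF b \<sigma>]
       evaluation_act[OF comp_el_in[OF EY_comp a b] comp_el_in[OF T_comp \<tau> \<sigma>]] evaluation_vert[OF f(1) st(1)]
           evaluation_vert[OF f(2) st(2)]
       evaluation_vert[OF f(3) st(3)] nat_component_comp_el[OF Y a b st(1)] nf_comp_el[OF T_comp Y_comp f(3) \<tau> \<sigma>]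
       comp_el_assoc[OF Y a1 b1 comp_el_in[OF Y_comp t2 s2]] comp_el_assoc[OF Y b1 t2 s2, symmetric]
           nat_component_natural[OF Y_comp b \<tau>]
       comp_el_assoc[OF Y t1 b2 s2] comp_el_assoc[OF Y a1 t1 comp_el_in[OF Y_comp b2 s2]])
qed

end

lemma evaluation_natural:
  assumes X: "enriched V X" and Y: "enriched V Y" and g: "g \<in> natural_functors V X Y"
  shows "followed_by V (ten_cat V (exp_cat V T X) T) (ten_id V (exp_cat V T X) T (exp_transport V T X Y g)) (evaluation V T
      Y) =
    followed_by V (ten_cat V (exp_cat V T X) T) (evaluation V T X) g"
proof -
  note XG = enriched_graph[OF X] and YG = enriched_graph[OF Y] and go = nf_ot[OF g]
  note EX = original_exp[OF X] and EY = original_exp[OF Y]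
  note EXT = original_ten[OF EX T_graph] and EYT = original_ten[OF EY T_graph]
  note p = exp_transport_ot[OF X Y g] note h = ten_id_ot[OF EX EY p]
  note eX = evaluation_ot[OF X] and eY = evaluation_ot[OF Y]
  let ?p = "exp_transport V T X Y g"
  show ?thesis unfolding followed_by_ten_cat
  proof (rule ten_eqI[OF EX YG followed_by_ot[OF EXT EYT YG h eY] followed_by_ot[OF EXT XG YG eX go]])
    show "on_vert (followed_by V (ten_graph V (exp_cat V T X) T) (ten_id V (exp_cat V T X) T ?p) (evaluation V T Y)) (\<phi>, s)
        =
       on_vert (followed_by V (ten_graph V (exp_cat V T X) T) (evaluation V T X) g) (\<phi>, s)"
      if "\<phi> \<in> Vert (exp_cat V T X)" "s \<in> Vert T" for \<phi> s
      using that followed_by_nf[OF T_comp enriched_composable[OF X] enriched_composable[OF Y] that(1)[unfolded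
          exp_cat_simps] g]
      by (simp add: followed_by_vert ten_graph_simps(1) ten_id_vert exp_cat_simps exp_transport_vert evaluation_vert)
    fix z \<phi> \<psi> s t a \<tau> assume a: "a \<in> hom (exp_cat V T X) z \<phi> \<psi>" and \<tau>: "\<tau> \<in> hom T z s t"
    note v = hom_vert[OF a] hom_vert[OF \<tau>] and f = hom_exp_vert[OF a]
    note pa = ot_act[OF EY p a] note pa' = pa[unfolded exp_transport_vert[OF f(1)] exp_transport_vert[OF f(2)]]
    note m = nat_component_in[OF enriched_composable[OF X] a v(3)] and n = ot_act[OF XG nf_ot[OF f(2)] \<tau>]
    show "pair z (Edg (exp_cat V T X) \<phi> \<psi>) (Edg T s t) a \<tau> \<cdot>
       on_edge (followed_by V (ten_graph V (exp_cat V T X) T) (ten_id V (exp_cat V T X) T ?p) (evaluation V T Y)) (\<phi>, s) (\<psi>,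
           t) =
       pair z (Edg (exp_cat V T X) \<phi> \<psi>) (Edg T s t) a \<tau> \<cdot>
       on_edge (followed_by V (ten_graph V (exp_cat V T X) T) (evaluation V T X) g) (\<phi>, s) (\<psi>, t)"
      by (simp only: followed_by_act[OF EYT YG h eY ten_pair_in[OF EX T_graph a \<tau>]] followed_by_act[OF XG YG eX go
          ten_pair_in[OF EX T_graph a \<tau>]]
        ten_id_act[OF EY p a \<tau>] ten_id_vert[OF v(1,3)] ten_id_vert[OF v(2,4)] exp_transport_vert[OF f(1)]
            exp_transport_vert[OF f(2)]
        evaluation_act[OF Y pa' \<tau>] evaluation_act[OF X a \<tau>] evaluation_vert[OF f(1) v(3)] evaluation_vert[OF f(2) v(4)]
        nat_component_exp_transport[OF X Y g a v(3)] nf_comp_el[OF enriched_composable[OF X] enriched_composable[OF Y] g m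
            n]
        followed_by_vert[OF v(3)] followed_by_vert[OF v(4)] followed_by_act[OF XG YG nf_ot[OF f(2)] go \<tau>])
  qed
qed

section \<open>Name and realization\<close>

context
  fixes X :: "('x, 'o, 'm) vcat" and Y :: "('y, 'o, 'm) vcat"
  assumes X: "enriched V X" and Y: "enriched V Y"
begin

lemma name_nf:
  assumes f: "f \<in> natural_functors V (ten_cat V X T) Y"
  shows "name_of V T X Y f \<in> natural_functors V X (exp_cat V T Y)"
  unfolding name_of_def
  by (rule followed_by_nf[OF X_comp[OF X] EY_comp[OF XT_enr[OF X]] EY_comp[OF Y] sections_exp_nf[OF X] exp_transport_nf[OF
      XT_enr[OF X] Y f]])

lemma realization_nf:
  assumes g: "g \<in> natural_functors V X (exp_cat V T Y)"
  shows "realization_of V T X Y g \<in> natural_functors V (ten_cat V X T) Y"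
  unfolding realization_of_def
  by (rule followed_by_nf[OF XT_comp[OF X] ten_composable[OF EY_comp[OF Y] T_comp] Y_comp[OF Y]
      ten_id_nf[OF X_comp[OF X] EY_comp[OF Y] g] evaluation_nf[OF Y]])

lemma name_vert:
  assumes x: "x \<in> Vert X"
  shows "on_vert (name_of V T X Y f) x = followed_by V T (section_at V X T x) f"
  unfolding name_of_def using x
  by (simp add: followed_by_vert sections_exp_vert exp_transport_vert section_at_nf[OF X])

lemma nat_component_name:
  assumes f: "f \<in> natural_functors V (ten_cat V X T) Y" and a: "a \<in> hom X z x y" and s: "s \<in> Vert T"
  shows "nat_component Y (on_vert (name_of V T X Y f) x) (on_vert (name_of V T X Y f) y) (a \<cdot> on_edge (name_of V T X Y f) x
      y) s =
    pair z (Edg X x y) (Edg T s s) a (unit_el T z s) \<cdot> on_edge f (x, s) (y, s)"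
proof -
  note v = hom_vert[OF a]
  note XT = XT_enr[OF X]
  show ?thesis
    unfolding name_vert[OF v(1)] name_vert[OF v(2)]
    unfolding name_of_def
    by (simp only: followed_by_act[OF original_exp[OF XT] original_exp[OF Y] sections_exp_ot[OF X] exp_transport_ot[OF XT Y
        f] a]
      sections_exp_vert[OF v(1)] sections_exp_vert[OF v(2)] nat_component_exp_transport[OF XT Y f sections_exp_hom[OF X a]
          s]
      nat_component_sections[OF X a s] section_at_vert[OF s])
qed

lemma realization_vert:
  assumes g: "g \<in> original_transports V X (exp_cat V T Y)" and x: "x \<in> Vert X" and s: "s \<in> Vert T"
  shows "on_vert (realization_of V T X Y g) (x, s) = on_vert (on_vert g x) s"
  unfolding realization_of_def using x s ot_vert[OF g x]
  by (simp add: followed_by_vert Vert_ten_cat ten_id_vert evaluation_vert exp_cat_simps)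

lemma realization_act:
  assumes g: "g \<in> original_transports V X (exp_cat V T Y)" and a: "a \<in> hom X z x y" and \<tau>: "\<tau> \<in> hom T z s t"
  shows "pair z (Edg X x y) (Edg T s t) a \<tau> \<cdot> on_edge (realization_of V T X Y g) (x, s) (y, t) =
    comp_el Y z (on_vert (on_vert g x) s) (on_vert (on_vert g y) s) (on_vert (on_vert g y) t)
      (nat_component Y (on_vert g x) (on_vert g y) (a \<cdot> on_edge g x y) s) (\<tau> \<cdot> on_edge (on_vert g y) s t)"
proof -
  note E = original_exp[OF Y] and G = X_graph[OF X] and v = hom_vert[OF a] hom_vert[OF \<tau>]
  show ?thesis unfolding realization_of_def followed_by_ten_cat
    by (simp only: followed_by_act[OF original_ten[OF E T_graph] Y_graph[OF Y] ten_id_ot[OF G E g] evaluation_ot[OF Y]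
        ten_pair_in[OF G T_graph a \<tau>]]
      ten_id_act[OF E g a \<tau>] ten_id_vert[OF v(1,3)] ten_id_vert[OF v(2,4)] evaluation_act[OF Y ot_act[OF E g a] \<tau>])
qed

text \<open>
  Every element \<open>\<langle>a, \<tau>\<rangle>\<close> is the composite of \<open>\<langle>a, 1\<rangle>\<close> and \<open>\<langle>1, \<tau>\<rangle>\<close>, the two elements on which the
  name of \<open>f\<close> records the values of \<open>f\<close>.
\<close>

lemma realization_name:
  assumes f: "f \<in> natural_functors V (ten_cat V X T) Y"
  shows "realization_of V T X Y (name_of V T X Y f) = f"
proof -
  note G = X_graph[OF X] and YG = Y_graph[OF Y]
  note n = name_nf[OF f] note no = nf_ot[OF n]
  note fo = nf_ot[OF f] note fo' = fo[unfolded ot_ten_cat_source]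
  show ?thesis
  proof (rule ten_eqI[OF G YG nf_ot[OF realization_nf[OF n], unfolded ot_ten_cat_source] fo'])
    show "on_vert (realization_of V T X Y (name_of V T X Y f)) (x, s) = on_vert f (x, s)" if "x \<in> Vert X" "s \<in> Vert T" for x
        s
      using that by (simp add: realization_vert[OF no] name_vert followed_by_vert section_at_vert)
    fix z x y s t a \<tau> assume a: "a \<in> hom X z x y" and \<tau>: "\<tau> \<in> hom T z s t"
    note v = hom_vert[OF a] and st = hom_vert[OF \<tau>] and z = hom_ob[OF a]
    note us = unit_el_in[OF T_graph st(1) z] and uy = unit_el_in[OF G v(2) z]
    note p = ten_pair_in[OF G T_graph a us, folded hom_ten_cat] and q = ten_pair_in[OF G T_graph uy \<tau>, folded hom_ten_cat]
    have "pair z (Edg X x y) (Edg T s t) a \<tau> \<cdot> on_edge (realization_of V T X Y (name_of V T X Y f)) (x, s) (y, t) =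
       comp_el Y z (on_vert f (x, s)) (on_vert f (y, s)) (on_vert f (y, t))
         (pair z (Edg X x y) (Edg T s s) a (unit_el T z s) \<cdot> on_edge f (x, s) (y, s))
         (pair z (Edg X y y) (Edg T s t) (unit_el X z y) \<tau> \<cdot> on_edge f (y, s) (y, t))"
      unfolding realization_act[OF no a \<tau>] nat_component_name[OF f a st(1)]
      by (simp only: name_vert[OF v(1)] name_vert[OF v(2)] followed_by_vert[OF st(1)] followed_by_vert[OF st(2)]
        section_at_vert[OF st(1)] section_at_vert[OF st(2)]
        followed_by_act[OF XT_graph[OF X] YG nf_ot[OF section_at_nf[OF X v(2)]] fo \<tau>] section_at_act[OF G v(2) \<tau>])
    also have "\<dots> = pair z (Edg X x y) (Edg T s t) a \<tau> \<cdot> on_edge f (x, s) (y, t)"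
      by (simp only: nf_comp_el[OF XT_comp[OF X] Y_comp[OF Y] f p q, symmetric] ten_comp_el[OF X_comp[OF X] T_comp a uy us
          \<tau>]
        comp_el_unit_el_right[OF X a] comp_el_unit_el_left[OF T \<tau>])
    finally show "pair z (Edg X x y) (Edg T s t) a \<tau> \<cdot> on_edge (realization_of V T X Y (name_of V T X Y f)) (x, s) (y, t) =
       pair z (Edg X x y) (Edg T s t) a \<tau> \<cdot> on_edge f (x, s) (y, t)" .
  qed
qed

text \<open>
  On vertices, the transport \<open>\<tau> \<mapsto> (g 1)\<^sub>s \<circ> (g x)(\<tau>)\<close> is \<open>g x\<close> because \<open>g\<close> maintains units; on
  edges, the entry \<open>(g a)\<^sub>s \<circ> (g y)(1)\<close> is \<open>(g a)\<^sub>s\<close> because \<open>g y\<close> does.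
\<close>

lemma name_realization:
  assumes g: "g \<in> natural_functors V X (exp_cat V T Y)"
  shows "name_of V T X Y (realization_of V T X Y g) = g"
proof -
  note G = X_graph[OF X] and YG = Y_graph[OF Y] and E = original_exp[OF Y]
  note r = realization_nf[OF g] note ro = nf_ot[OF r]
  note go = nf_ot[OF g]
  note n = nf_ot[OF name_nf[OF r]]
  have gnf: "on_vert g x \<in> natural_functors V T Y" if "x \<in> Vert X" for x
    using ot_vert[OF go that] by (simp add: exp_cat_simps)
  have vert: "on_vert (name_of V T X Y (realization_of V T X Y g)) x = on_vert g x" if x: "x \<in> Vert X" for x
    unfolding name_vert[OF x]
  proof (rule ot_eqI[OF T_graph YG followed_by_ot[OF T_graph XT_graph[OF X] YG nf_ot[OF section_at_nf[OF X x]] ro] nf_ot[OF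
      gnf[OF x]]])
    show "on_vert (followed_by V T (section_at V X T x) (realization_of V T X Y g)) s = on_vert (on_vert g x) s" if "s \<in>
        Vert T" for s
      using that by (simp add: followed_by_vert section_at_vert realization_vert[OF go x])
    fix z s t \<tau> assume \<tau>: "\<tau> \<in> hom T z s t"
    note st = hom_vert[OF \<tau>] and z = hom_ob[OF \<tau>]
    show "\<tau> \<cdot> on_edge (followed_by V T (section_at V X T x) (realization_of V T X Y g)) s t = \<tau> \<cdot> on_edge (on_vert g x) s t"
      by (simp only: followed_by_act[OF XT_graph[OF X] YG nf_ot[OF section_at_nf[OF X x]] ro \<tau>] section_at_act[OF G x \<tau>]
        section_at_vert[OF st(1)] section_at_vert[OF st(2)] realization_act[OF go unit_el_in[OF G x z] \<tau>] ot_unit_el[OF G E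
            go x z]
        nat_component_unit_el[OF Y gnf[OF x] z st(1)] comp_el_unit_el_left[OF Y ot_act[OF YG nf_ot[OF gnf[OF x]] \<tau>]])
  qed
  show ?thesis
  proof (rule ot_eqI[OF G E n go vert])
    fix z x y a assume a: "a \<in> hom X z x y"
    note v = hom_vert[OF a] and z = hom_ob[OF a]
    note m = ot_act[OF E n a, unfolded vert[OF v(1)] vert[OF v(2)]] and ga = ot_act[OF E go a]
    show "a \<cdot> on_edge (name_of V T X Y (realization_of V T X Y g)) x y = a \<cdot> on_edge g x y"
    proof (rule nat_component_eqI[OF Y_comp[OF Y] m ga])
      fix s assume s: "s \<in> Vert T"
      show "nat_component Y (on_vert g x) (on_vert g y) (a \<cdot> on_edge (name_of V T X Y (realization_of V T X Y g)) x y) s =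
         nat_component Y (on_vert g x) (on_vert g y) (a \<cdot> on_edge g x y) s"
        using nat_component_name[OF r a s]
        by (simp only: vert[OF v(1)] vert[OF v(2)] realization_act[OF go a unit_el_in[OF T_graph s z]]
          ot_unit_el[OF T_graph YG nf_ot[OF gnf[OF v(2)]] s z] comp_el_unit_el_right[OF Y nat_component_in[OF Y_comp[OF Y]
              ga s]])
    qed
  qed
qed

end

text \<open>
  Both appointments are composites of a functor with the unit or counit, so their naturality is the
  naturality of these transforms together with functoriality.
\<close>

lemma name_natural_source:
  assumes X: "enriched V X" and X': "enriched V X'" and Y: "enriched V Y"
    and h: "h \<in> natural_functors V X X'" and f: "f \<in> natural_functors V (ten_cat V X' T) Y"
  shows "name_of V T X Y (followed_by V (ten_cat V X T) (ten_id V X T h) f) = followed_by V X h (name_of V T X' Y f)"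
proof -
  note XT = ten_enriched[OF X T] and XT' = ten_enriched[OF X' T]
  note C = enriched_composable[OF X] enriched_composable[OF X']
  note hT = ten_id_nf[OF C h]
  note E = original_exp[OF XT] original_exp[OF XT'] original_exp[OF Y]
  note eh = exp_transport_ot[OF XT XT' hT] and ef = exp_transport_ot[OF XT' Y f]
  show ?thesis unfolding name_of_def
    by (simp only: exp_transport_followed_by[OF XT XT' Y hT f]
      followed_by_assoc[OF enriched_graph[OF X] E sections_exp_ot[OF X] eh ef, symmetric]
      sections_exp_natural[OF X X' h, symmetric]
      followed_by_assoc[OF enriched_graph[OF X] enriched_graph[OF X'] E(2,3) nf_ot[OF h] sections_exp_ot[OF X'] ef])
qed

lemma realization_natural_source:
  assumes X: "enriched V X" and X': "enriched V X'" and Y: "enriched V Y"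
    and h: "h \<in> natural_functors V X X'" and g: "g \<in> natural_functors V X' (exp_cat V T Y)"
  shows "realization_of V T X Y (followed_by V X h g) =
    followed_by V (ten_cat V X T) (ten_id V X T h) (realization_of V T X' Y g)"
proof -
  note G = enriched_graph[OF X] enriched_graph[OF X'] original_exp[OF Y]
  show ?thesis unfolding realization_of_def followed_by_ten_cat
    by (simp only: ten_id_followed_by[OF G nf_ot[OF h] nf_ot[OF g]]
      followed_by_assoc[OF original_ten[OF G(1) T_graph] original_ten[OF G(2) T_graph] original_ten[OF G(3) T_graph]
          enriched_graph[OF Y]
        ten_id_ot[OF G(1,2) nf_ot[OF h]] ten_id_ot[OF G(2,3) nf_ot[OF g]] evaluation_ot[OF Y]])
qed

lemma name_natural_target:
  assumes X: "enriched V X" and Y: "enriched V Y" and Y': "enriched V Y'"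
    and k: "k \<in> natural_functors V Y Y'" and f: "f \<in> natural_functors V (ten_cat V X T) Y"
  shows "name_of V T X Y' (followed_by V (ten_cat V X T) f k) =
    followed_by V X (name_of V T X Y f) (exp_transport V T Y Y' k)"
proof -
  note XT = ten_enriched[OF X T]
  show ?thesis unfolding name_of_def
    by (simp only: exp_transport_followed_by[OF XT Y Y' f k]
      followed_by_assoc[OF enriched_graph[OF X] original_exp[OF XT] original_exp[OF Y] original_exp[OF Y']
        sections_exp_ot[OF X] exp_transport_ot[OF XT Y f] exp_transport_ot[OF Y Y' k]])
qed

lemma realization_natural_target:
  assumes X: "enriched V X" and Y: "enriched V Y" and Y': "enriched V Y'"
    and k: "k \<in> natural_functors V Y Y'" and g: "g \<in> natural_functors V X (exp_cat V T Y)"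
  shows "realization_of V T X Y' (followed_by V X g (exp_transport V T Y Y' k)) =
    followed_by V (ten_cat V X T) (realization_of V T X Y g) k"
proof -
  note G = enriched_graph[OF X] original_exp[OF Y] original_exp[OF Y']
  note ek = exp_transport_ot[OF Y Y' k] and go = nf_ot[OF g]
  note TGs = original_ten[OF G(1) T_graph] original_ten[OF G(2) T_graph] original_ten[OF G(3) T_graph]
  show ?thesis unfolding realization_of_def followed_by_ten_cat
    by (simp only: ten_id_followed_by[OF G go ek]
      followed_by_assoc[OF TGs enriched_graph[OF Y'] ten_id_ot[OF G(1,2) go] ten_id_ot[OF G(2,3) ek] evaluation_ot[OF Y']]
      evaluation_natural[OF Y Y' k, unfolded followed_by_ten_cat]
      followed_by_assoc[OF TGs(1,2) enriched_graph[OF Y] enriched_graph[OF Y'] ten_id_ot[OF G(1,2) go] evaluation_ot[OF Y]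
          nf_ot[OF k]])
qed

lemma name_of_id:
  assumes X: "enriched V X"
  shows "name_of V T X (ten_cat V X T) (id_transport V (ten_cat V X T)) = sections_exp V T X"
  unfolding name_of_def exp_transport_id[OF ten_enriched[OF X T]]
  by (rule followed_by_id_right[OF enriched_graph[OF X] original_exp[OF ten_enriched[OF X T]] sections_exp_ot[OF X]])

lemma realization_of_id:
  assumes Y: "enriched V Y"
  shows "realization_of V T (exp_cat V T Y) Y (id_transport V (exp_cat V T Y)) = evaluation V T Y"
  unfolding realization_of_def followed_by_ten_cat ten_id_id[OF original_exp[OF Y]]
  by (rule followed_by_id_left[OF original_ten[OF original_exp[OF Y] T_graph] enriched_graph[OF Y] evaluation_ot[OF Y]])

text \<open>
  The composite is the realization of the name of the identity.
\<close>

lemma triangle_tensor: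
  assumes X: "enriched V X"
  shows "followed_by V (ten_cat V X T) (ten_id V X T (sections_exp V T X)) (evaluation V T (ten_cat V X T)) =
    id_transport V (ten_cat V X T)"
proof -
  note XT = ten_enriched[OF X T]
  show ?thesis
    using realization_name[OF X XT id_nf[OF enriched_composable[OF XT]]]
    unfolding name_of_id[OF X] realization_of_def .
qed

text \<open>
  The composite is the name of the realization of the identity.
\<close>

lemma triangle_exp:
  assumes Y: "enriched V Y"
  shows "followed_by V (exp_cat V T Y) (sections_exp V T (exp_cat V T Y))
           (exp_transport V T (ten_cat V (exp_cat V T Y) T) Y (evaluation V T Y)) = id_transport V (exp_cat V T Y)"
proof -
  note E = exp_enriched[OF Y]
  show ?thesis
    using name_realization[OF E Y id_nf[OF enriched_composable[OF E]]]
    unfolding realization_of_id[OF Y] name_of_def .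
qed

lemma name_bij:
  assumes X: "enriched V X" and Y: "enriched V Y"
  shows "bij_betw (name_of V T X Y) (natural_functors V (ten_cat V X T) Y) (natural_functors V X (exp_cat V T Y))"
    and "bij_betw (realization_of V T X Y) (natural_functors V X (exp_cat V T Y)) (natural_functors V (ten_cat V X T) Y)"
  using realization_name[OF X Y] name_realization[OF X Y] name_nf[OF X Y] realization_nf[OF X Y]
  by (auto intro!: bij_betw_byWitness[where f' = "realization_of V T X Y"] bij_betw_byWitness[where f' = "name_of V T X Y"])

end

theorem proposition8:
  fixes V :: "('o, 'm) relcat" and T :: "('s, 'o, 'm) vcat"
  assumes "infinite (UNIV :: 's set)"
    and "monoidal_closed V"
    and "small_complete TYPE('s) V"
    and "tensor_maintains_products TYPE('s) V"
    and "relator_involution V"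
    and "involution_natural_iso V"
    and "enriched V T"
  shows
    "((\<forall>X :: ('x1, 'o, 'm) vcat. enriched V X \<longrightarrow>
         enriched V (ten_cat V X T) \<and>
         ten_id V X T (id_transport V X) = id_transport V (ten_cat V X T)) \<and>
      (\<forall>(X :: ('x1, 'o, 'm) vcat) (Y :: ('x2, 'o, 'm) vcat).
         enriched V X \<and> enriched V Y \<longrightarrow>
         (\<forall>g \<in> natural_functors V X Y.
            ten_id V X T g \<in> natural_functors V (ten_cat V X T) (ten_cat V Y T))) \<and>
      (\<forall>(X :: ('x1, 'o, 'm) vcat) (Y :: ('x2, 'o, 'm) vcat) (Z :: ('x3, 'o, 'm) vcat).
         enriched V X \<and> enriched V Y \<and> enriched V Z \<longrightarrow>
         (\<forall>g \<in> natural_functors V X Y. \<forall>h \<in> natural_functors V Y Z.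
            ten_id V X T (followed_by V X g h) =
            followed_by V (ten_cat V X T) (ten_id V X T g) (ten_id V Y T h))))
     \<and>
     ((\<forall>Y :: ('y1, 'o, 'm) vcat. enriched V Y \<longrightarrow>
         enriched V (exp_cat V T Y) \<and>
         exp_incl V T Y \<in> natural_functors V (exp_cat V T Y) (pow_cat V T Y) \<and>
         exp_transport V T Y Y (id_transport V Y) = id_transport V (exp_cat V T Y)) \<and>
      (\<forall>(X :: ('y1, 'o, 'm) vcat) (Y :: ('y2, 'o, 'm) vcat).
         enriched V X \<and> enriched V Y \<longrightarrow>
         (\<forall>f \<in> natural_functors V X Y.
            pow_transport V T X Y f \<in> natural_functors V (pow_cat V T X) (pow_cat V T Y) \<and>
            exp_transport V T X Y f \<in> natural_functors V (exp_cat V T X) (exp_cat V T Y) \<and>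
            followed_by V (exp_cat V T X) (exp_transport V T X Y f) (exp_incl V T Y) =
            followed_by V (exp_cat V T X) (exp_incl V T X) (pow_transport V T X Y f))) \<and>
      (\<forall>(X :: ('y1, 'o, 'm) vcat) (Y :: ('y2, 'o, 'm) vcat) (Z :: ('y3, 'o, 'm) vcat).
         enriched V X \<and> enriched V Y \<and> enriched V Z \<longrightarrow>
         (\<forall>f \<in> natural_functors V X Y. \<forall>h \<in> natural_functors V Y Z.
            exp_transport V T X Z (followed_by V X f h) =
            followed_by V (exp_cat V T X) (exp_transport V T X Y f) (exp_transport V T Y Z h))))
     \<and>
     ((\<forall>X :: ('x1, 'o, 'm) vcat. enriched V X \<longrightarrow>
         sections_exp V T X \<in> natural_functors V X (exp_cat V T (ten_cat V X T)) \<and>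
         followed_by V X (sections_exp V T X) (exp_incl V T (ten_cat V X T)) = sections_pow V T X) \<and>
      (\<forall>(X :: ('x1, 'o, 'm) vcat) (Y :: ('x2, 'o, 'm) vcat).
         enriched V X \<and> enriched V Y \<longrightarrow>
         (\<forall>f \<in> natural_functors V X Y.
            followed_by V X f (sections_exp V T Y) =
            followed_by V X (sections_exp V T X)
              (exp_transport V T (ten_cat V X T) (ten_cat V Y T) (ten_id V X T f)))) \<and>
      (\<forall>(X :: ('x1, 'o, 'm, 'e1) ovgraph_scheme) (Y :: ('x2, 'o, 'm, 'e2) ovgraph_scheme).
         original_graph V X \<and> original_graph V Y \<longrightarrow>
         sections_pow V T X \<in> original_transports V X (pow_graph V T (ten_graph V X T)) \<and>
         (\<forall>f \<in> original_transports V X Y.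
            followed_by V X f (sections_pow V T Y) =
            followed_by V X (sections_pow V T X)
              (pow_transport V T (ten_graph V X T) (ten_graph V Y T) (ten_id V X T f)))))
     \<and>
     ((\<forall>Y :: ('y1, 'o, 'm) vcat. enriched V Y \<longrightarrow>
         evaluation V T Y \<in> natural_functors V (ten_cat V (exp_cat V T Y) T) Y) \<and>
      (\<forall>(Y :: ('y1, 'o, 'm) vcat) (Y' :: ('y2, 'o, 'm) vcat).
         enriched V Y \<and> enriched V Y' \<longrightarrow>
         (\<forall>g \<in> natural_functors V Y Y'.
            followed_by V (ten_cat V (exp_cat V T Y) T)
              (ten_id V (exp_cat V T Y) T (exp_transport V T Y Y' g)) (evaluation V T Y') =
            followed_by V (ten_cat V (exp_cat V T Y) T) (evaluation V T Y) g)))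
     \<and>
     ((\<forall>(X :: ('x1, 'o, 'm) vcat) (Y :: ('y1, 'o, 'm) vcat).
         enriched V X \<and> enriched V Y \<longrightarrow>
         bij_betw (name_of V T X Y)
           (natural_functors V (ten_cat V X T) Y) (natural_functors V X (exp_cat V T Y)) \<and>
         bij_betw (realization_of V T X Y)
           (natural_functors V X (exp_cat V T Y)) (natural_functors V (ten_cat V X T) Y) \<and>
         (\<forall>f \<in> natural_functors V (ten_cat V X T) Y.
            realization_of V T X Y (name_of V T X Y f) = f) \<and>
         (\<forall>g \<in> natural_functors V X (exp_cat V T Y).
            name_of V T X Y (realization_of V T X Y g) = g)) \<and>
      (\<forall>(X :: ('x1, 'o, 'm) vcat) (X' :: ('x2, 'o, 'm) vcat) (Y :: ('y1, 'o, 'm) vcat).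
         enriched V X \<and> enriched V X' \<and> enriched V Y \<longrightarrow>
         (\<forall>h \<in> natural_functors V X X'.
            (\<forall>f \<in> natural_functors V (ten_cat V X' T) Y.
               name_of V T X Y (followed_by V (ten_cat V X T) (ten_id V X T h) f) =
               followed_by V X h (name_of V T X' Y f)) \<and>
            (\<forall>g \<in> natural_functors V X' (exp_cat V T Y).
               realization_of V T X Y (followed_by V X h g) =
               followed_by V (ten_cat V X T) (ten_id V X T h) (realization_of V T X' Y g)))) \<and>
      (\<forall>(X :: ('x1, 'o, 'm) vcat) (Y :: ('y1, 'o, 'm) vcat) (Y' :: ('y2, 'o, 'm) vcat).
         enriched V X \<and> enriched V Y \<and> enriched V Y' \<longrightarrow>
         (\<forall>k \<in> natural_functors V Y Y'.
            (\<forall>f \<in> natural_functors V (ten_cat V X T) Y.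
               name_of V T X Y' (followed_by V (ten_cat V X T) f k) =
               followed_by V X (name_of V T X Y f) (exp_transport V T Y Y' k)) \<and>
            (\<forall>g \<in> natural_functors V X (exp_cat V T Y).
               realization_of V T X Y' (followed_by V X g (exp_transport V T Y Y' k)) =
               followed_by V (ten_cat V X T) (realization_of V T X Y g) k))))
     \<and>
     ((\<forall>X :: ('x1, 'o, 'm) vcat. enriched V X \<longrightarrow>
         name_of V T X (ten_cat V X T) (id_transport V (ten_cat V X T)) = sections_exp V T X \<and>
         followed_by V (ten_cat V X T)
           (ten_id V X T (sections_exp V T X)) (evaluation V T (ten_cat V X T)) =
         id_transport V (ten_cat V X T)) \<and>
      (\<forall>Y :: ('y1, 'o, 'm) vcat. enriched V Y \<longrightarrow>
         realization_of V T (exp_cat V T Y) Y (id_transport V (exp_cat V T Y)) = evaluation V T Y \<and>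
         followed_by V (exp_cat V T Y) (sections_exp V T (exp_cat V T Y))
           (exp_transport V T (ten_cat V (exp_cat V T Y) T) Y (evaluation V T Y)) =
         id_transport V (exp_cat V T Y)))"
proof -
  interpret power_base V "TYPE('s)" T
    using assms unfolding power_base_def power_base_axioms_def relator_category_def by blast
  show ?thesis
    (is "(?t1 \<and> ?t2 \<and> ?t3) \<and> (?e1 \<and> ?e2 \<and> ?e3) \<and> (?s1 \<and> ?s2 \<and> ?s3) \<and> (?v1 \<and> ?v2) \<and> (?n1 \<and> ?n2 \<and> ?n3) \<and> (?d1 \<and> ?d2)")
  proof (intro conjI)
    show ?t1
      by (simp add: id_ten_cat ten_id_id[OF enriched_graph] ten_enriched[OF _ T])
    show ?t2 using ten_id_nf[OF enriched_composable enriched_composable] by blast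
    show ?t3
      unfolding followed_by_ten_cat
      using ten_id_followed_by[OF enriched_graph enriched_graph enriched_graph nf_ot nf_ot] by blast
    show ?e1 using exp_enriched exp_incl_nf exp_transport_id by blast
    show ?e2 using pow_transport_nf[OF enriched_composable enriched_composable] exp_transport_nf exp_transport_restricts by blast
    show ?e3 using exp_transport_followed_by by blast
    show ?s1 using sections_exp_nf sections_exp_incl by blast
    show ?s2 using sections_exp_natural by blast
    show ?s3 using sections_pow_ot sections_pow_natural by blast
    show ?v1 using evaluation_nf by blast
    show ?v2 using evaluation_natural by blast
    show ?n1 using name_bij realization_name name_realization by blast
    show ?n2 using name_natural_source realization_natural_source by blast
    show ?n3 using name_natural_target realization_natural_target by blast
    show ?d1 using name_of_id triangle_tensor by blast
    show ?d2 using realization_of_id triangle_exp by blast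
  qed
qed

end
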